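(* Let $p>0$, $E>0$ and assume $u(\cdot,0)\in H^p(\mathbb{R}^n)$ with $\|u(\cdot,0)\|_{H^p}\le E$. Let $g=Au(\cdot,0)$, let $g^\delta\in L^2(\mathbb{R}^n)$ satisfy $\|g-g^\delta\|_{L^2}\le\delta$, and let $A_h:L^2(\mathbb{R}^n)\to L^2(\mathbb{R}^n)$ be a convolution operator, $A_h=\mathcal{F}^{-1}\psi_h(\xi)\mathcal{F}$, with operator norms satisfying $|||A-A_h|||\le h$ and $|||A_h|||\le1$. Let $$u_\beta^{\delta,h}=\underset{u\in L^2(\mathbb{R}^n)}{\mathrm{argmin}}\ \|A_hu-g^\delta\|_{L^2}^2+\|(I-C_\beta)u\|_{L^2}^2 ,$$ and put $q=p/(2\tau)$, $\rho=C(p)E$. Then there is a constant $\bar K$ independent of $\rho$, $\delta$ and $h$ such that, for $\beta(\delta,h)=(h+\delta/\rho)^{1/(2s)}$ and all sufficiently small $h+\delta/\rho$, $$\|u(\cdot,0)-u_{\beta(\delta,h)}^{\delta,h}\|_{L^2}\le\bar K\rho f_q\left((h+\delta/\rho)^2\right).$$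
   Context: Let $n\in\mathbb{N}$, $T>0$, $\tau\in(0,1]$, and let $\gamma:(0,T)\to(0,\infty)$ be integrable. The Fourier transform is $\hat f(\xi)=\mathcal{F}(f)(\xi)=\int_{\mathbb{R}^n} f(x)e^{-2\pi i x\cdot\xi}\,dx$. Put $\psi(\xi)=\exp\left(-|2\pi\xi|^{2\tau}\int_0^T\gamma(\lambda)\,d\lambda\right)$ and let $A:L^2(\mathbb{R}^n)\to L^2(\mathbb{R}^n)$ be $Af=\mathcal{F}^{-1}(\psi\hat f)$; $\bar A=A/\sqrt e$. The function $u(\cdot,0)\in L^2(\mathbb{R}^n)$ is the exact initial temperature, and $g=Au(\cdot,0)=u(\cdot,T)$ the exact final temperature. Kernel: $\phi\in L^1(\mathbb{R}^n)$ is smooth, real-valued, $\int_{\mathbb{R}^n}\phi=1$, $|\hat\phi(\xi)|<1$ for $\xi\ne0$, $\hat\phi$ is radially decreasing (decreasing along every ray from the origin), and for some $s>0$, $|1-\hat\phi(\xi)|\sim|\xi|^s$ as $\xi\to0$, where $a\sim b$ means that $a/b$ stays between two positive constants in the limit considered. For $\beta>0$, $\phi_\beta(x)=\beta^{-n}\phi(x/\beta)$ and $C_\beta f=\phi_\beta\star f$ on $L^2(\mathbb{R}^n)$; $I$ is the identity. $\|f\|_{H^p}^2=\int_{\mathbb{R}^n}(1+|\xi|^2)^p|\hat f(\xi)|^2\,d\xi$. For $q>0$, $f_q(\lambda)=(-\ln\lambda)^{-q}$, $\lambda\in(0,1)$; $f_q(\bar A^*\bar A)$ is given by functional calculus, i.e.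 it is the Fourier multiplier with symbol $f_q(\psi(\xi)^2/e)=\left(1+2|2\pi\xi|^{2\tau}\int_0^T\gamma(\lambda)\,d\lambda\right)^{-q}$. $C(p)>0$ denotes a constant depending on $p$ (not on $E$) such that every $v\in H^p(\mathbb{R}^n)$ with $\|v\|_{H^p}\le E$ can be written $v=f_q(\bar A^*\bar A)w$ with $q=p/(2\tau)$ and $\|w\|_{L^2}\le C(p)E$. *)

theory Defs
  imports "HOL-Analysis.Analysis" "HOL-Library.Landau_Symbols"
begin

(* Elements of L2 are represented by complex-valued Borel functions on real^'n, not by
   classes modulo null sets; operators on L2 act on representatives. *)

definition L2 :: "(real^'n \<Rightarrow> complex) set" where
  "L2 = {f \<in> borel_measurable lborel. integrable lborel (\<lambda>x. (cmod (f x))\<^sup>2)}"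

definition l2norm :: "(real^'n \<Rightarrow> complex) \<Rightarrow> real" where
  "l2norm f = sqrt (LINT x|lborel. (cmod (f x))\<^sup>2)"

(* Extended-real supremum, so that an unbounded operator has norm \<infinity>. *)
definition l2_opnorm :: "((real^'n \<Rightarrow> complex) \<Rightarrow> (real^'n \<Rightarrow> complex)) \<Rightarrow> ereal" where
  "l2_opnorm B = (SUP f\<in>{f \<in> L2. l2norm f \<le> 1}. ereal (l2norm (B f)))"

definition fourier :: "(real^'n \<Rightarrow> complex) \<Rightarrow> (real^'n \<Rightarrow> complex)" where
  "fourier f \<xi> = (LINT x|lborel. f x * exp (- 2 * of_real pi * \<i> * of_real (x \<bullet> \<xi>)))"

(* The Fourier transform on L2 is the L2-limit of the integral transforms of the truncations
   to balls; it is determined up to a null set. *)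
definition l2_fourier :: "(real^'n \<Rightarrow> complex) \<Rightarrow> (real^'n \<Rightarrow> complex)" where
  "l2_fourier f = (SOME F. F \<in> L2 \<and>
     ((\<lambda>R. l2norm (\<lambda>\<xi>. F \<xi> - fourier (\<lambda>x. indicator (cball 0 R) x *\<^sub>R f x) \<xi>)) \<longlongrightarrow> 0) at_top)"

definition l2_inv_fourier :: "(real^'n \<Rightarrow> complex) \<Rightarrow> (real^'n \<Rightarrow> complex)" where
  "l2_inv_fourier F = (SOME f. f \<in> L2 \<and> (AE \<xi> in lborel. l2_fourier f \<xi> = F \<xi>))"

definition fourier_multiplier ::
    "(real^'n \<Rightarrow> complex) \<Rightarrow> (real^'n \<Rightarrow> complex) \<Rightarrow> (real^'n \<Rightarrow> complex)" where
  "fourier_multiplier m f = l2_inv_fourier (\<lambda>\<xi>. m \<xi> * l2_fourier f \<xi>)"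

(* m is the symbol of a multiplier operator defined on all of L2 with values in L2. *)
definition l2_symbol :: "(real^'n \<Rightarrow> complex) \<Rightarrow> bool" where
  "l2_symbol m \<longleftrightarrow> m \<in> borel_measurable lborel \<and> (\<forall>f\<in>L2. (\<lambda>\<xi>. m \<xi> * l2_fourier f \<xi>) \<in> L2)"

definition sobolev :: "real \<Rightarrow> (real^'n \<Rightarrow> complex) set" where
  "sobolev p = {f \<in> L2. integrable lborel
     (\<lambda>\<xi>. (1 + (norm \<xi>)\<^sup>2) powr p * (cmod (l2_fourier f \<xi>))\<^sup>2)}"

definition sobolev_norm :: "real \<Rightarrow> (real^'n \<Rightarrow> complex) \<Rightarrow> real" where
  "sobolev_norm p f =
     sqrt (LINT \<xi>|lborel. (1 + (norm \<xi>)\<^sup>2) powr p * (cmod (l2_fourier f \<xi>))\<^sup>2)"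

fun differentiable_times :: "nat \<Rightarrow> (real^'n \<Rightarrow> real) \<Rightarrow> bool" where
  "differentiable_times 0 f \<longleftrightarrow> continuous_on UNIV f"
| "differentiable_times (Suc k) f \<longleftrightarrow> (\<forall>x. f differentiable (at x)) \<and>
     (\<forall>v. differentiable_times k (\<lambda>x. frechet_derivative f (at x) v))"

definition smooth :: "(real^'n \<Rightarrow> real) \<Rightarrow> bool" where
  "smooth f \<longleftrightarrow> (\<forall>k. differentiable_times k f)"

definition convolution ::
    "(real^'n \<Rightarrow> complex) \<Rightarrow> (real^'n \<Rightarrow> complex) \<Rightarrow> (real^'n \<Rightarrow> complex)" where
  "convolution f g x = (LINT y|lborel. f (x - y) * g y)"

definition dilate :: "real \<Rightarrow> (real^'n \<Rightarrow> real) \<Rightarrow> (real^'n \<Rightarrow> real)" where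
  "dilate \<beta> \<phi> x = \<phi> (x /\<^sub>R \<beta>) / \<beta> ^ CARD('n)"

definition mollify ::
    "(real^'n \<Rightarrow> real) \<Rightarrow> real \<Rightarrow> (real^'n \<Rightarrow> complex) \<Rightarrow> (real^'n \<Rightarrow> complex)" where
  "mollify \<phi> \<beta> f = convolution (\<lambda>x. complex_of_real (dilate \<beta> \<phi> x)) f"

definition heat_symbol :: "real \<Rightarrow> real \<Rightarrow> (real \<Rightarrow> real) \<Rightarrow> real^'n \<Rightarrow> real" where
  "heat_symbol T \<tau> \<gamma> \<xi> =
     exp (- (norm ((2 * pi) *\<^sub>R \<xi>) powr (2 * \<tau>) * (LINT l:{0<..<T}|lborel. \<gamma> l)))"

definition heat_op ::
    "real \<Rightarrow> real \<Rightarrow> (real \<Rightarrow> real) \<Rightarrow> (real^'n \<Rightarrow> complex) \<Rightarrow> (real^'n \<Rightarrow> complex)" where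
  "heat_op T \<tau> \<gamma> = fourier_multiplier (\<lambda>\<xi>. complex_of_real (heat_symbol T \<tau> \<gamma> \<xi>))"

definition log_index :: "real \<Rightarrow> real \<Rightarrow> real" where
  "log_index q t = (- ln t) powr (- q)"

(* log_index q applied by functional calculus to B* B, where B = heat_op / sqrt e: since B is the
   multiplier with the real symbol heat_symbol / sqrt e, B* B has symbol heat_symbol^2 / e. *)
definition source_op ::
    "real \<Rightarrow> real \<Rightarrow> (real \<Rightarrow> real) \<Rightarrow> real \<Rightarrow> (real^'n \<Rightarrow> complex) \<Rightarrow> (real^'n \<Rightarrow> complex)" where
  "source_op T \<tau> \<gamma> q =
     fourier_multiplier (\<lambda>\<xi>. complex_of_real (log_index q ((heat_symbol T \<tau> \<gamma> \<xi>)\<^sup>2 / exp 1)))"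

definition objective ::
    "((real^'n \<Rightarrow> complex) \<Rightarrow> (real^'n \<Rightarrow> complex)) \<Rightarrow> (real^'n \<Rightarrow> real) \<Rightarrow> real \<Rightarrow>
     (real^'n \<Rightarrow> complex) \<Rightarrow> (real^'n \<Rightarrow> complex) \<Rightarrow> real" where
  "objective B \<phi> \<beta> g u =
     (l2norm (\<lambda>x. B u x - g x))\<^sup>2 + (l2norm (\<lambda>x. u x - mollify \<phi> \<beta> u x))\<^sup>2"

end

(* By Plancherel's theorem the objective becomes a pointwise quadratic in the Fourier transform U of u.
   Completing the square, its unique minimiser is U = cnj psi_h * G / D with
   D = |psi_h|^2 + |1 - phi^(beta .)|^2, where G is the transform of the data. The error splits into
   |1 - phi^(beta .)|^2 / D applied to the source element and into two terms with the factor
   |psi_h| / D. With eps = h + delta/rho and beta^s = eps^(1/2) that factor is O(eps^(-1/2)): either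
   |xi| < 1 and psi_h is bounded below, or |1 - phi^| >= c eps^(1/2). For the first term put
   sigma = -ln psi: where sigma >= ln(1/eps)/4 the logarithmic source condition gives the rate, and
   elsewhere psi_h >= eps^(1/4)/2 makes the quotient a power of eps. *)
theory Submission
  imports "HOL-Probability.Characteristic_Functions" "HOL-Real_Asymp.Real_Asymp" Defs
begin

subsection \<open>The space of square integrable functions\<close>

text \<open>The sum eps = h + delta/rho is forced by the two terms with factor |psi_h| / D. Since
  f_q(psi^2/e) <= 1, the source element w dominates the transform of u(.,0), so the operator error
  is at most h * rho; the data error is at most delta, and together they make rho * eps. Times
  O(eps^(-1/2)) this is O(rho * eps^(1/2)), eventually below any power of 1/ln(1/eps), so only the
  source term is of logarithmic size. Evaluating f_q at eps^2 instead of eps costs the factor 2^q.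
  The hypothesis on operators becomes pointwise because the norm of a multiplier bounds its symbol:
  |psi - psi_h| <= h off a null set. Radial monotonicity of phi^ carries the lower bound on |1 -
  phi^| from a small ball out to infinity. What shapes the first half is that
  \<open>l2_fourier\<close> and \<open>l2_inv_fourier\<close> are arbitrary choices of
  representatives. Their properties are recovered from existence and a.e. uniqueness of L2 limits,
  so pointwise identities on the frequency side hold only almost everywhere.\<close>

lemma integrable_le:
  fixes f :: "'b \<Rightarrow> 'c::{banach, second_countable_topology}"
  assumes "integrable M g" "f \<in> borel_measurable M" "\<And>x. norm (f x) \<le> (g x :: real)"
  shows "integrable M f"
  using assms(1,2)
proof (rule Bochner_Integration.integrable_bound)
  show "AE x in M. norm (f x) \<le> norm (g x)"
    using order_trans[OF assms(3) abs_ge_self] by simp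
qed

lemma L2D:
  assumes "f \<in> L2"
  shows L2_measurable: "f \<in> borel_measurable borel"
    and L2_integrable: "integrable lborel (\<lambda>x. (cmod (f x))\<^sup>2)"
  using assms by (auto simp: L2_def)

lemma L2I:
  assumes "f \<in> borel_measurable borel" "integrable lborel (\<lambda>x. (cmod (f x))\<^sup>2)"
  shows "f \<in> L2"
  using assms by (auto simp: L2_def)

lemma l2norm_nonneg [simp]: "0 \<le> l2norm f"
  by (simp add: l2norm_def)

lemma l2norm_power2: "(l2norm f)\<^sup>2 = (LINT x|lborel. (cmod (f x))\<^sup>2)"
  by (simp add: l2norm_def)

lemma L2_mono_AE:
  fixes f g :: "real^'n \<Rightarrow> complex"
  assumes "g \<in> L2" "f \<in> borel_measurable borel" "AE x in lborel. cmod (f x) \<le> cmod (g x)"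
  shows "f \<in> L2" "l2norm f \<le> l2norm g"
proof -
  have *: "AE x in lborel. (cmod (f x))\<^sup>2 \<le> (cmod (g x))\<^sup>2"
    using assms(3) by eventually_elim (auto intro: power_mono)
  have [measurable]: "f \<in> borel_measurable borel" by fact
  have int: "integrable lborel (\<lambda>x. (cmod (f x))\<^sup>2)"
    by (rule Bochner_Integration.integrable_bound[OF L2_integrable[OF assms(1)]]) (use * in auto)
  then show "f \<in> L2" using assms(2) by (rule L2I[rotated])
  show "l2norm f \<le> l2norm g"
    unfolding l2norm_def using int L2_integrable[OF assms(1)] * by (auto intro: integral_mono_AE)
qed

lemma L2_cong_AE:
  fixes f g :: "real^'n \<Rightarrow> complex"
  assumes "f \<in> L2" "g \<in> borel_measurable borel" "AE x in lborel. f x = g x"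
  shows "g \<in> L2"
  by (rule L2_mono_AE(1)[OF assms(1,2)]) (use assms(3) in \<open>eventually_elim, auto\<close>)

lemma l2norm_cong_AE:
  fixes f g :: "real^'n \<Rightarrow> complex"
  assumes "f \<in> borel_measurable borel" "g \<in> borel_measurable borel"
    and "AE x in lborel. cmod (f x) = cmod (g x)"
  shows "l2norm f = l2norm g"
proof -
  have [measurable]: "f \<in> borel_measurable borel" "g \<in> borel_measurable borel" by fact+
  show ?thesis unfolding l2norm_def
    by (intro arg_cong[where f=sqrt] integral_cong_AE) (use assms(3) in auto)
qed

lemma L2_mult_integrable:
  fixes f g :: "real^'n \<Rightarrow> complex"
  assumes "f \<in> L2" "g \<in> L2"
  shows "integrable lborel (\<lambda>x. f x * g x)"
proof (rule integrable_le)
  note [measurable] = L2_measurable[OF assms(1)] L2_measurable[OF assms(2)]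
  show "integrable lborel (\<lambda>x. (cmod (f x))\<^sup>2 + (cmod (g x))\<^sup>2)"
    using assms[THEN L2_integrable] by simp
  show "(\<lambda>x. f x * g x) \<in> borel_measurable lborel" by simp
  fix x
  have "0 \<le> cmod (f x) * cmod (g x)" by simp
  then have "cmod (f x) * cmod (g x) \<le> (cmod (f x))\<^sup>2 + (cmod (g x))\<^sup>2"
    using sum_squares_bound[of "cmod (f x)" "cmod (g x)"] by linarith
  then show "norm (f x * g x) \<le> (cmod (f x))\<^sup>2 + (cmod (g x))\<^sup>2" by (simp add: norm_mult)
qed

lemma L2_add:
  fixes f g :: "real^'n \<Rightarrow> complex"
  assumes "f \<in> L2" "g \<in> L2"
  shows "(\<lambda>x. f x + g x) \<in> L2"
proof (rule L2I)
  note [measurable] = L2_measurable[OF assms(1)] L2_measurable[OF assms(2)]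
  show "(\<lambda>x. f x + g x) \<in> borel_measurable borel" by simp
  show "integrable lborel (\<lambda>x. (cmod (f x + g x))\<^sup>2)"
  proof (rule integrable_le)
    show "integrable lborel (\<lambda>x. 2 * (cmod (f x))\<^sup>2 + 2 * (cmod (g x))\<^sup>2)"
      using assms[THEN L2_integrable] by simp
    fix x
    have "(cmod (f x + g x))\<^sup>2 \<le> (cmod (f x) + cmod (g x))\<^sup>2"
      by (intro power_mono norm_triangle_ineq) auto
    also have "\<dots> \<le> 2 * (cmod (f x))\<^sup>2 + 2 * (cmod (g x))\<^sup>2"
      using sum_squares_bound[of "cmod (f x)" "cmod (g x)"] by (simp add: power2_sum)
    finally show "norm ((cmod (f x + g x))\<^sup>2) \<le> 2 * (cmod (f x))\<^sup>2 + 2 * (cmod (g x))\<^sup>2" by simp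
  qed simp
qed

lemma L2_mult_const:
  assumes "f \<in> L2"
  shows "(\<lambda>x. c * f x) \<in> L2"
  using L2D[OF assms] by (auto intro!: L2I simp: norm_mult power_mult_distrib)

lemma l2norm_mult_const: "l2norm (\<lambda>x. c * f x) = cmod c * l2norm f"
  by (simp add: l2norm_def norm_mult power_mult_distrib real_sqrt_mult)

lemma L2_diff:
  fixes f g :: "real^'n \<Rightarrow> complex"
  assumes "f \<in> L2" "g \<in> L2"
  shows "(\<lambda>x. f x - g x) \<in> L2"
  using L2_add[OF assms(1) L2_mult_const[OF assms(2), of "-1"]] by simp

lemma measurable_cnj [measurable (raw)]:
  "f \<in> borel_measurable M \<Longrightarrow> (\<lambda>x. cnj (f x)) \<in> borel_measurable M"
  by (rule borel_measurable_continuous_on[OF continuous_on_cnj[OF continuous_on_id]])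

lemma L2_cnj: "f \<in> L2 \<Longrightarrow> (\<lambda>x. cnj (f x)) \<in> L2"
  using L2D[of f] by (intro L2I measurable_cnj) auto

lemma L2_zero [simp]: "(\<lambda>x. 0) \<in> L2"
  by (auto intro: L2I)

lemma l2norm_minus_commute: "l2norm (\<lambda>x. f x - g x) = l2norm (\<lambda>x. g x - f x)"
  by (simp add: l2norm_def norm_minus_commute)

section \<open>Inner product and triangle inequalities\<close>

lemma L2_Cauchy_Schwarz:
  fixes f g :: "real^'n \<Rightarrow> complex"
  assumes "f \<in> L2" "g \<in> L2"
  shows "(LINT x|lborel. cmod (f x) * cmod (g x)) \<le> l2norm f * l2norm g"
proof -
  note [measurable] = L2_measurable[OF assms(1)] L2_measurable[OF assms(2)]
  let ?I = "LINT x|lborel. cmod (f x) * cmod (g x)"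
  have int: "integrable lborel (\<lambda>x. cmod (f x) * cmod (g x))"
    using integrable_norm[OF L2_mult_integrable[OF assms]] by (simp add: norm_mult)
  have nn: "0 \<le> ?I" by simp
  have "(ennreal ?I)\<^sup>2 = (\<integral>\<^sup>+x. ennreal (cmod (f x)) * ennreal (cmod (g x)) \<partial>lborel)\<^sup>2"
    by (subst nn_integral_eq_integral[symmetric, OF int]) (auto simp: ennreal_mult)
  also have "\<dots> \<le> (\<integral>\<^sup>+x. (ennreal (cmod (f x)))\<^sup>2 \<partial>lborel) * (\<integral>\<^sup>+x. (ennreal (cmod (g x)))\<^sup>2 \<partial>lborel)"
    by (rule Cauchy_Schwarz_nn_integral) auto
  also have "\<dots> = ennreal ((l2norm f)\<^sup>2) * ennreal ((l2norm g)\<^sup>2)"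
    using assms[THEN L2_integrable] by (simp add: ennreal_power nn_integral_eq_integral l2norm_power2)
  finally have "?I\<^sup>2 \<le> (l2norm f * l2norm g)\<^sup>2"
    using nn by (simp add: ennreal_power ennreal_mult[symmetric] power_mult_distrib)
  then show ?thesis by (rule power2_le_imp_le) simp
qed

lemma norm_integral_mult_le_l2norm:
  fixes f g :: "real^'n \<Rightarrow> complex"
  assumes "f \<in> L2" "g \<in> L2"
  shows "cmod (LINT x|lborel. f x * g x) \<le> l2norm f * l2norm g"
  using integral_norm_bound[of lborel "\<lambda>x. f x * g x"] L2_Cauchy_Schwarz[OF assms]
  by (simp add: norm_mult)

lemma l2norm_triangle:
  fixes f g :: "real^'n \<Rightarrow> complex"
  assumes "f \<in> L2" "g \<in> L2"
  shows "l2norm (\<lambda>x. f x + g x) \<le> l2norm f + l2norm g"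
proof (rule power2_le_imp_le)
  have int: "integrable lborel (\<lambda>x. cmod (f x) * cmod (g x))"
    using integrable_norm[OF L2_mult_integrable[OF assms]] by (simp add: norm_mult)
  note ints = assms[THEN L2_integrable] int
  have "(l2norm (\<lambda>x. f x + g x))\<^sup>2 \<le> (LINT x|lborel. (cmod (f x))\<^sup>2 + (cmod (g x))\<^sup>2 + 2 * (cmod (f x) * cmod (g x)))"
    unfolding l2norm_power2
  proof (intro integral_mono)
    show "integrable lborel (\<lambda>x. (cmod (f x + g x))\<^sup>2)" by (rule L2_integrable[OF L2_add[OF assms]])
    show "integrable lborel (\<lambda>x. (cmod (f x))\<^sup>2 + (cmod (g x))\<^sup>2 + 2 * (cmod (f x) * cmod (g x)))" using ints by simp
    fix x
    have "(cmod (f x + g x))\<^sup>2 \<le> (cmod (f x) + cmod (g x))\<^sup>2"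
      by (intro power_mono norm_triangle_ineq) auto
    then show "(cmod (f x + g x))\<^sup>2 \<le> (cmod (f x))\<^sup>2 + (cmod (g x))\<^sup>2 + 2 * (cmod (f x) * cmod (g x))"
      by (simp add: power2_sum)
  qed
  also have "\<dots> = (l2norm f)\<^sup>2 + (l2norm g)\<^sup>2 + 2 * (LINT x|lborel. cmod (f x) * cmod (g x))"
    using ints by (simp add: l2norm_power2)
  also have "\<dots> \<le> (l2norm f + l2norm g)\<^sup>2"
    using L2_Cauchy_Schwarz[OF assms] by (simp add: power2_sum)
  finally show "(l2norm (\<lambda>x. f x + g x))\<^sup>2 \<le> (l2norm f + l2norm g)\<^sup>2" .
qed simp

lemma l2norm_triangle_diff:
  fixes f g h :: "real^'n \<Rightarrow> complex"
  assumes "f \<in> L2" "g \<in> L2" "h \<in> L2"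
  shows "l2norm (\<lambda>x. f x - h x) \<le> l2norm (\<lambda>x. f x - g x) + l2norm (\<lambda>x. g x - h x)"
  using l2norm_triangle[OF L2_diff[OF assms(1,2)] L2_diff[OF assms(2,3)]] by simp

lemma l2norm_diff_triangle_abs:
  fixes f g :: "real^'n \<Rightarrow> complex"
  assumes "f \<in> L2" "g \<in> L2"
  shows "\<bar>l2norm f - l2norm g\<bar> \<le> l2norm (\<lambda>x. f x - g x)"
  using l2norm_triangle[OF L2_diff[OF assms] assms(2)]
    l2norm_triangle[OF L2_diff[OF assms(2,1)] assms(1)]
  by (simp add: l2norm_minus_commute[of f g])

section \<open>Convergence and completeness in L2\<close>

lemma l2norm_tendsto:
  fixes f :: "'b \<Rightarrow> real^'n \<Rightarrow> complex"
  assumes "\<And>k. f k \<in> L2" "F \<in> L2" "((\<lambda>k. l2norm (\<lambda>x. f k x - F x)) \<longlongrightarrow> 0) net"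
  shows "((\<lambda>k. l2norm (f k)) \<longlongrightarrow> l2norm F) net"
proof (rule Lim_transform)
  show "((\<lambda>k. l2norm F) \<longlongrightarrow> l2norm F) net" by simp
  show "((\<lambda>k. l2norm (f k) - l2norm F) \<longlongrightarrow> 0) net"
    using assms(3)
  proof (rule Lim_null_comparison[rotated], intro always_eventually allI)
    fix k show "norm (l2norm (f k) - l2norm F) \<le> l2norm (\<lambda>x. f k x - F x)"
      using l2norm_diff_triangle_abs[OF assms(1,2), of k] by simp
  qed
qed

lemma l2norm_eq_0D:
  fixes f :: "real^'n \<Rightarrow> complex"
  assumes "f \<in> L2" "l2norm f = 0"
  shows "AE x in lborel. f x = 0"
proof -
  have "(LINT x|lborel. (cmod (f x))\<^sup>2) = 0" using assms(2) by (simp add: l2norm_def)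
  then have "AE x in lborel. (cmod (f x))\<^sup>2 = 0"
    using integral_nonneg_eq_0_iff_AE[OF L2_integrable[OF assms(1)]] by simp
  then show ?thesis by simp
qed

lemma l2norm_diff_eq_0D:
  fixes f g :: "real^'n \<Rightarrow> complex"
  assumes "f \<in> L2" "g \<in> L2" "l2norm (\<lambda>x. f x - g x) = 0"
  shows "AE x in lborel. f x = g x"
  using l2norm_eq_0D[OF L2_diff[OF assms(1,2)] assms(3)] by simp

lemma L2_limit_unique:
  fixes f :: "'b \<Rightarrow> real^'n \<Rightarrow> complex"
  assumes "net \<noteq> bot" "\<And>k. f k \<in> L2" "F \<in> L2" "G \<in> L2"
    and "((\<lambda>k. l2norm (\<lambda>x. f k x - F x)) \<longlongrightarrow> 0) net"
    and "((\<lambda>k. l2norm (\<lambda>x. f k x - G x)) \<longlongrightarrow> 0) net"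
  shows "AE x in lborel. F x = G x"
proof (rule l2norm_diff_eq_0D[OF assms(3,4)])
  have "((\<lambda>k. l2norm (\<lambda>x. f k x - F x) + l2norm (\<lambda>x. f k x - G x)) \<longlongrightarrow> 0 + 0) net"
    using assms(5,6) by (rule tendsto_add)
  moreover have "l2norm (\<lambda>x. F x - G x) \<le> l2norm (\<lambda>x. f k x - F x) + l2norm (\<lambda>x. f k x - G x)" for k
    using l2norm_triangle_diff[OF assms(3,2,4)] by (simp add: l2norm_minus_commute[of F])
  ultimately have "l2norm (\<lambda>x. F x - G x) \<le> 0 + 0"
    using assms(1) by (intro tendsto_lowerbound) (auto intro!: always_eventually)
  then show "l2norm (\<lambda>x. F x - G x) = 0" using l2norm_nonneg[of "\<lambda>x. F x - G x"] by linarith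
qed

text \<open>Fatou's lemma for the squared moduli. It carries norm bounds to limits known only
  pointwise, as happens for the subsequence in the completeness proof and for the transforms of
  truncations in Plancherel's theorem.\<close>

lemma L2_Fatou:
  fixes s :: "nat \<Rightarrow> real^'n \<Rightarrow> complex"
  assumes "\<And>k. s k \<in> L2" and bd: "\<And>k. l2norm (s k) \<le> C"
    and F[measurable]: "F \<in> borel_measurable borel" and lim: "AE x in lborel. (\<lambda>k. s k x) \<longlonglongrightarrow> F x"
  shows "F \<in> L2" "l2norm F \<le> C"
proof -
  note [measurable] = L2_measurable[OF assms(1)]
  have C: "0 \<le> C" using bd[of 0] l2norm_nonneg[of "s 0"] by linarith
  have "(\<integral>\<^sup>+x. ennreal ((cmod (F x))\<^sup>2) \<partial>lborel) = (\<integral>\<^sup>+x. liminf (\<lambda>k. ennreal ((cmod (s k x))\<^sup>2)) \<partial>lborel)"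
  proof (rule nn_integral_cong_AE, use lim in eventually_elim)
    fix x assume "(\<lambda>k. s k x) \<longlonglongrightarrow> F x"
    then have "(\<lambda>k. ennreal ((cmod (s k x))\<^sup>2)) \<longlonglongrightarrow> ennreal ((cmod (F x))\<^sup>2)"
      by (intro tendsto_intros)
    then show "ennreal ((cmod (F x))\<^sup>2) = liminf (\<lambda>k. ennreal ((cmod (s k x))\<^sup>2))"
      by (rule lim_imp_Liminf[symmetric, OF trivial_limit_sequentially])
  qed
  also have "\<dots> \<le> liminf (\<lambda>k. (\<integral>\<^sup>+x. ennreal ((cmod (s k x))\<^sup>2) \<partial>lborel))"
    by (rule nn_integral_liminf) simp
  also have "\<dots> = liminf (\<lambda>k. ennreal ((l2norm (s k))\<^sup>2))"
    using L2_integrable[OF assms(1)] by (simp add: nn_integral_eq_integral l2norm_power2)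
  also have "\<dots> \<le> liminf (\<lambda>k. ennreal (C\<^sup>2))"
    using bd by (intro Liminf_mono always_eventually allI ennreal_leI power_mono) auto
  also have "\<dots> = ennreal (C\<^sup>2)" by (simp add: Liminf_const)
  finally have le: "(\<integral>\<^sup>+x. ennreal ((cmod (F x))\<^sup>2) \<partial>lborel) \<le> ennreal (C\<^sup>2)" .
  then have int: "integrable lborel (\<lambda>x. (cmod (F x))\<^sup>2)"
    by (intro integrableI_bounded) (auto simp: top.extremum_unique le_less_trans[OF _ ennreal_less_top])
  then show "F \<in> L2" by (intro L2I) auto
  have "(l2norm F)\<^sup>2 \<le> C\<^sup>2"
    using le C int by (simp add: nn_integral_eq_integral l2norm_power2)
  then show "l2norm F \<le> C" using C by (rule power2_le_imp_le)
qed

text \<open>Riesz-Fischer: a subsequence with geometrically small increments converges almost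
  everywhere, and Fatou's lemma upgrades this to convergence in norm of the whole sequence.\<close>

lemma L2_complete:
  fixes s :: "nat \<Rightarrow> real^'n \<Rightarrow> complex"
  assumes L2: "\<And>k. s k \<in> L2"
    and Cauchy: "\<And>e. e > 0 \<Longrightarrow> \<exists>N. \<forall>m\<ge>N. \<forall>n\<ge>N. l2norm (\<lambda>x. s m x - s n x) \<le> e"
  obtains F where "F \<in> L2" "(\<lambda>k. l2norm (\<lambda>x. s k x - F x)) \<longlonglongrightarrow> 0"
proof -
  note [measurable] = L2_measurable[OF L2]
  have "\<exists>N. \<forall>k. \<forall>m\<ge>N k. \<forall>n\<ge>N k. l2norm (\<lambda>x. s m x - s n x) \<le> (1/2)^k"
    by (intro choice allI Cauchy) simp
  then obtain N where N: "\<And>k m n. m \<ge> N k \<Longrightarrow> n \<ge> N k \<Longrightarrow> l2norm (\<lambda>x. s m x - s n x) \<le> (1/2)^k"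
    by blast
  \<comment> \<open>The maximum makes the index sequence nondecreasing while keeping it above each
    threshold \<open>N k\<close>.\<close>
  define r where "r = rec_nat (N 0) (\<lambda>k a. max a (N (Suc k)))"
  have r_Suc: "r (Suc k) = max (r k) (N (Suc k))" for k by (simp add: r_def)
  have r_ge: "N k \<le> r k" for k by (cases k) (auto simp: r_def)
  have r_mono: "r k \<le> r j" if "k \<le> j" for k j
    using that by (rule lift_Suc_mono_le[rotated]) (simp add: r_Suc)
  define d where "d k x = cmod (s (r (Suc k)) x - s (r k) x)" for k x
  have [measurable]: "d k \<in> borel_measurable borel" for k unfolding d_def by simp
  have d_int: "(\<integral>\<^sup>+x. ennreal ((d k x)\<^sup>2) \<partial>lborel) \<le> ennreal ((1/4)^k)" for k
  proof -
    have "(\<integral>\<^sup>+x. ennreal ((d k x)\<^sup>2) \<partial>lborel) = ennreal ((l2norm (\<lambda>x. s (r (Suc k)) x - s (r k) x))\<^sup>2)"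
      unfolding d_def l2norm_power2
      by (intro nn_integral_eq_integral L2_integrable L2_diff L2) auto
    also have "\<dots> \<le> ennreal (((1/2)^k)\<^sup>2)"
      by (intro ennreal_leI power_mono N order_trans[OF r_ge r_mono]) auto
    also have "((1/2::real)^k)\<^sup>2 = (1/4)^k"
      by (simp add: power2_eq_square power_mult_distrib[symmetric])
    finally show ?thesis .
  qed
  \<comment> \<open>The squared increments have integrals at most 4^-k, so the weight 2^k still
    leaves a convergent series. Its a.e. finiteness forces the squared increments below 2^-k
    eventually, hence summability of the increments themselves.\<close>
  have "(\<integral>\<^sup>+x. (\<Sum>k. ennreal (2^k * (d k x)\<^sup>2)) \<partial>lborel) = (\<Sum>k. \<integral>\<^sup>+x. ennreal (2^k * (d k x)\<^sup>2) \<partial>lborel)"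
    by (rule nn_integral_suminf) simp
  also have "\<dots> = (\<Sum>k. ennreal (2^k) * (\<integral>\<^sup>+x. ennreal ((d k x)\<^sup>2) \<partial>lborel))"
    by (simp add: ennreal_mult nn_integral_cmult)
  also have "\<dots> \<le> (\<Sum>k. ennreal ((1/2)^k))"
  proof (intro suminf_le summableI)
    fix k :: nat
    have "ennreal (2^k) * (\<integral>\<^sup>+x. ennreal ((d k x)\<^sup>2) \<partial>lborel) \<le> ennreal (2^k) * ennreal ((1/4)^k)"
      by (intro mult_left_mono d_int) simp
    also have "\<dots> = ennreal ((1/2)^k)"
      by (simp add: ennreal_mult[symmetric] power_mult_distrib[symmetric])
    finally show "ennreal (2^k) * (\<integral>\<^sup>+x. ennreal ((d k x)\<^sup>2) \<partial>lborel) \<le> ennreal ((1/2)^k)" .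
  qed
  also have "\<dots> < \<infinity>"
    by (subst suminf_ennreal2) (auto intro: summable_geometric)
  finally have "(\<integral>\<^sup>+x. (\<Sum>k. ennreal (2^k * (d k x)\<^sup>2)) \<partial>lborel) \<noteq> \<infinity>" by simp
  then have AE_fin: "AE x in lborel. (\<Sum>k. ennreal (2^k * (d k x)\<^sup>2)) \<noteq> \<infinity>"
    by (rule nn_integral_PInf_AE[rotated]) simp
  have conv: "AE x in lborel. convergent (\<lambda>k. s (r k) x)"
    using AE_fin
  proof eventually_elim
    fix x assume "(\<Sum>k. ennreal (2^k * (d k x)\<^sup>2)) \<noteq> \<infinity>"
    then have "summable (\<lambda>k. 2^k * (d k x)\<^sup>2)"
      by (intro summable_suminf_not_top) auto
    then have "(\<lambda>k. 2^k * (d k x)\<^sup>2) \<longlonglongrightarrow> 0" by (rule summable_LIMSEQ_zero)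
    then have ev: "eventually (\<lambda>k. 2^k * (d k x)\<^sup>2 < 1) sequentially"
      by (rule order_tendstoD) simp
    have "summable (\<lambda>k. d k x)"
    proof (rule summable_comparison_test_ev)
      show "summable (\<lambda>k. (1 / sqrt 2) ^ k)"
        by (rule summable_geometric) auto
      show "\<forall>\<^sub>F k in sequentially. norm (d k x) \<le> (1 / sqrt 2) ^ k"
        using ev
      proof eventually_elim
        fix k assume "2^k * (d k x)\<^sup>2 < 1"
        then have "(d k x)\<^sup>2 \<le> 1 / 2^k" by (simp add: field_simps)
        also have "\<dots> = ((1 / sqrt 2) ^ k)\<^sup>2"
          by (simp add: power_divide power_mult[symmetric] mult.commute[of k] power_mult)
        finally have "d k x \<le> (1 / sqrt 2) ^ k" by (rule power2_le_imp_le) simp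
        then show "norm (d k x) \<le> (1 / sqrt 2) ^ k" by (simp add: d_def)
      qed
    qed
    then have "summable (\<lambda>k. s (r (Suc k)) x - s (r k) x)"
      unfolding d_def by (rule summable_norm_cancel)
    then have "convergent (\<lambda>n. \<Sum>k<n. s (r (Suc k)) x - s (r k) x)"
      by (simp add: summable_iff_convergent)
    then have "convergent (\<lambda>n. s (r n) x - s (r 0) x)"
      by (simp add: sum_lessThan_telescope[of "\<lambda>k. s (r k) x"])
    then have "convergent (\<lambda>n. (s (r n) x - s (r 0) x) + s (r 0) x)"
      by (rule convergent_add) (rule convergent_const)
    then show "convergent (\<lambda>k. s (r k) x)" by simp
  qed
  \<comment> \<open>On the null set where the subsequence diverges, \<open>lim\<close> is an
    unspecified value; measurability is unaffected.\<close>
  define F where "F x = lim (\<lambda>k. s (r k) x)" for x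
  have F[measurable]: "F \<in> borel_measurable borel" unfolding F_def by measurable
  have lim: "AE x in lborel. (\<lambda>k. s (r k) x) \<longlonglongrightarrow> F x"
    using conv unfolding F_def by eventually_elim (simp add: convergent_LIMSEQ_iff)
  \<comment> \<open>Fatou with \<open>m\<close> fixed and \<open>j\<close> tending to infinity: the
    subsequence from \<open>r k\<close> onwards stays within 2^-k of \<open>s m\<close>.\<close>
  have bd: "(\<lambda>x. s m x - F x) \<in> L2 \<and> l2norm (\<lambda>x. s m x - F x) \<le> (1/2)^k" if "m \<ge> r k" for m k
  proof -
    have 1: "(\<lambda>x. s m x - s (r (j + k)) x) \<in> L2" for j by (intro L2_diff L2)
    have 2: "l2norm (\<lambda>x. s m x - s (r (j + k)) x) \<le> (1/2)^k" for j
      using that r_ge[of k] r_mono[of k "j + k"] by (intro N) auto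
    have 3: "AE x in lborel. (\<lambda>j. s m x - s (r (j + k)) x) \<longlonglongrightarrow> s m x - F x"
      using lim
    proof eventually_elim
      fix x assume "(\<lambda>k. s (r k) x) \<longlonglongrightarrow> F x"
      then have "(\<lambda>j. s (r (j + k)) x) \<longlonglongrightarrow> F x" by (rule LIMSEQ_ignore_initial_segment)
      then show "(\<lambda>j. s m x - s (r (j + k)) x) \<longlonglongrightarrow> s m x - F x" by (intro tendsto_intros)
    qed
    show ?thesis using L2_Fatou[OF 1 2 _ 3] by simp
  qed
  show ?thesis
  proof
    show "F \<in> L2"
      using L2_diff[OF L2[of "r 0"] bd[OF order_refl, of 0, THEN conjunct1]] by simp
    show "(\<lambda>k. l2norm (\<lambda>x. s k x - F x)) \<longlonglongrightarrow> 0"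
    proof (rule LIMSEQ_I)
      fix e :: real assume "0 < e"
      then obtain k where k: "(1/2::real)^k < e" using real_arch_pow_inv[of e "1/2"] by auto
      then show "\<exists>no. \<forall>n\<ge>no. norm (l2norm (\<lambda>x. s n x - F x) - 0) < e"
        using bd[of k] by (intro exI[of _ "r k"]) (auto intro: le_less_trans)
    qed
  qed
qed

subsection \<open>The Fourier transform of integrable functions\<close>

definition fourier_char :: "real^'n \<Rightarrow> real^'n \<Rightarrow> complex" where
  "fourier_char x \<xi> = exp (- 2 * of_real pi * \<i> * of_real (x \<bullet> \<xi>))"

lemma fourier_eq: "fourier f \<xi> = (LINT x|lborel. f x * fourier_char x \<xi>)"
  by (simp add: fourier_def fourier_char_def)

lemma norm_fourier_char [simp]: "cmod (fourier_char x \<xi>) = 1"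
  by (simp add: fourier_char_def)

lemma fourier_char_commute: "fourier_char x \<xi> = fourier_char \<xi> x"
  by (simp add: fourier_char_def inner_commute)

lemma fourier_char_add: "fourier_char (x + y) \<xi> = fourier_char x \<xi> * fourier_char y \<xi>"
  by (simp add: fourier_char_def inner_add_left exp_add[symmetric] algebra_simps)

lemma cnj_fourier_char: "cnj (fourier_char x \<xi>) = fourier_char (- x) \<xi>"
  by (simp add: fourier_char_def exp_cnj)

lemma measurable_fourier_char [measurable]:
  "(\<lambda>z. fourier_char (fst z) (snd z)) \<in> borel_measurable (borel \<Otimes>\<^sub>M borel)"
  unfolding fourier_char_def borel_prod
  by (intro borel_measurable_continuous_onI continuous_intros)

lemma measurable_fourier_char' [measurable (raw)]:
  assumes "f \<in> M \<rightarrow>\<^sub>M borel" "g \<in> M \<rightarrow>\<^sub>M borel"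
  shows "(\<lambda>z. fourier_char (f z) (g z)) \<in> borel_measurable M"
  using measurable_compose[OF measurable_Pair[OF assms] measurable_fourier_char] by simp

lemma integrable_fourier_char:
  fixes f :: "real^'n \<Rightarrow> complex"
  assumes "integrable lborel f"
  shows "integrable lborel (\<lambda>x. f x * fourier_char x \<xi>)"
proof (rule integrable_le)
  have [measurable]: "f \<in> borel_measurable borel" using assms by auto
  show "integrable lborel (\<lambda>x. norm (f x))" using assms by simp
  show "(\<lambda>x. f x * fourier_char x \<xi>) \<in> borel_measurable lborel" by simp
qed (simp add: norm_mult)

lemma borel_measurable_fourier [measurable]:
  fixes f :: "real^'n \<Rightarrow> complex"
  assumes [measurable]: "f \<in> borel_measurable borel"
  shows "fourier f \<in> borel_measurable borel"
  unfolding fourier_eq[abs_def] by (rule lborel.borel_measurable_lebesgue_integral) simp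

lemma norm_fourier_le:
  fixes f :: "real^'n \<Rightarrow> complex"
  shows "cmod (fourier f \<xi>) \<le> (LINT x|lborel. cmod (f x))"
  unfolding fourier_eq by (rule integral_norm_bound[THEN order_trans]) (simp add: norm_mult)

lemma fourier_diff:
  fixes f g :: "real^'n \<Rightarrow> complex"
  assumes "integrable lborel f" "integrable lborel g"
  shows "fourier (\<lambda>x. f x - g x) \<xi> = fourier f \<xi> - fourier g \<xi>"
  unfolding fourier_eq using assms[THEN integrable_fourier_char]
  by (simp add: left_diff_distrib)

lemma fourier_add:
  fixes f g :: "real^'n \<Rightarrow> complex"
  assumes "integrable lborel f" "integrable lborel g"
  shows "fourier (\<lambda>x. f x + g x) \<xi> = fourier f \<xi> + fourier g \<xi>"
  unfolding fourier_eq using assms[THEN integrable_fourier_char]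
  by (simp add: distrib_right)

lemma fourier_mult_const: "fourier (\<lambda>x. c * f x) \<xi> = c * fourier f \<xi>"
  by (simp add: fourier_eq mult.assoc)

lemma integrable_bounded_kernel:
  fixes f k :: "real^'n \<Rightarrow> complex"
  assumes "integrable lborel f" "integrable lborel k"
    and K[measurable]: "(\<lambda>(x, y). K x y) \<in> borel_measurable (borel \<Otimes>\<^sub>M borel)"
    and bd: "\<And>x y. cmod (K x y) \<le> M"
  shows "integrable (lborel \<Otimes>\<^sub>M lborel) (\<lambda>(x, y). f x * K x y * k y)"
proof -
  have [measurable]: "f \<in> borel_measurable borel" "k \<in> borel_measurable borel" using assms(1,2) by auto
  have "integrable (lborel \<Otimes>\<^sub>M lborel) (\<lambda>(x, y). f x * k y)"
  proof (rule lborel_pair.Fubini_integrable)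
    show "integrable lborel (\<lambda>x. LINT y|lborel. norm (case (x, y) of (x, y) \<Rightarrow> f x * k y))"
      using assms(1) by (simp add: norm_mult)
    show "AE x in lborel. integrable lborel (\<lambda>y. case (x, y) of (x, y) \<Rightarrow> f x * k y)"
      using assms(2) by simp
  qed simp
  then have "integrable (lborel \<Otimes>\<^sub>M lborel) (\<lambda>z. M * norm (case z of (x, y) \<Rightarrow> f x * k y))"
    by simp
  then show ?thesis
  proof (rule integrable_le)
    have "(\<lambda>(x, y). f x * K x y * k y) \<in> borel_measurable (borel \<Otimes>\<^sub>M borel)"
      by measurable
    then show "(\<lambda>(x, y). f x * K x y * k y) \<in> borel_measurable (lborel \<Otimes>\<^sub>M lborel)"
      by (simp cong: measurable_cong_sets sets_pair_measure_cong)
    fix z :: "(real^'n) \<times> (real^'n)"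
    show "norm (case z of (x, y) \<Rightarrow> f x * K x y * k y) \<le> M * norm (case z of (x, y) \<Rightarrow> f x * k y)"
      using mult_right_mono[OF bd, of "cmod (f (fst z)) * cmod (k (snd z))" "fst z" "snd z"]
      by (simp add: case_prod_beta norm_mult mult_ac)
  qed
qed

text \<open>Fubini for a general bounded kernel, because two kinds occur: characters, with bound 1,
  and translates of a bounded function, with the bound of that function.\<close>

lemma integral_kernel_swap:
  fixes f k :: "real^'n \<Rightarrow> complex"
  assumes "integrable lborel f" "integrable lborel k"
    and K[measurable]: "(\<lambda>(x, y). K x y) \<in> borel_measurable (borel \<Otimes>\<^sub>M borel)"
    and bd: "\<And>x y. cmod (K x y) \<le> M"
  shows "(LINT x|lborel. f x * (LINT y|lborel. K x y * k y)) = (LINT y|lborel. (LINT x|lborel. f x * K x y) * k y)"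
proof -
  have "(LINT x|lborel. f x * (LINT y|lborel. K x y * k y)) = (LINT x|lborel. LINT y|lborel. f x * K x y * k y)"
    by (simp add: mult.assoc)
  also have "\<dots> = (LINT y|lborel. LINT x|lborel. f x * K x y * k y)"
    using lborel_pair.Fubini_integral[OF integrable_bounded_kernel[OF assms]] by simp
  also have "\<dots> = (LINT y|lborel. (LINT x|lborel. f x * K x y) * k y)" by simp
  finally show ?thesis .
qed

lemma fourier_multiplication_formula:
  fixes f k :: "real^'n \<Rightarrow> complex"
  assumes "integrable lborel f" "integrable lborel k"
  shows "(LINT x|lborel. f x * fourier k x) = (LINT x|lborel. fourier f x * k x)"
proof -
  have "(LINT x|lborel. f x * fourier k x) = (LINT x|lborel. f x * (LINT y|lborel. fourier_char x y * k y))"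
    by (simp add: fourier_eq fourier_char_commute mult.commute)
  also have "\<dots> = (LINT y|lborel. (LINT x|lborel. f x * fourier_char x y) * k y)"
    by (rule integral_kernel_swap[OF assms, where M=1]) auto
  finally show ?thesis by (simp add: fourier_eq)
qed

subsection \<open>Affine substitutions\<close>

lemma integrable_affine:
  fixes f :: "real^'n \<Rightarrow> 'b::{banach, second_countable_topology}"
  assumes "c \<noteq> 0" "integrable lborel f"
  shows "integrable lborel (\<lambda>x. f (t + c *\<^sub>R x))"
proof -
  have [measurable]: "f \<in> borel_measurable borel" using assms(2) by auto
  have "integrable (density (distr lborel borel (\<lambda>x. t + c *\<^sub>R x)) (\<lambda>_. \<bar>c\<bar> ^ DIM(real^'n))) f"
    using assms(2) lborel_affine[OF assms(1), of t] by simp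
  then have "integrable lborel (\<lambda>x. (\<bar>c\<bar> ^ DIM(real^'n)) *\<^sub>R f (t + c *\<^sub>R x))"
    by (simp add: integrable_density integrable_distr_eq)
  then have "integrable lborel (\<lambda>x. inverse (\<bar>c\<bar> ^ DIM(real^'n)) *\<^sub>R (\<bar>c\<bar> ^ DIM(real^'n)) *\<^sub>R f (t + c *\<^sub>R x))"
    by (rule integrable_scaleR_right)
  then show ?thesis using assms(1) by simp
qed

lemma integral_affine:
  fixes f :: "real^'n \<Rightarrow> 'b::{banach, second_countable_topology}"
  assumes c: "c \<noteq> 0"
  shows "(LINT x|lborel. f x) = (\<bar>c\<bar> ^ CARD('n)) *\<^sub>R (LINT x|lborel. f (t + c *\<^sub>R x))"
proof (cases "integrable lborel f")
  case True
  then have [measurable]: "f \<in> borel_measurable borel" by auto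
  have "(LINT x|lborel. f x) = integral\<^sup>L (density (distr lborel borel (\<lambda>x. t + c *\<^sub>R x)) (\<lambda>_. \<bar>c\<bar> ^ DIM(real^'n))) f"
    using lborel_affine[OF c, of t] by simp
  also have "\<dots> = (\<bar>c\<bar> ^ CARD('n)) *\<^sub>R (LINT x|lborel. f (t + c *\<^sub>R x))"
    by (simp add: integral_density integral_distr)
  finally show ?thesis .
next
  case False
  \<comment> \<open>Non-integrable functions have integral 0, so the identity persists once
    integrability is seen to fail on both sides; the inverse substitution shows this.\<close>
  have "\<not> integrable lborel (\<lambda>x. f (t + c *\<^sub>R x))"
  proof
    assume "integrable lborel (\<lambda>x. f (t + c *\<^sub>R x))"
    from integrable_affine[OF _ this, of "1/c" "- (1/c) *\<^sub>R t"] c False show False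
      by (simp add: scaleR_diff_right)
  qed
  with False show ?thesis by (simp add: not_integrable_integral_eq)
qed

lemma integrable_reflect:
  fixes f :: "real^'n \<Rightarrow> 'b::{banach, second_countable_topology}"
  assumes "integrable lborel f"
  shows "integrable lborel (\<lambda>y. f (x - y))"
  using integrable_affine[OF _ assms, of "-1" x] by simp

lemma integral_reflect:
  fixes f :: "real^'n \<Rightarrow> 'b::{banach, second_countable_topology}"
  shows "(LINT y|lborel. f (x - y)) = (LINT y|lborel. f y)"
  using integral_affine[of "-1" f x] by simp

lemma integrable_translate:
  fixes f :: "real^'n \<Rightarrow> 'b::{banach, second_countable_topology}"
  assumes "integrable lborel f"
  shows "integrable lborel (\<lambda>y. f (y - x))"
  using integrable_affine[OF _ assms, of "1" "-x"] by simp

lemma integral_translate: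
  fixes f :: "real^'n \<Rightarrow> 'b::{banach, second_countable_topology}"
  shows "(LINT y|lborel. f (y - x)) = (LINT y|lborel. f y)"
  using integral_affine[of "1" f "-x"] by simp

subsection \<open>Continuity of translations in the mean\<close>

text \<open>Continuity of z -> f(. - z) in L1 at the origin, phrased with sequences so that
  dominated convergence applies directly.\<close>

definition translation_continuous :: "(real^'n \<Rightarrow> 'b::{banach, second_countable_topology}) \<Rightarrow> bool" where
  "translation_continuous f \<longleftrightarrow>
     (\<forall>z. z \<longlonglongrightarrow> 0 \<longrightarrow> (\<lambda>k::nat. LINT x|lborel. norm (f (x - z k) - f x)) \<longlonglongrightarrow> 0)"

text \<open>The three-term estimate: translation invariance of Lebesgue measure makes the error of
  the translated approximation equal to that of the approximation itself.\<close>

lemma translation_continuous_approx: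
  fixes f :: "real^'n \<Rightarrow> 'b::{banach, second_countable_topology}"
  assumes f: "integrable lborel f"
    and approx: "\<And>e. e > 0 \<Longrightarrow> \<exists>g. integrable lborel g \<and> translation_continuous g \<and> (LINT x|lborel. norm (f x - g x)) \<le> e"
  shows "translation_continuous f"
  unfolding translation_continuous_def
proof (intro allI impI LIMSEQ_I)
  fix z :: "nat \<Rightarrow> real^'n" and e :: real
  assume z: "z \<longlonglongrightarrow> 0" and e: "0 < e"
  obtain g where g: "integrable lborel g" "translation_continuous g" "(LINT x|lborel. norm (f x - g x)) \<le> e/4"
    using approx[of "e/4"] e by auto
  have "(\<lambda>k. LINT x|lborel. norm (g (x - z k) - g x)) \<longlonglongrightarrow> 0"
    using g(2) z by (auto simp: translation_continuous_def)
  from LIMSEQ_D[OF this, of "e/2"] e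
  obtain N where N: "\<And>k. k \<ge> N \<Longrightarrow> norm ((LINT x|lborel. norm (g (x - z k) - g x)) - 0) < e/2"
    by auto
  have "norm ((LINT x|lborel. norm (f (x - z k) - f x)) - 0) < e" if "k \<ge> N" for k
  proof -
    have fg: "integrable lborel (\<lambda>x. norm (f x - g x))" using f g(1) by simp
    note i1 = integrable_translate[OF fg, of "z k"]
    have i2: "integrable lborel (\<lambda>x. norm (g (x - z k) - g x))"
      using integrable_translate[OF g(1), of "z k"] g(1) by simp
    have i0: "integrable lborel (\<lambda>x. norm (f (x - z k) - f x))"
      using integrable_translate[OF f, of "z k"] f by simp
    have "(LINT x|lborel. norm (f (x - z k) - f x)) \<le>
        (LINT x|lborel. norm (f (x - z k) - g (x - z k)) + norm (g (x - z k) - g x) + norm (f x - g x))"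
    proof (rule integral_mono[OF i0])
      show "integrable lborel (\<lambda>x. norm (f (x - z k) - g (x - z k)) + norm (g (x - z k) - g x) + norm (f x - g x))"
        by (intro Bochner_Integration.integrable_add i1 i2 fg)
      fix x
      have eq: "f (x - z k) - f x = (f (x - z k) - g (x - z k)) + (g (x - z k) - g x) - (f x - g x)" by simp
      show "norm (f (x - z k) - f x) \<le> norm (f (x - z k) - g (x - z k)) + norm (g (x - z k) - g x) + norm (f x - g x)"
        using norm_triangle_ineq4[of "(f (x - z k) - g (x - z k)) + (g (x - z k) - g x)" "f x - g x"]
          norm_triangle_ineq[of "f (x - z k) - g (x - z k)" "g (x - z k) - g x"]
        by (subst eq) linarith
    qed
    also have "\<dots> = (LINT x|lborel. norm (f (x - z k) - g (x - z k))) + (LINT x|lborel. norm (g (x - z k) - g x)) + (LINT x|lborel. norm (f x - g x))"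
      using i1 i2 fg by simp
    also have "(LINT x|lborel. norm (f (x - z k) - g (x - z k))) = (LINT x|lborel. norm (f x - g x))"
      by (rule integral_translate[of "\<lambda>x. norm (f x - g x)"])
    finally show ?thesis using N[OF that] g(3) by simp
  qed
  then show "\<exists>no. \<forall>k\<ge>no. norm ((LINT x|lborel. norm (f (x - z k) - f x)) - 0) < e" by blast
qed

text \<open>The symmetric difference of U and its translate has measure 2|U| minus twice the
  overlap. Openness makes the overlap converge to |U|, since a point of U stays in U under small
  shifts.\<close>

lemma translation_continuous_open:
  fixes c :: "'b::{banach, second_countable_topology}" and U :: "(real^'n) set"
  assumes U: "open U" "emeasure lborel U < \<infinity>"
  shows "translation_continuous (\<lambda>x. indicator U x *\<^sub>R c)"
  unfolding translation_continuous_def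
proof (intro allI impI)
  fix z :: "nat \<Rightarrow> real^'n" assume z: "z \<longlonglongrightarrow> 0"
  have [measurable]: "U \<in> sets borel" using U by simp
  let ?u = "indicator U :: real^'n \<Rightarrow> real"
  have i: "integrable lborel ?u" using U by (intro integrable_real_indicator) auto
  have iz: "integrable lborel (\<lambda>x. ?u (x - w))" for w using integrable_translate[OF i] .
  have ip: "integrable lborel (\<lambda>x. ?u (x - w) * ?u x)" for w
    by (rule integrable_le[OF i]) (auto simp: indicator_def)
  have "(\<lambda>k. LINT x|lborel. ?u (x - z k) * ?u x) \<longlonglongrightarrow> (LINT x|lborel. ?u x)"
  proof (rule integral_dominated_convergence[where w="?u"])
    show "AE x in lborel. (\<lambda>k. ?u (x - z k) * ?u x) \<longlonglongrightarrow> ?u x"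
    proof (intro always_eventually allI)
      fix x
      show "(\<lambda>k. ?u (x - z k) * ?u x) \<longlonglongrightarrow> ?u x"
      proof (cases "x \<in> U")
        case True
        have "(\<lambda>k. x - z k) \<longlonglongrightarrow> x - 0" using z by (intro tendsto_intros)
        then have "\<forall>\<^sub>F k in sequentially. x - z k \<in> U"
          using U(1) True by (auto simp: tendsto_def)
        then have "\<forall>\<^sub>F k in sequentially. ?u (x - z k) * ?u x = ?u x"
          by eventually_elim (use True in simp)
        then show ?thesis by (rule tendsto_eventually)
      qed simp
    qed
  qed (use i in \<open>auto simp: indicator_def\<close>)
  then have "(\<lambda>k. norm c * (2 * (LINT x|lborel. ?u x) - 2 * (LINT x|lborel. ?u (x - z k) * ?u x))) \<longlonglongrightarrow>
      norm c * (2 * (LINT x|lborel. ?u x) - 2 * (LINT x|lborel. ?u x))"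
    by (intro tendsto_intros)
  moreover have "(LINT x|lborel. norm (?u (x - w) *\<^sub>R c - ?u x *\<^sub>R c)) =
      norm c * (2 * (LINT x|lborel. ?u x) - 2 * (LINT x|lborel. ?u (x - w) * ?u x))" for w
  proof -
    have "(LINT x|lborel. norm (?u (x - w) *\<^sub>R c - ?u x *\<^sub>R c)) = 
        (LINT x|lborel. norm c * (?u (x - w) + ?u x - 2 * (?u (x - w) * ?u x)))"
      by (intro Bochner_Integration.integral_cong refl) (auto simp: indicator_def)
    also have "\<dots> = norm c * ((LINT x|lborel. ?u (x - w)) + (LINT x|lborel. ?u x) - 2 * (LINT x|lborel. ?u (x - w) * ?u x))"
      using i iz ip by simp
    also have "(LINT x|lborel. ?u (x - w)) = (LINT x|lborel. ?u x)" by (rule integral_translate)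
    finally show ?thesis by simp
  qed
  ultimately show "(\<lambda>k. LINT x|lborel. norm (?u (x - z k) *\<^sub>R c - ?u x *\<^sub>R c)) \<longlonglongrightarrow> 0"
    by simp
qed

text \<open>Induction over integrable functions; outer regularity replaces a measurable set by an
  open one, for which the claim is known.\<close>

lemma integrable_translation_continuous:
  fixes f :: "real^'n \<Rightarrow> 'b::{banach, second_countable_topology}"
  assumes "integrable lborel f"
  shows "translation_continuous f"
  using assms
proof (induction rule: integrable_induct)
  case (base A c)
  have A[measurable]: "A \<in> sets borel" using base by simp
  show ?case
  proof (rule translation_continuous_approx)
    show "integrable lborel (\<lambda>x. indicator A x *\<^sub>R c)"
      using base by (intro integrable_scaleR_left integrable_real_indicator) auto
    fix e :: real assume e: "e > 0"
    \<comment> \<open>The summand 1 keeps the quotient meaningful when \<open>c = 0\<close>.\<close>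
    define e' where "e' = e / (norm c + 1)"
    have e': "e' > 0" using e by (simp add: e'_def add_nonneg_pos)
    obtain U where U: "open U" "A \<subseteq> U" "emeasure lborel (U - A) < ennreal e'"
      using outer_regular_lborel[OF A e'] by blast
    have [measurable]: "U \<in> sets borel" using U by simp
    have fin: "emeasure lborel (U - A) < \<infinity>" using U(3) by (rule less_trans) simp
    have "emeasure lborel U = emeasure lborel (A \<union> (U - A))" using U(2) by (simp add: Un_absorb1)
    also have "\<dots> \<le> emeasure lborel A + emeasure lborel (U - A)"
      by (rule emeasure_subadditive) auto
    also have "\<dots> < \<infinity>" using base fin by (simp add: ennreal_add_less_top)
    finally have Ufin: "emeasure lborel U < \<infinity>" .
    have "(LINT x|lborel. norm (indicator A x *\<^sub>R c - indicator U x *\<^sub>R c)) = (LINT x|lborel. norm c * indicator (U - A) x)"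
      using U(2) by (intro Bochner_Integration.integral_cong refl) (auto simp: indicator_def)
    also have "\<dots> = norm c * measure lborel (U - A)" by simp
    also have "\<dots> \<le> norm c * e'"
      using U(3) fin e' by (intro mult_left_mono) (auto simp: emeasure_eq_ennreal_measure ennreal_less_iff)
    also have "\<dots> \<le> (norm c + 1) * e'" using e' by simp
    also have "\<dots> = e" using norm_ge_zero[of c] by (simp add: e'_def add_nonneg_eq_0_iff)
    finally have "(LINT x|lborel. norm (indicator A x *\<^sub>R c - indicator U x *\<^sub>R c)) \<le> e" .
    moreover have "integrable lborel (\<lambda>x. indicator U x *\<^sub>R c)"
      using Ufin by (intro integrable_scaleR_left integrable_real_indicator) auto
    ultimately show "\<exists>g. integrable lborel g \<and> translation_continuous g \<and>
        (LINT x|lborel. norm (indicator A x *\<^sub>R c - g x)) \<le> e"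
      using translation_continuous_open[OF U(1) Ufin, of c] by blast
  qed
next
  case (add f g)
  show ?case
    unfolding translation_continuous_def
  proof (intro allI impI)
    fix z :: "nat \<Rightarrow> real^'n" assume z: "z \<longlonglongrightarrow> 0"
    have i1: "integrable lborel (\<lambda>x. norm (f (x - w) - f x))" for w
      using integrable_translate[OF add.hyps(1)] add.hyps(1) by simp
    have i2: "integrable lborel (\<lambda>x. norm (g (x - w) - g x))" for w
      using integrable_translate[OF add.hyps(2)] add.hyps(2) by simp
    have i3: "integrable lborel (\<lambda>x. norm (f (x - w) + g (x - w) - (f x + g x)))" for w
      using integrable_translate[OF add.hyps(1)] add.hyps(1) integrable_translate[OF add.hyps(2)] add.hyps(2) by simp
    have lim: "(\<lambda>k. (LINT x|lborel. norm (f (x - z k) - f x)) + (LINT x|lborel. norm (g (x - z k) - g x))) \<longlonglongrightarrow> 0 + 0"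
      using add.IH z unfolding translation_continuous_def by (intro tendsto_add) auto
    show "(\<lambda>k. LINT x|lborel. norm (f (x - z k) + g (x - z k) - (f x + g x))) \<longlonglongrightarrow> 0"
    proof (rule tendsto_sandwich[OF _ _ tendsto_const])
      show "(\<lambda>k. (LINT x|lborel. norm (f (x - z k) - f x)) + (LINT x|lborel. norm (g (x - z k) - g x))) \<longlonglongrightarrow> 0"
        using lim by simp
      show "\<forall>\<^sub>F k in sequentially. (LINT x|lborel. norm (f (x - z k) + g (x - z k) - (f x + g x)))
          \<le> (LINT x|lborel. norm (f (x - z k) - f x)) + (LINT x|lborel. norm (g (x - z k) - g x))"
      proof (intro always_eventually allI)
        fix k
        have "(LINT x|lborel. norm (f (x - z k) + g (x - z k) - (f x + g x))) \<le>
          (LINT x|lborel. norm (f (x - z k) - f x) + norm (g (x - z k) - g x))"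
        proof (rule integral_mono[OF i3])
          fix x show "norm (f (x - z k) + g (x - z k) - (f x + g x)) \<le> norm (f (x - z k) - f x) + norm (g (x - z k) - g x)"
            using norm_triangle_ineq[of "f (x - z k) - f x" "g (x - z k) - g x"] by (simp add: algebra_simps)
        qed (use i1 i2 in simp)
        then show "(LINT x|lborel. norm (f (x - z k) + g (x - z k) - (f x + g x)))
          \<le> (LINT x|lborel. norm (f (x - z k) - f x)) + (LINT x|lborel. norm (g (x - z k) - g x))"
          using i1 i2 by simp
      qed
    qed simp
  qed
next
  case (lim f s)
  note [measurable] = borel_measurable_integrable[OF lim.hyps(1)] borel_measurable_integrable[OF lim.hyps(4)]
  show ?case
  proof (rule translation_continuous_approx[OF lim.hyps(4)])
    fix e :: real assume e: "e > 0"
    have "(\<lambda>k. LINT x|lborel. norm (f x - s k x)) \<longlonglongrightarrow> (LINT x::real^'n|lborel. 0)"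
    \<comment> \<open>The approximants satisfy |s k| <= 2 |f|, so the differences are at most 3
      |f|.\<close>
    proof (rule integral_dominated_convergence[where w="\<lambda>x. 3 * norm (f x)"])
      show "integrable lborel (\<lambda>x. 3 * norm (f x))" using lim.hyps(4) by simp
      show "AE x in lborel. (\<lambda>k. norm (f x - s k x)) \<longlonglongrightarrow> 0"
      proof (intro always_eventually allI)
        fix x
        have "(\<lambda>k. norm (f x - s k x)) \<longlonglongrightarrow> norm (f x - f x)"
          using lim.hyps(2)[of x] by (intro tendsto_intros) simp
        then show "(\<lambda>k. norm (f x - s k x)) \<longlonglongrightarrow> 0" by simp
      qed
      show "AE x in lborel. norm (norm (f x - s k x)) \<le> 3 * norm (f x)" for k
      proof (intro always_eventually allI)
        fix x
        show "norm (norm (f x - s k x)) \<le> 3 * norm (f x)"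
          using norm_triangle_ineq4[of "f x" "s k x"] lim.hyps(3)[of x k] by simp
      qed
    qed simp_all
    then have "\<forall>\<^sub>F k in sequentially. (LINT x|lborel. norm (f x - s k x)) < e"
      using e by (intro order_tendstoD) auto
    then obtain k where "(LINT x|lborel. norm (f x - s k x)) < e"
      by (auto simp: eventually_sequentially)
    then show "\<exists>g. integrable lborel g \<and> translation_continuous g \<and> (LINT x|lborel. norm (f x - g x)) \<le> e"
      using lim.IH[of k] lim.hyps(1)[of k] by (intro exI[of _ "s k"]) auto
  qed
qed

subsection \<open>The Gaussian\<close>

text \<open>After rescaling this is the characteristic function exp(-b^2/2) of the standard normal
  distribution.\<close>

lemma gaussian_fourier_real:
  assumes t: "t > 0"
  shows "integrable lborel (\<lambda>x. complex_of_real (exp (- pi * t\<^sup>2 * x\<^sup>2)) * iexp (- (2 * pi * a * x)))" (is ?int)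
    and "(LINT x|lborel. complex_of_real (exp (- pi * t\<^sup>2 * x\<^sup>2)) * iexp (- (2 * pi * a * x))) =
      complex_of_real (exp (- pi * a\<^sup>2 / t\<^sup>2) / t)" (is ?eq)
proof -
  \<comment> \<open>Chosen so that (c x)^2 / 2 = pi t^2 x^2; then \<open>b\<close> is the frequency
    with b c x = - 2 pi a x.\<close>
  define c where "c = sqrt (2 * pi) * t"
  define b where "b = - (2 * pi * a) / c"
  have c: "c > 0" using t by (simp add: c_def)
  have c2: "c\<^sup>2 = 2 * pi * t\<^sup>2" by (simp add: c_def power_mult_distrib)
  have *: "complex_of_real (exp (- pi * t\<^sup>2 * x\<^sup>2)) * iexp (- (2 * pi * a * x)) =
      complex_of_real (sqrt (2 * pi)) * (std_normal_density (0 + c * x) *\<^sub>R iexp (b * (0 + c * x)))" for x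
  proof -
    have 1: "b * (0 + c * x) = - (2 * pi * a * x)" using c by (simp add: b_def)
    have 2: "- ((0 + c * x)\<^sup>2) / 2 = - pi * t\<^sup>2 * x\<^sup>2" by (simp add: power_mult_distrib c2)
    show ?thesis unfolding std_normal_density_def 1 2 by (simp add: scaleR_conv_of_real)
  qed
  have int: "integrable lborel (\<lambda>y. std_normal_density y *\<^sub>R iexp (b * y))"
  proof (rule integrable_le)
    show "integrable lborel std_normal_density" by simp
    show "(\<lambda>y. std_normal_density y *\<^sub>R iexp (b * y)) \<in> borel_measurable lborel" by simp
  qed (simp add: norm_exp_eq_Re)
  have "integrable lborel (\<lambda>x. std_normal_density (0 + c * x) *\<^sub>R iexp (b * (0 + c * x)))"
    by (rule lborel_integrable_real_affine[OF int]) (use c in simp)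
  then show ?int unfolding * by (rule integrable_mult_right)
  have "char std_normal_distribution b = (LINT y|lborel. std_normal_density y *\<^sub>R iexp (b * y))"
    unfolding char_def by (subst integral_density) auto
  then have "complex_of_real (exp (- (b\<^sup>2) / 2)) = (LINT y|lborel. std_normal_density y *\<^sub>R iexp (b * y))"
    by (simp add: char_std_normal_distribution)
  also have "\<dots> = c *\<^sub>R (LINT x|lborel. std_normal_density (0 + c * x) *\<^sub>R iexp (b * (0 + c * x)))"
    using c by (subst lborel_integral_real_affine[of c _ 0]) auto
  finally have eq: "(LINT x|lborel. std_normal_density (0 + c * x) *\<^sub>R iexp (b * (0 + c * x))) = complex_of_real (exp (- (b\<^sup>2) / 2) / c)"
    using c by (simp add: scaleR_conv_of_real field_simps)
  have b2: "- (b\<^sup>2) / 2 = - pi * a\<^sup>2 / t\<^sup>2"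
    unfolding b_def power_divide c2 by (simp add: power2_eq_square)
  show ?eq
    unfolding * integral_mult_right_zero eq b2 using t by (simp add: c_def)
qed

definition gaussian :: "real \<Rightarrow> real^'n \<Rightarrow> real" where
  "gaussian t \<xi> = exp (- pi * t\<^sup>2 * (norm \<xi>)\<^sup>2)"

text \<open>The Fourier transform of \<open>gaussian t\<close>. It equals t^-n times
  \<open>gaussian_kernel 1\<close> at x/t, so it concentrates at the origin exactly while
  \<open>gaussian t\<close> increases to 1.\<close>

definition gaussian_kernel :: "real \<Rightarrow> real^'n \<Rightarrow> real" where
  "gaussian_kernel t x = exp (- pi * (norm x)\<^sup>2 / t\<^sup>2) / t ^ CARD('n)"

lemma gaussian_measurable [measurable]: "gaussian t \<in> borel_measurable borel"
  unfolding gaussian_def by measurable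

lemma gaussian_kernel_measurable [measurable]: "gaussian_kernel t \<in> borel_measurable borel"
  unfolding gaussian_kernel_def by measurable

text \<open>Lebesgue measure is the image of the product of the one-dimensional measures under the
  coordinate map, so a product of functions of single coordinates integrates to a product.\<close>

lemma integral_lborel_prod:
  fixes f :: "'a::euclidean_space \<Rightarrow> real \<Rightarrow> complex"
  assumes int: "\<And>b. b \<in> Basis \<Longrightarrow> integrable lborel (f b)"
  shows "integrable lborel (\<lambda>x::'a. \<Prod>b\<in>Basis. f b (x \<bullet> b))"
    and "(LINT x|lborel. (\<Prod>b\<in>Basis. f b (x \<bullet> b))) = (\<Prod>b\<in>(Basis::'a set). (LINT x|lborel. f b x))"
proof -
  interpret P: product_sigma_finite "\<lambda>b::'a. lborel :: real measure" ..
  have [measurable]: "b \<in> Basis \<Longrightarrow> f b \<in> borel_measurable borel" for b using int by auto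
  have m: "(\<lambda>x::'a. \<Prod>b\<in>Basis. f b (x \<bullet> b)) \<in> borel_measurable borel" by measurable
  have T: "(\<lambda>f. \<Sum>b\<in>Basis. f b *\<^sub>R b) \<in> (\<Pi>\<^sub>M b\<in>(Basis::'a set). lborel) \<rightarrow>\<^sub>M (borel :: 'a measure)"
    by measurable
  have *: "(\<Prod>b\<in>Basis. f b ((\<Sum>b'\<in>Basis. g b' *\<^sub>R b') \<bullet> b)) = (\<Prod>b\<in>(Basis::'a set). f b (g b))" for g
    by (intro prod.cong refl) simp
  show "integrable lborel (\<lambda>x::'a. \<Prod>b\<in>Basis. f b (x \<bullet> b))"
    unfolding lborel_eq[where 'a='a] integrable_distr_eq[OF T m] *
    using int by (intro P.product_integrable_prod) auto
  show "(LINT x|lborel. (\<Prod>b\<in>Basis. f b (x \<bullet> b))) = (\<Prod>b\<in>(Basis::'a set). (LINT x|lborel. f b x))"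
    by (subst lborel_eq[where 'a='a], subst integral_distr[OF T m], unfold *)
       (use int in \<open>intro P.product_integral_prod, auto\<close>)
qed

lemma gaussian_fourier:
  fixes a :: "real^'n"
  assumes t: "t > 0"
  shows "integrable lborel (\<lambda>x::real^'n. complex_of_real (gaussian t x))" (is ?int)
    and "fourier (\<lambda>x. complex_of_real (gaussian t x)) a = complex_of_real (gaussian_kernel t a)" (is ?eq)
proof -
  let ?f = "\<lambda>a b x. complex_of_real (exp (- pi * t\<^sup>2 * x\<^sup>2)) * iexp (- (2 * pi * (a \<bullet> b) * x))"
  have norm2: "(norm x)\<^sup>2 = (\<Sum>b\<in>Basis. (x \<bullet> b)\<^sup>2)" for x :: "real^'n"
    unfolding power2_norm_eq_inner by (subst euclidean_inner) (simp add: power2_eq_square)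
  have eq: "complex_of_real (gaussian t x) * fourier_char x a = (\<Prod>b\<in>Basis. ?f a b (x \<bullet> b))" for x a :: "real^'n"
  proof -
    have "fourier_char x a = iexp (- (2 * pi * (x \<bullet> a)))"
      by (simp add: fourier_char_def mult_ac)
    also have "x \<bullet> a = (\<Sum>b\<in>Basis. (a \<bullet> b) * (x \<bullet> b))" by (subst euclidean_inner) (simp add: mult.commute)
    finally have 1: "fourier_char x a = (\<Prod>b\<in>Basis. iexp (- (2 * pi * (a \<bullet> b) * (x \<bullet> b))))"
      by (simp add: exp_sum sum_distrib_left sum_negf mult.assoc flip: exp_sum)
    have 2: "gaussian t x = (\<Prod>b\<in>Basis. exp (- pi * t\<^sup>2 * (x \<bullet> b)\<^sup>2))"
      unfolding gaussian_def norm2 by (simp add: sum_distrib_left exp_sum)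
    show ?thesis unfolding 1 2 by (simp add: prod.distrib)
  qed
  \<comment> \<open>At frequency 0 the character is 1, so integrability of the bare Gaussian is a
    special case.\<close>
  have "integrable lborel (\<lambda>x::real^'n. \<Prod>b\<in>Basis. ?f 0 b (x \<bullet> b))"
    by (rule integral_lborel_prod(1)) (rule gaussian_fourier_real(1)[OF t])
  then show ?int unfolding eq[symmetric] by (simp add: fourier_char_def)
  have "fourier (\<lambda>x. complex_of_real (gaussian t x)) a = (\<Prod>b\<in>Basis. LINT x|lborel. ?f a b x)"
    unfolding fourier_eq eq by (rule integral_lborel_prod(2)) (rule gaussian_fourier_real(1)[OF t])
  also have "\<dots> = (\<Prod>b\<in>(Basis::(real^'n) set). complex_of_real (exp (- pi * (a \<bullet> b)\<^sup>2 / t\<^sup>2) / t))"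
    by (intro prod.cong refl gaussian_fourier_real(2)[OF t])
  also have "\<dots> = complex_of_real (gaussian_kernel t a)"
    unfolding gaussian_kernel_def norm2
    by (simp add: prod_dividef sum_distrib_left sum_divide_distrib exp_sum flip: of_real_prod of_real_divide of_real_power)
  finally show ?eq .
qed

lemma gaussian_kernel_1: "gaussian_kernel 1 = gaussian 1"
  by (simp add: fun_eq_iff gaussian_kernel_def gaussian_def)

lemma integrable_gaussian: "t > 0 \<Longrightarrow> integrable lborel (gaussian t :: real^'n \<Rightarrow> real)"
  using gaussian_fourier(1)[of t] by (simp add: complex_of_real_integrable_eq)

lemma integral_gaussian_kernel_1: "(LINT x|lborel. gaussian_kernel 1 (x :: real^'n)) = 1"
proof -
  have "complex_of_real (LINT x|lborel. gaussian_kernel 1 (x :: real^'n)) = fourier (\<lambda>x::real^'n. complex_of_real (gaussian 1 x)) 0"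
    by (simp add: fourier_eq fourier_char_def gaussian_kernel_1)
  also have "\<dots> = 1"
    by (subst gaussian_fourier(2)) (auto simp: gaussian_kernel_def)
  finally show ?thesis by simp
qed

lemma gaussian_kernel_eq_scaled:
  assumes "t > 0"
  shows "gaussian_kernel t (x :: real^'n) = gaussian t (x /\<^sub>R t\<^sup>2) / t ^ CARD('n)"
  using assms by (simp add: gaussian_kernel_def gaussian_def field_simps power2_eq_square)

lemma integrable_gaussian_kernel:
  assumes "t > 0"
  shows "integrable lborel (gaussian_kernel t :: real^'n \<Rightarrow> real)"
proof -
  have "integrable lborel (\<lambda>x::real^'n. gaussian t (0 + inverse (t\<^sup>2) *\<^sub>R x))"
    using assms by (intro integrable_affine integrable_gaussian) auto
  moreover have "gaussian_kernel t = (\<lambda>x::real^'n. gaussian t (0 + inverse (t\<^sup>2) *\<^sub>R x) / t ^ CARD('n))"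
    using gaussian_kernel_eq_scaled[OF assms, where 'n='n] by (simp add: fun_eq_iff)
  ultimately show ?thesis by simp
qed

subsection \<open>Plancherel's theorem\<close>

text \<open>The convolution of f with its reflected conjugate. Formally its transform is |f^|^2, and
  its value at 0 is the squared L2 norm of f.\<close>

definition autocorrelation :: "(real^'n \<Rightarrow> complex) \<Rightarrow> real^'n \<Rightarrow> complex" where
  "autocorrelation f z = (LINT x|lborel. f x * cnj (f (x - z)))"

lemma autocorrelation_measurable [measurable]:
  fixes f :: "real^'n \<Rightarrow> complex"
  assumes [measurable]: "f \<in> borel_measurable borel"
  shows "autocorrelation f \<in> borel_measurable borel"
  unfolding autocorrelation_def[abs_def]
  by (rule lborel.borel_measurable_lebesgue_integral) simp

text \<open>Applying the multiplication formula with the damped conjugate of \<^term>\<open>fourier f\<close> moves the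
  Gaussian to the other side, where it acts as an approximate identity on the autocorrelation.\<close>

lemma integral_fourier_gaussian:
  fixes f :: "real^'n \<Rightarrow> complex"
  assumes f: "integrable lborel f" and bd: "\<And>x. cmod (f x) \<le> M" and t: "t > 0"
  shows "integrable lborel (\<lambda>\<xi>. (cmod (fourier f \<xi>))\<^sup>2 * gaussian t \<xi>)"
    and "complex_of_real (LINT \<xi>|lborel. (cmod (fourier f \<xi>))\<^sup>2 * gaussian t \<xi>) =
      (LINT z|lborel. autocorrelation f z * of_real (gaussian_kernel t z))"
proof -
  have [measurable]: "f \<in> borel_measurable borel" using f by auto
  let ?C = "LINT x|lborel. cmod (f x)"
  have fC: "cmod (fourier f \<xi>) \<le> ?C" for \<xi> by (rule norm_fourier_le)
  note gi = integrable_gaussian[OF t, where 'n='n]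
  have gpos: "0 \<le> gaussian t x" for x :: "real^'n" by (simp add: gaussian_def)
  show int: "integrable lborel (\<lambda>\<xi>. (cmod (fourier f \<xi>))\<^sup>2 * gaussian t \<xi>)"
  proof (rule integrable_le)
    show "integrable lborel (\<lambda>\<xi>::real^'n. ?C\<^sup>2 * gaussian t \<xi>)" using gi by simp
    show "norm ((cmod (fourier f \<xi>))\<^sup>2 * gaussian t \<xi>) \<le> ?C\<^sup>2 * gaussian t \<xi>" for \<xi>
      using gpos[of \<xi>] fC[of \<xi>] by (auto simp: abs_mult intro!: mult_right_mono power_mono)
  qed simp
  let ?k = "\<lambda>\<xi>. cnj (fourier f \<xi>) * complex_of_real (gaussian t \<xi>)"
  have k: "integrable lborel ?k"
  proof (rule integrable_le)
    show "integrable lborel (\<lambda>\<xi>::real^'n. ?C * gaussian t \<xi>)" using gi by simp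
    show "norm (?k \<xi>) \<le> ?C * gaussian t \<xi>" for \<xi>
      using gpos[of \<xi>] fC[of \<xi>] by (auto simp: norm_mult intro!: mult_right_mono)
  qed simp
  \<comment> \<open>Conjugation turns the inner character into that of -y, so the two characters
    combine to that of x - y, whose integral against the Gaussian is the kernel at x - y.\<close>
  have fk: "fourier ?k x = (LINT z|lborel. cnj (f (x - z)) * of_real (gaussian_kernel t z))" for x
  proof -
    have of_real_kernel: "(LINT \<xi>|lborel. fourier_char (x - y) \<xi> * complex_of_real (gaussian t \<xi>)) = of_real (gaussian_kernel t (x - y))" for y
      unfolding gaussian_fourier(2)[OF t, symmetric] fourier_eq
      by (simp add: fourier_char_commute[of "x - y"] mult.commute)
    have "fourier ?k x = (LINT \<xi>|lborel. (LINT y|lborel. cnj (f y) * fourier_char (x - y) \<xi>) * complex_of_real (gaussian t \<xi>))"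
      unfolding fourier_eq
    proof (intro Bochner_Integration.integral_cong refl)
      fix \<xi>
      have "cnj (LINT y|lborel. f y * fourier_char y \<xi>) * complex_of_real (gaussian t \<xi>) * fourier_char \<xi> x =
         (LINT y|lborel. cnj (f y * fourier_char y \<xi>)) * fourier_char \<xi> x * complex_of_real (gaussian t \<xi>)"
        by (subst Bochner_Integration.integral_cnj) (simp only: mult_ac)
      also have "\<dots> = (LINT y|lborel. cnj (f y) * fourier_char (x - y) \<xi>) * complex_of_real (gaussian t \<xi>)"
        unfolding integral_mult_left_zero[symmetric]
        by (intro arg_cong[where f="\<lambda>z. z * _"] Bochner_Integration.integral_cong refl)
           (simp add: cnj_fourier_char fourier_char_commute[of \<xi> x] fourier_char_add[of x "- _", simplified] mult_ac)
      finally show "cnj (LINT y|lborel. f y * fourier_char y \<xi>) * complex_of_real (gaussian t \<xi>) * fourier_char \<xi> x =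
        (LINT y|lborel. cnj (f y) * fourier_char (x - y) \<xi>) * complex_of_real (gaussian t \<xi>)" .
    qed
    also have "\<dots> = (LINT y|lborel. cnj (f y) * (LINT \<xi>|lborel. fourier_char (x - y) \<xi> * complex_of_real (gaussian t \<xi>)))"
      using f gaussian_fourier(1)[OF t]
      by (intro integral_kernel_swap[symmetric, where M=1]) auto
    also have "\<dots> = (LINT y|lborel. cnj (f y) * of_real (gaussian_kernel t (x - y)))"
      unfolding of_real_kernel ..
    also have "\<dots> = (LINT z|lborel. cnj (f (x - z)) * of_real (gaussian_kernel t z))"
      by (subst integral_reflect[of _ x, symmetric]) simp
    finally show ?thesis .
  qed
  have "complex_of_real (LINT \<xi>|lborel. (cmod (fourier f \<xi>))\<^sup>2 * gaussian t \<xi>) = (LINT \<xi>|lborel. fourier f \<xi> * ?k \<xi>)"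
    unfolding integral_complex_of_real[symmetric]
    by (intro Bochner_Integration.integral_cong refl) (simp add: complex_norm_square flip: of_real_power)
  also have "\<dots> = (LINT x|lborel. f x * (LINT z|lborel. cnj (f (x - z)) * of_real (gaussian_kernel t z)))"
    unfolding fourier_multiplication_formula[OF f k, symmetric] fk ..
  also have "\<dots> = (LINT z|lborel. (LINT x|lborel. f x * cnj (f (x - z))) * of_real (gaussian_kernel t z))"
    using f bd integrable_gaussian_kernel[OF t, where 'n='n]
    by (intro integral_kernel_swap[where M=M]) auto
  finally show "complex_of_real (LINT \<xi>|lborel. (cmod (fourier f \<xi>))\<^sup>2 * gaussian t \<xi>) =
      (LINT z|lborel. autocorrelation f z * of_real (gaussian_kernel t z))"
    by (simp add: autocorrelation_def)
qed

text \<open>The uniform bound provides the dominating function, and the last estimate reduces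
  continuity at 0 to continuity of translations in the mean. Boundedness of f allows one factor of
  the product to be estimated by M.\<close>

lemma autocorrelation_bound:
  fixes f :: "real^'n \<Rightarrow> complex"
  assumes f: "integrable lborel f" and bd: "\<And>x. cmod (f x) \<le> M"
  shows "integrable lborel (\<lambda>x. f x * cnj (f (x - z)))"
    and "cmod (autocorrelation f z) \<le> M * (LINT x|lborel. cmod (f x))"
    and "cmod (autocorrelation f z - autocorrelation f 0) \<le> M * (LINT x|lborel. cmod (f (x - z) - f x))"
proof -
  have [measurable]: "f \<in> borel_measurable borel" using f by auto
  show int: "integrable lborel (\<lambda>x. f x * cnj (f (x - z)))" for z
  proof (rule integrable_le)
    show "integrable lborel (\<lambda>x. M * cmod (f x))" using f by simp
    show "norm (f x * cnj (f (x - z))) \<le> M * cmod (f x)" for x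
      using mult_right_mono[OF bd[of "x - z"] norm_ge_zero[of "f x"]] by (simp add: norm_mult mult.commute)
  qed simp
  have fz: "integrable lborel (\<lambda>x. f (x - z))" by (rule integrable_translate[OF f])
  have "cmod (autocorrelation f z) \<le> (LINT x|lborel. cmod (f x * cnj (f (x - z))))"
    unfolding autocorrelation_def by (rule integral_norm_bound)
  also have "\<dots> \<le> (LINT x|lborel. M * cmod (f x))"
  proof (rule integral_mono)
    show "integrable lborel (\<lambda>x. cmod (f x * cnj (f (x - z))))" using int[of z] by (rule integrable_norm)
    show "cmod (f x * cnj (f (x - z))) \<le> M * cmod (f x)" for x
      using mult_right_mono[OF bd[of "x - z"] norm_ge_zero[of "f x"]] by (simp add: norm_mult mult.commute)
  qed (use f in simp)
  finally show "cmod (autocorrelation f z) \<le> M * (LINT x|lborel. cmod (f x))" by simp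
  have "autocorrelation f z - autocorrelation f 0 = (LINT x|lborel. f x * cnj (f (x - z) - f x))"
    unfolding autocorrelation_def using int[of z] int[of 0]
    by (simp add: right_diff_distrib)
  also have "cmod \<dots> \<le> (LINT x|lborel. cmod (f x * cnj (f (x - z) - f x)))"
    by (rule integral_norm_bound)
  also have "\<dots> \<le> (LINT x|lborel. M * cmod (f (x - z) - f x))"
  proof (rule integral_mono)
    show "integrable lborel (\<lambda>x. cmod (f x * cnj (f (x - z) - f x)))"
      using int[of z] int[of 0] by (simp add: right_diff_distrib)
    show "cmod (f x * cnj (f (x - z) - f x)) \<le> M * cmod (f (x - z) - f x)" for x
      using bd[of x] by (simp add: norm_mult mult_right_mono flip: complex_cnj_diff)
  qed (use f fz in simp)
  finally show "cmod (autocorrelation f z - autocorrelation f 0) \<le> M * (LINT x|lborel. cmod (f (x - z) - f x))"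
    by simp
qed

lemma L2_bounded:
  fixes f :: "real^'n \<Rightarrow> complex"
  assumes f: "integrable lborel f" and bd: "\<And>x. cmod (f x) \<le> M"
  shows "f \<in> L2"
proof (rule L2I)
  show [measurable]: "f \<in> borel_measurable borel" using f by auto
  show "integrable lborel (\<lambda>x. (cmod (f x))\<^sup>2)"
  proof (rule integrable_le)
    show "integrable lborel (\<lambda>x. M * cmod (f x))" using f by simp
    show "norm ((cmod (f x))\<^sup>2) \<le> M * cmod (f x)" for x
      using bd[of x] by (simp add: power2_eq_square mult_right_mono)
  qed simp
qed

text \<open>Let t tend to 0 in the damped identity. One side increases to the squared norm of the
  transform; the other tends to the autocorrelation at 0.\<close>

lemma Plancherel_bounded:
  fixes f :: "real^'n \<Rightarrow> complex"
  assumes f: "integrable lborel f" and bd: "\<And>x. cmod (f x) \<le> M"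
  shows "fourier f \<in> L2" "l2norm (fourier f) = l2norm f"
proof -
  have [measurable]: "f \<in> borel_measurable borel" using f by auto
  define t where "t k = 1 / real (Suc k)" for k
  have t: "t k > 0" for k by (simp add: t_def)
  have t0: "t \<longlonglongrightarrow> 0" unfolding t_def by (rule LIMSEQ_Suc) (rule lim_1_over_n)
  let ?I = "\<lambda>k. LINT \<xi>|lborel. (cmod (fourier f \<xi>))\<^sup>2 * gaussian (t k) \<xi>"
  have "(\<lambda>k. LINT z|lborel. autocorrelation f (t k *\<^sub>R z) * of_real (gaussian_kernel 1 z)) \<longlonglongrightarrow>
      (LINT z::real^'n|lborel. autocorrelation f 0 * of_real (gaussian_kernel 1 z))"
  proof (rule integral_dominated_convergence)
    show "integrable lborel (\<lambda>z::real^'n. M * (LINT x|lborel. cmod (f x)) * gaussian_kernel 1 z)"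
      using integrable_gaussian_kernel[of 1, where 'n='n] by simp
    show "AE z::real^'n in lborel. (\<lambda>k. autocorrelation f (t k *\<^sub>R z) * complex_of_real (gaussian_kernel 1 z)) \<longlonglongrightarrow> autocorrelation f 0 * of_real (gaussian_kernel 1 z)"
    proof (intro always_eventually allI tendsto_intros)
      fix z :: "real^'n"
      have "(\<lambda>k. t k *\<^sub>R z) \<longlonglongrightarrow> 0 *\<^sub>R z" using t0 by (intro tendsto_intros)
      then have "(\<lambda>k. LINT x|lborel. norm (f (x - t k *\<^sub>R z) - f x)) \<longlonglongrightarrow> 0"
        using integrable_translation_continuous[OF f] by (simp add: translation_continuous_def)
      then have "(\<lambda>k. M * (LINT x|lborel. norm (f (x - t k *\<^sub>R z) - f x))) \<longlonglongrightarrow> M * 0"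
        by (intro tendsto_intros)
      then have "(\<lambda>k. autocorrelation f (t k *\<^sub>R z) - autocorrelation f 0) \<longlonglongrightarrow> 0"
        by (intro Lim_null_comparison[OF always_eventually[OF allI[OF autocorrelation_bound(3)[OF f bd]]]]) simp
      then show "(\<lambda>k. autocorrelation f (t k *\<^sub>R z)) \<longlonglongrightarrow> autocorrelation f 0"
        by (rule LIM_zero_cancel)
    qed
    show "AE z::real^'n in lborel. norm (autocorrelation f (t k *\<^sub>R z) * complex_of_real (gaussian_kernel 1 z)) \<le> M * (LINT x|lborel. cmod (f x)) * gaussian_kernel 1 z" for k
      using autocorrelation_bound(2)[OF f bd]
      by (intro always_eventually allI) (auto simp: norm_mult gaussian_kernel_def intro!: mult_right_mono)
  qed simp_all
  \<comment> \<open>Substituting t z for z moves the parameter from the kernel into the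
    autocorrelation, which leaves one fixed integrable weight for dominated convergence.\<close>
  moreover have "(LINT z::real^'n|lborel. autocorrelation f (t k *\<^sub>R z) * of_real (gaussian_kernel 1 z)) = complex_of_real (?I k)" for k
  proof -
    have scale: "c *\<^sub>R (a * complex_of_real (r / c)) = a * complex_of_real r" if "c \<noteq> 0" for a c r
      using that by (simp add: scaleR_conv_of_real)
    have kernel: "gaussian_kernel (t k) (t k *\<^sub>R z) = gaussian_kernel 1 z / t k ^ CARD('n)" for z :: "real^'n"
      using t[of k] by (simp add: gaussian_kernel_def power_mult_distrib)
    have "complex_of_real (?I k) = (LINT z|lborel. autocorrelation f z * of_real (gaussian_kernel (t k) z))"
      by (rule integral_fourier_gaussian(2)[OF f bd t])
    also have "\<dots> = (t k ^ CARD('n)) *\<^sub>R (LINT z::real^'n|lborel. autocorrelation f (t k *\<^sub>R z) * of_real (gaussian_kernel (t k) (t k *\<^sub>R z)))"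
      using t[of k] by (subst integral_affine[of "t k" _ 0]) auto
    also have "\<dots> = (LINT z::real^'n|lborel. autocorrelation f (t k *\<^sub>R z) * of_real (gaussian_kernel 1 z))"
      unfolding integral_scaleR_right[symmetric] kernel
      using t[of k] by (subst scale) auto
    finally show ?thesis by simp
  qed
  moreover have "(LINT z::real^'n|lborel. autocorrelation f 0 * of_real (gaussian_kernel 1 z)) = complex_of_real ((l2norm f)\<^sup>2)"
  proof -
    have "(LINT z::real^'n|lborel. complex_of_real (gaussian_kernel 1 z)) = 1"
      by (simp add: integral_gaussian_kernel_1)
    moreover have "autocorrelation f 0 = complex_of_real ((l2norm f)\<^sup>2)"
      unfolding autocorrelation_def l2norm_power2 integral_complex_of_real[symmetric]
      by (intro Bochner_Integration.integral_cong refl) (simp add: complex_norm_square flip: of_real_power)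
    ultimately show ?thesis by simp
  qed
  ultimately have "(\<lambda>k. complex_of_real (?I k)) \<longlonglongrightarrow> complex_of_real ((l2norm f)\<^sup>2)"
    by (simp only:)
  then have lim: "?I \<longlonglongrightarrow> (l2norm f)\<^sup>2"
    by (simp only: tendsto_of_real_iff)
  have mono: "incseq (\<lambda>k. (cmod (fourier f \<xi>))\<^sup>2 * gaussian (t k) \<xi>)" for \<xi>
  proof (rule incseq_SucI, rule mult_left_mono)
    fix k
    have "(t (Suc k))\<^sup>2 \<le> (t k)\<^sup>2" by (intro power_mono) (auto simp: t_def frac_le)
    then show "gaussian (t k) \<xi> \<le> gaussian (t (Suc k)) \<xi>"
      by (simp add: gaussian_def mult_right_mono)
  qed simp
  have gl: "(\<lambda>k. (cmod (fourier f \<xi>))\<^sup>2 * gaussian (t k) \<xi>) \<longlonglongrightarrow> (cmod (fourier f \<xi>))\<^sup>2" for \<xi>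
  proof -
    have "(\<lambda>k. (cmod (fourier f \<xi>))\<^sup>2 * exp (- pi * (t k)\<^sup>2 * (norm \<xi>)\<^sup>2)) \<longlonglongrightarrow> (cmod (fourier f \<xi>))\<^sup>2 * exp (- pi * 0\<^sup>2 * (norm \<xi>)\<^sup>2)"
      by (intro tendsto_intros t0)
    then show ?thesis by (simp add: gaussian_def)
  qed
  \<comment> \<open>Monotone convergence yields square integrability of the transform as part of its
    conclusion, from the finite limit of the damped integrals.\<close>
  have "integrable lborel (\<lambda>\<xi>. (cmod (fourier f \<xi>))\<^sup>2)"
    by (rule integrable_monotone_convergence[OF integral_fourier_gaussian(1)[OF f bd t] _ _ lim])
       (use mono gl in auto)
  then show "fourier f \<in> L2" by (intro L2I) auto
  have "(LINT \<xi>|lborel. (cmod (fourier f \<xi>))\<^sup>2) = (l2norm f)\<^sup>2"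
    by (rule integral_monotone_convergence[OF integral_fourier_gaussian(1)[OF f bd t] _ _ lim])
       (use mono gl in auto)
  then show "l2norm (fourier f) = l2norm f" unfolding l2norm_def[of "fourier f"] by simp
qed

lemma L2_dominated_convergence:
  fixes s :: "nat \<Rightarrow> real^'n \<Rightarrow> complex"
  assumes f: "f \<in> L2" and [measurable]: "\<And>k. s k \<in> borel_measurable borel"
    and bd: "\<And>k x. cmod (s k x - f x) \<le> cmod (f x)" and lim: "\<And>x. (\<lambda>k. s k x) \<longlonglongrightarrow> f x"
  shows "(\<lambda>k. l2norm (\<lambda>x. s k x - f x)) \<longlonglongrightarrow> 0"
proof -
  note [measurable] = L2_measurable[OF f]
  have "(\<lambda>k. LINT x|lborel. (cmod (s k x - f x))\<^sup>2) \<longlonglongrightarrow> (LINT x::real^'n|lborel. 0)"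
  proof (rule integral_dominated_convergence[OF _ _ L2_integrable[OF f]])
    show "AE x in lborel. (\<lambda>k. (cmod (s k x - f x))\<^sup>2) \<longlonglongrightarrow> 0"
    proof (intro always_eventually allI)
      fix x
      have "(\<lambda>k. (cmod (s k x - f x))\<^sup>2) \<longlonglongrightarrow> (cmod (f x - f x))\<^sup>2"
        by (intro tendsto_intros lim)
      then show "(\<lambda>k. (cmod (s k x - f x))\<^sup>2) \<longlonglongrightarrow> 0" by simp
    qed
    show "AE x in lborel. norm ((cmod (s k x - f x))\<^sup>2) \<le> (cmod (f x))\<^sup>2" for k
      using bd by (intro always_eventually allI) (simp add: power_mono)
  qed simp_all
  then have "(\<lambda>k. sqrt (LINT x|lborel. (cmod (s k x - f x))\<^sup>2)) \<longlonglongrightarrow> sqrt 0"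
    by (intro tendsto_intros) simp
  then show ?thesis by (simp add: l2norm_def)
qed

text \<open>Cutting off large values reduces to bounded functions. The truncations converge in L1,
  which makes their transforms converge pointwise, and in L2, where the isometry already holds for
  them.\<close>

theorem Plancherel:
  fixes f :: "real^'n \<Rightarrow> complex"
  assumes f: "integrable lborel f" and f2: "f \<in> L2"
  shows "fourier f \<in> L2" "l2norm (fourier f) = l2norm f"
proof -
  have [measurable]: "f \<in> borel_measurable borel" using f by auto
  define s where "s k x = (if cmod (f x) \<le> real k then f x else 0)" for k :: nat and x
  have [measurable]: "s k \<in> borel_measurable borel" for k unfolding s_def by measurable
  have sle: "cmod (s k x) \<le> cmod (f x)" "cmod (s k x) \<le> real k" for k x
    by (auto simp: s_def)
  have slim: "(\<lambda>k. s k x) \<longlonglongrightarrow> f x" for x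
  proof -
    have "\<forall>\<^sub>F k in sequentially. s k x = f x"
      using eventually_ge_at_top[of "nat \<lceil>cmod (f x)\<rceil>"]
    proof eventually_elim
      fix k assume "nat \<lceil>cmod (f x)\<rceil> \<le> k"
      then have "cmod (f x) \<le> real k" by linarith
      then show "s k x = f x" by (simp add: s_def)
    qed
    then show ?thesis by (rule tendsto_eventually)
  qed
  have s1: "integrable lborel (s k)" for k
    by (rule integrable_le[of _ "\<lambda>x. cmod (f x)"]) (use f sle in auto)
  have s2: "s k \<in> L2" for k by (rule L2_mono_AE(1)[OF f2]) (use sle in auto)
  have s_conv: "(\<lambda>k. l2norm (\<lambda>x. s k x - f x)) \<longlonglongrightarrow> 0"
    by (rule L2_dominated_convergence[OF f2 _ _ slim]) (auto simp: s_def)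
  have "(\<lambda>k. LINT x|lborel. cmod (s k x - f x)) \<longlonglongrightarrow> (LINT x::real^'n|lborel. 0)"
  proof (rule integral_dominated_convergence)
    show "integrable lborel (\<lambda>x. cmod (f x))" using f by simp
    show "AE x in lborel. (\<lambda>k. cmod (s k x - f x)) \<longlonglongrightarrow> 0"
      using slim by (intro always_eventually allI tendsto_norm_zero LIM_zero)
    show "AE x in lborel. norm (cmod (s k x - f x)) \<le> cmod (f x)" for k
      by (intro always_eventually allI) (auto simp: s_def)
  qed simp_all
  then have L1: "(\<lambda>k. LINT x|lborel. cmod (s k x - f x)) \<longlonglongrightarrow> 0" by simp
  have Flim: "(\<lambda>k. fourier (s k) \<xi>) \<longlonglongrightarrow> fourier f \<xi>" for \<xi>
  proof (rule LIM_zero_cancel, rule Lim_null_comparison[OF _ L1], intro always_eventually allI)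
    fix k
    show "norm (fourier (s k) \<xi> - fourier f \<xi>) \<le> (LINT x|lborel. cmod (s k x - f x))"
      unfolding fourier_diff[OF s1 f, symmetric] by (rule norm_fourier_le)
  qed
  have F2: "fourier (s k) \<in> L2" for k by (rule Plancherel_bounded(1)[OF s1 sle(2)])
  have Fdiff: "l2norm (\<lambda>\<xi>. fourier (s k) \<xi> - fourier (s j) \<xi>) = l2norm (\<lambda>x. s k x - s j x)" for k j
  proof -
    have bd: "cmod (s k x - s j x) \<le> real k + real j" for x
      using norm_triangle_ineq4[of "s k x" "s j x"] sle(2)[of k x] sle(2)[of j x] by linarith
    show ?thesis
      unfolding fourier_diff[OF s1 s1, symmetric]
      by (rule Plancherel_bounded(2)[OF _ bd]) (use s1 in simp)
  qed
  \<comment> \<open>Fatou in the second index \<open>j\<close>. The bound with an extra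
    \<open>e\<close> holds only from some \<open>j0\<close> on, hence the shifted index, and
    \<open>e\<close> is removed at the end.\<close>
  have key: "(\<lambda>\<xi>. fourier (s k) \<xi> - fourier f \<xi>) \<in> L2 \<and>
      l2norm (\<lambda>\<xi>. fourier (s k) \<xi> - fourier f \<xi>) \<le> l2norm (\<lambda>x. s k x - f x)" for k
  proof -
    have near: "\<exists>j0. \<forall>j\<ge>j0. l2norm (\<lambda>x. s k x - s j x) \<le> l2norm (\<lambda>x. s k x - f x) + e" if e: "e > 0" for e
    proof -
      from LIMSEQ_D[OF s_conv e] obtain j0 where j0: "\<And>j. j \<ge> j0 \<Longrightarrow> l2norm (\<lambda>x. s j x - f x) < e" by auto
      have "l2norm (\<lambda>x. s k x - s j x) \<le> l2norm (\<lambda>x. s k x - f x) + e" if "j \<ge> j0" for j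
        using l2norm_triangle_diff[OF s2[of k] f2 s2[of j]] j0[OF that]
        by (simp add: l2norm_minus_commute[of f])
      then show ?thesis by blast
    qed
    have "(\<lambda>\<xi>. fourier (s k) \<xi> - fourier f \<xi>) \<in> L2 \<and>
      l2norm (\<lambda>\<xi>. fourier (s k) \<xi> - fourier f \<xi>) \<le> l2norm (\<lambda>x. s k x - f x) + e" if e: "e > 0" for e
    proof -
      obtain j0 where j0: "\<And>j. j \<ge> j0 \<Longrightarrow> l2norm (\<lambda>x. s k x - s j x) \<le> l2norm (\<lambda>x. s k x - f x) + e"
        using near[OF e] by blast
      have lim: "AE \<xi> in lborel. (\<lambda>j. fourier (s k) \<xi> - fourier (s (j + j0)) \<xi>) \<longlonglongrightarrow> fourier (s k) \<xi> - fourier f \<xi>"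
        by (intro always_eventually allI tendsto_intros LIMSEQ_ignore_initial_segment Flim)
      have L2j: "(\<lambda>\<xi>. fourier (s k) \<xi> - fourier (s (j + j0)) \<xi>) \<in> L2" for j by (intro L2_diff F2)
      have bdj: "l2norm (\<lambda>\<xi>. fourier (s k) \<xi> - fourier (s (j + j0)) \<xi>) \<le> l2norm (\<lambda>x. s k x - f x) + e" for j
        unfolding Fdiff by (rule j0) simp
      show ?thesis using L2_Fatou[OF L2j bdj _ lim] by simp
    qed
    then show ?thesis using field_le_epsilon zero_less_one by metis
  qed
  show L2: "fourier f \<in> L2"
    using L2_diff[OF F2[of 0] key[of 0, THEN conjunct1]] by simp
  have "(\<lambda>k. l2norm (\<lambda>\<xi>. fourier (s k) \<xi> - fourier f \<xi>)) \<longlonglongrightarrow> 0"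
    by (rule tendsto_sandwich[OF _ _ tendsto_const s_conv]) (use key in auto)
  then have "(\<lambda>k. l2norm (fourier (s k))) \<longlonglongrightarrow> l2norm (fourier f)"
    by (rule l2norm_tendsto[OF F2 L2])
  moreover have "l2norm (fourier (s k)) = l2norm (s k)" for k
    by (rule Plancherel_bounded(2)[OF s1 sle(2)])
  ultimately have "(\<lambda>k. l2norm (s k)) \<longlonglongrightarrow> l2norm (fourier f)" by simp
  then show "l2norm (fourier f) = l2norm f"
    using LIMSEQ_unique l2norm_tendsto[OF s2 f2 s_conv] by blast
qed

subsection \<open>The Fourier transform on square integrable functions\<close>

abbreviation ball_truncation :: "real \<Rightarrow> (real^'n \<Rightarrow> complex) \<Rightarrow> real^'n \<Rightarrow> complex" where
  "ball_truncation R f \<equiv> (\<lambda>x. indicator (cball 0 R) x *\<^sub>R f x)"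

lemma L2_indicator:
  fixes f :: "real^'n \<Rightarrow> complex"
  assumes "f \<in> L2" "A \<in> sets borel"
  shows "(\<lambda>x. indicator A x *\<^sub>R f x) \<in> L2"
proof (rule L2_mono_AE(1)[OF assms(1)])
  note [measurable] = L2_measurable[OF assms(1)] assms(2)
  show "(\<lambda>x. indicator A x *\<^sub>R f x) \<in> borel_measurable borel" by measurable
qed (auto simp: indicator_def)

lemmas ball_truncation_L2 = L2_indicator[OF _ borel_closed[OF closed_cball[of 0]]]

lemma ball_truncation_integrable:
  fixes f :: "real^'n \<Rightarrow> complex"
  assumes f: "f \<in> L2"
  shows "integrable lborel (ball_truncation R f)"
proof (rule integrable_le)
  note [measurable] = L2_measurable[OF f]
  have "integrable lborel (indicator (cball (0::real^'n) R) :: _ \<Rightarrow> real)"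
    using emeasure_lborel_cball_finite by (intro integrable_real_indicator) auto
  then show "integrable lborel (\<lambda>x. indicator (cball (0::real^'n) R) x + (cmod (f x))\<^sup>2)"
    using L2_integrable[OF f] by simp
  have "y \<le> 1 + y\<^sup>2" for y :: real
    using sum_squares_bound[of y 1] by (cases "y \<ge> 0") (auto intro: order_trans[of _ 0])
  then show "norm (indicator (cball 0 R) x *\<^sub>R f x) \<le> indicator (cball 0 R) x + (cmod (f x))\<^sup>2" for x
    by (auto simp: indicator_def)
qed (use L2_measurable[OF ball_truncation_L2[OF f]] in simp)

lemma ball_truncation_tendsto:
  fixes f :: "real^'n \<Rightarrow> complex"
  assumes f: "f \<in> L2"
  shows "((\<lambda>R. l2norm (\<lambda>x. ball_truncation R f x - f x)) \<longlongrightarrow> 0) at_top"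
proof (rule tendsto_at_topI_sequentially)
  fix X :: "nat \<Rightarrow> real" assume X: "filterlim X at_top sequentially"
  note [measurable] = L2_measurable[OF f]
  show "(\<lambda>k. l2norm (\<lambda>x. ball_truncation (X k) f x - f x)) \<longlonglongrightarrow> 0"
  proof (rule L2_dominated_convergence[OF f])
    fix x :: "real^'n"
    have "\<forall>\<^sub>F k in sequentially. norm x \<le> X k"
      using X by (auto simp: filterlim_at_top)
    then have "\<forall>\<^sub>F k in sequentially. ball_truncation (X k) f x = f x"
      by eventually_elim auto
    then show "(\<lambda>k. ball_truncation (X k) f x) \<longlonglongrightarrow> f x" by (rule tendsto_eventually)
  qed (use L2_measurable[OF ball_truncation_L2[OF f]] in \<open>auto simp: indicator_def\<close>)
qed

lemmas fourier_ball_truncation_L2 = Plancherel(1)[OF ball_truncation_integrable ball_truncation_L2]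

lemma l2norm_fourier_diff:
  fixes f g :: "real^'n \<Rightarrow> complex"
  assumes "integrable lborel f" "f \<in> L2" "integrable lborel g" "g \<in> L2"
  shows "l2norm (\<lambda>\<xi>. fourier f \<xi> - fourier g \<xi>) = l2norm (\<lambda>x. f x - g x)"
proof -
  have "l2norm (fourier (\<lambda>x. f x - g x)) = l2norm (\<lambda>x. f x - g x)"
    using assms by (intro Plancherel(2) L2_diff) auto
  then show ?thesis unfolding fourier_diff[OF assms(1,3), abs_def] .
qed

text \<open>Existence of the limit that \<open>l2_fourier\<close> selects: Plancherel makes the
  transforms of the ball truncations a Cauchy family.\<close>

lemma l2_fourier_props:
  fixes f :: "real^'n \<Rightarrow> complex"
  assumes f: "f \<in> L2"
  shows l2_fourier_L2: "l2_fourier f \<in> L2"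
    and l2_fourier_tendsto: "((\<lambda>R. l2norm (\<lambda>\<xi>. l2_fourier f \<xi> - fourier (ball_truncation R f) \<xi>)) \<longlongrightarrow> 0) at_top"
proof -
  let ?s = "\<lambda>k::nat. fourier (ball_truncation (real k) f)"
  note ft = ball_truncation_integrable[OF f] ball_truncation_L2[OF f]
  have lim: "(\<lambda>k::nat. l2norm (\<lambda>x. ball_truncation (real k) f x - f x)) \<longlonglongrightarrow> 0"
    using ball_truncation_tendsto[OF f] filterlim_real_sequentially by (rule filterlim_compose)
  have le: "l2norm (\<lambda>x. ball_truncation R f x - ball_truncation S f x) \<le>
      l2norm (\<lambda>x. ball_truncation R f x - f x) + l2norm (\<lambda>x. ball_truncation S f x - f x)" for R S
    using l2norm_triangle_diff[OF ft(2)[of R] f ft(2)[of S]] by (simp add: l2norm_minus_commute[of f])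
  obtain F where F: "F \<in> L2" "(\<lambda>k. l2norm (\<lambda>x. ?s k x - F x)) \<longlonglongrightarrow> 0"
  proof (rule L2_complete)
    show "?s k \<in> L2" for k by (rule fourier_ball_truncation_L2[OF f f])
    fix e :: real assume "e > 0"
    from LIMSEQ_D[OF lim half_gt_zero[OF this]] obtain N
      where N: "\<And>k. k \<ge> N \<Longrightarrow> l2norm (\<lambda>x. ball_truncation (real k) f x - f x) < e / 2" by auto
    show "\<exists>N. \<forall>m\<ge>N. \<forall>n\<ge>N. l2norm (\<lambda>x. ?s m x - ?s n x) \<le> e"
    proof (intro exI[of _ N] allI impI)
      fix m n assume "m \<ge> N" "n \<ge> N"
      then show "l2norm (\<lambda>x. ?s m x - ?s n x) \<le> e"
        unfolding l2norm_fourier_diff[OF ft ft]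
        using le[of "real m" "real n"] N[of m] N[of n] by linarith
    qed
  qed
  \<comment> \<open>Completeness only gave a limit along integer radii; this estimate compares it
    with every real radius \<open>R\<close>, as the definition demands.\<close>
  have bd: "l2norm (\<lambda>\<xi>. F \<xi> - fourier (ball_truncation R f) \<xi>) \<le> l2norm (\<lambda>x. ball_truncation R f x - f x)" for R
  proof -
    have "(\<lambda>k. l2norm (\<lambda>x. ?s k x - F x) + (l2norm (\<lambda>x. ball_truncation (real k) f x - f x) + l2norm (\<lambda>x. ball_truncation R f x - f x)))
      \<longlonglongrightarrow> 0 + (0 + l2norm (\<lambda>x. ball_truncation R f x - f x))"
      by (intro tendsto_intros F lim)
    moreover have "l2norm (\<lambda>\<xi>. F \<xi> - fourier (ball_truncation R f) \<xi>) \<le>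
      l2norm (\<lambda>x. ?s k x - F x) + (l2norm (\<lambda>x. ball_truncation (real k) f x - f x) + l2norm (\<lambda>x. ball_truncation R f x - f x))" for k
    proof -
      have "l2norm (\<lambda>\<xi>. F \<xi> - fourier (ball_truncation R f) \<xi>) \<le> l2norm (\<lambda>x. F x - ?s k x) + l2norm (\<lambda>x. ?s k x - fourier (ball_truncation R f) x)"
        by (intro l2norm_triangle_diff F fourier_ball_truncation_L2[OF f f])
      then show ?thesis
        using le[of "real k" R] unfolding l2norm_fourier_diff[OF ft ft] l2norm_minus_commute[of F] by linarith
    qed
    ultimately have "l2norm (\<lambda>\<xi>. F \<xi> - fourier (ball_truncation R f) \<xi>) \<le> 0 + (0 + l2norm (\<lambda>x. ball_truncation R f x - f x))"
      using LIMSEQ_le_const by blast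
    then show ?thesis by simp
  qed
  have "((\<lambda>R. l2norm (\<lambda>\<xi>. F \<xi> - fourier (ball_truncation R f) \<xi>)) \<longlongrightarrow> 0) at_top"
    by (rule tendsto_sandwich[OF _ _ tendsto_const ball_truncation_tendsto[OF f]]) (use bd in auto)
  with F(1) have "\<exists>F. F \<in> L2 \<and> ((\<lambda>R. l2norm (\<lambda>\<xi>. F \<xi> - fourier (ball_truncation R f) \<xi>)) \<longlongrightarrow> 0) at_top"
    by blast
  from someI_ex[OF this]
  show "l2_fourier f \<in> L2"
    "((\<lambda>R. l2norm (\<lambda>\<xi>. l2_fourier f \<xi> - fourier (ball_truncation R f) \<xi>)) \<longlongrightarrow> 0) at_top"
    unfolding l2_fourier_def by auto
qed

text \<open>Makes the choice in \<open>l2_fourier\<close> harmless: any L2 function with the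
  defining limit property represents the same class.\<close>

lemma l2_fourier_unique:
  fixes f F :: "real^'n \<Rightarrow> complex"
  assumes "f \<in> L2" "F \<in> L2" "((\<lambda>R. l2norm (\<lambda>\<xi>. F \<xi> - fourier (ball_truncation R f) \<xi>)) \<longlongrightarrow> 0) at_top"
  shows "AE \<xi> in lborel. l2_fourier f \<xi> = F \<xi>"
  using fourier_ball_truncation_L2[OF assms(1,1)] l2_fourier_L2[OF assms(1)] assms(2)
proof (rule L2_limit_unique[OF trivial_limit_at_top_linorder])
  show "((\<lambda>R. l2norm (\<lambda>\<xi>. fourier (ball_truncation R f) \<xi> - l2_fourier f \<xi>)) \<longlongrightarrow> 0) at_top"
    using l2_fourier_tendsto[OF assms(1)] by (subst l2norm_minus_commute)
  show "((\<lambda>R. l2norm (\<lambda>\<xi>. fourier (ball_truncation R f) \<xi> - F \<xi>)) \<longlongrightarrow> 0) at_top"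
    using assms(3) by (subst l2norm_minus_commute)
qed

lemma l2_fourier_eq_fourier:
  fixes f :: "real^'n \<Rightarrow> complex"
  assumes "integrable lborel f" "f \<in> L2"
  shows "AE \<xi> in lborel. l2_fourier f \<xi> = fourier f \<xi>"
proof (rule l2_fourier_unique[OF assms(2) Plancherel(1)[OF assms]])
  have "l2norm (\<lambda>\<xi>. fourier f \<xi> - fourier (ball_truncation R f) \<xi>) = l2norm (\<lambda>x. ball_truncation R f x - f x)" for R
    using assms by (subst l2norm_fourier_diff)
      (auto intro: ball_truncation_integrable ball_truncation_L2 simp: l2norm_minus_commute[of f])
  then show "((\<lambda>R. l2norm (\<lambda>\<xi>. fourier f \<xi> - fourier (ball_truncation R f) \<xi>)) \<longlongrightarrow> 0) at_top"
    using ball_truncation_tendsto[OF assms(2)] by simp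
qed

lemma l2norm_l2_fourier:
  fixes f :: "real^'n \<Rightarrow> complex"
  assumes f: "f \<in> L2"
  shows "l2norm (l2_fourier f) = l2norm f"
proof -
  have "((\<lambda>R. l2norm (fourier (ball_truncation R f))) \<longlongrightarrow> l2norm (l2_fourier f)) at_top"
    by (rule l2norm_tendsto[OF fourier_ball_truncation_L2[OF f f] l2_fourier_L2[OF f]])
       (use l2_fourier_tendsto[OF f] in \<open>subst l2norm_minus_commute\<close>)
  moreover have "l2norm (fourier (ball_truncation R f)) = l2norm (ball_truncation R f)" for R
    by (rule Plancherel(2)[OF ball_truncation_integrable[OF f] ball_truncation_L2[OF f]])
  ultimately have "((\<lambda>R. l2norm (ball_truncation R f)) \<longlongrightarrow> l2norm (l2_fourier f)) at_top" by simp
  moreover have "((\<lambda>R. l2norm (ball_truncation R f)) \<longlongrightarrow> l2norm f) at_top"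
    by (rule l2norm_tendsto[OF ball_truncation_L2[OF f] f ball_truncation_tendsto[OF f]])
  ultimately show ?thesis using tendsto_unique trivial_limit_at_top_linorder by blast
qed

lemma l2_fourier_add:
  fixes f g :: "real^'n \<Rightarrow> complex"
  assumes "f \<in> L2" "g \<in> L2"
  shows "AE \<xi> in lborel. l2_fourier (\<lambda>x. f x + g x) \<xi> = l2_fourier f \<xi> + l2_fourier g \<xi>"
proof (rule l2_fourier_unique)
  note F = assms[THEN l2_fourier_L2]
  show "(\<lambda>x. f x + g x) \<in> L2" "(\<lambda>\<xi>. l2_fourier f \<xi> + l2_fourier g \<xi>) \<in> L2"
    by (intro L2_add assms F)+
  let ?d = "\<lambda>f R \<xi>. l2_fourier f \<xi> - fourier (ball_truncation R f) \<xi>"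
  have eq: "l2_fourier f \<xi> + l2_fourier g \<xi> - fourier (ball_truncation R (\<lambda>x. f x + g x)) \<xi> = ?d f R \<xi> + ?d g R \<xi>" for R \<xi>
    using fourier_add[OF assms[THEN ball_truncation_integrable, of R], of \<xi>]
    by (simp add: scaleR_add_right)
  have le: "l2norm (\<lambda>\<xi>. ?d f R \<xi> + ?d g R \<xi>) \<le> l2norm (?d f R) + l2norm (?d g R)" for R
    by (intro l2norm_triangle L2_diff F assms fourier_ball_truncation_L2)
  have lim: "((\<lambda>R. l2norm (?d f R) + l2norm (?d g R)) \<longlongrightarrow> 0) at_top"
    using tendsto_add[OF l2_fourier_tendsto[OF assms(1)] l2_fourier_tendsto[OF assms(2)]] by simp
  show "((\<lambda>R. l2norm (\<lambda>\<xi>. l2_fourier f \<xi> + l2_fourier g \<xi> - fourier (ball_truncation R (\<lambda>x. f x + g x)) \<xi>)) \<longlongrightarrow> 0) at_top"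
    unfolding eq by (rule tendsto_sandwich[OF _ _ tendsto_const lim]) (intro always_eventually allI l2norm_nonneg le)+
qed

lemma l2_fourier_mult_const:
  fixes f :: "real^'n \<Rightarrow> complex"
  assumes "f \<in> L2"
  shows "AE \<xi> in lborel. l2_fourier (\<lambda>x. c * f x) \<xi> = c * l2_fourier f \<xi>"
proof (rule l2_fourier_unique)
  show "(\<lambda>x. c * f x) \<in> L2" "(\<lambda>\<xi>. c * l2_fourier f \<xi>) \<in> L2"
    by (intro L2_mult_const l2_fourier_L2 assms)+
  have "l2norm (\<lambda>\<xi>. c * l2_fourier f \<xi> - fourier (ball_truncation R (\<lambda>x. c * f x)) \<xi>) =
      cmod c * l2norm (\<lambda>\<xi>. l2_fourier f \<xi> - fourier (ball_truncation R f) \<xi>)" for R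
    unfolding l2norm_mult_const[symmetric] right_diff_distrib fourier_mult_const[symmetric] by simp
  then show "((\<lambda>R. l2norm (\<lambda>\<xi>. c * l2_fourier f \<xi> - fourier (ball_truncation R (\<lambda>x. c * f x)) \<xi>)) \<longlongrightarrow> 0) at_top"
    using tendsto_mult[OF tendsto_const l2_fourier_tendsto[OF assms], of "cmod c"] by simp
qed

lemma l2_fourier_diff:
  fixes f g :: "real^'n \<Rightarrow> complex"
  assumes "f \<in> L2" "g \<in> L2"
  shows "AE \<xi> in lborel. l2_fourier (\<lambda>x. f x - g x) \<xi> = l2_fourier f \<xi> - l2_fourier g \<xi>"
  using l2_fourier_add[OF assms(1) L2_mult_const[OF assms(2), of "-1"]]
    l2_fourier_mult_const[OF assms(2), of "-1"]
  by eventually_elim simp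

lemma l2norm_l2_fourier_diff:
  fixes f g :: "real^'n \<Rightarrow> complex"
  assumes "f \<in> L2" "g \<in> L2"
  shows "l2norm (\<lambda>\<xi>. l2_fourier f \<xi> - l2_fourier g \<xi>) = l2norm (\<lambda>x. f x - g x)"
proof -
  have "l2norm (\<lambda>\<xi>. l2_fourier f \<xi> - l2_fourier g \<xi>) = l2norm (l2_fourier (\<lambda>x. f x - g x))"
    by (intro l2norm_cong_AE L2_measurable L2_diff l2_fourier_L2 assms)
       (use l2_fourier_diff[OF assms] in \<open>eventually_elim, simp\<close>)
  then show ?thesis using l2norm_l2_fourier[OF L2_diff[OF assms]] by simp
qed

text \<open>Needed because elements of L2 are functions and not classes; it follows from the
  isometry applied to the difference. It is how the source representation, an a.e. identity, reaches
  the frequency side.\<close>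

lemma l2_fourier_cong_AE:
  fixes f g :: "real^'n \<Rightarrow> complex"
  assumes "f \<in> L2" "g \<in> L2" "AE x in lborel. f x = g x"
  shows "AE \<xi> in lborel. l2_fourier f \<xi> = l2_fourier g \<xi>"
proof (rule l2norm_diff_eq_0D[OF assms(1,2)[THEN l2_fourier_L2]])
  have "l2norm (\<lambda>x. f x - g x) = l2norm (\<lambda>x::real^'n. 0)"
    by (intro l2norm_cong_AE L2_measurable L2_diff assms(1,2) L2_zero) (use assms(3) in \<open>eventually_elim, simp\<close>)
  then show "l2norm (\<lambda>\<xi>. l2_fourier f \<xi> - l2_fourier g \<xi>) = 0"
    unfolding l2norm_l2_fourier_diff[OF assms(1,2)] by (simp add: l2norm_def)
qed

section \<open>Bilinear pairings, Parseval's identity and inversion\<close>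

lemma L2_integral_mult_tendsto:
  fixes f g :: "nat \<Rightarrow> real^'n \<Rightarrow> complex"
  assumes L2: "\<And>k. f k \<in> L2" "\<And>k. g k \<in> L2" "F \<in> L2" "G \<in> L2"
    and f: "(\<lambda>k. l2norm (\<lambda>x. f k x - F x)) \<longlonglongrightarrow> 0" and g: "(\<lambda>k. l2norm (\<lambda>x. g k x - G x)) \<longlonglongrightarrow> 0"
  shows "(\<lambda>k. LINT x|lborel. f k x * g k x) \<longlonglongrightarrow> (LINT x|lborel. F x * G x)"
proof (rule LIM_zero_cancel, rule Lim_null_comparison[OF always_eventually[OF allI]])
  fix k
  have "(LINT x|lborel. f k x * g k x) - (LINT x|lborel. F x * G x) = (LINT x|lborel. f k x * g k x - F x * G x)"
    by (intro Bochner_Integration.integral_diff[symmetric] L2_mult_integrable L2)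
  also have "\<dots> = (LINT x|lborel. (f k x - F x) * g k x + F x * (g k x - G x))"
    by (simp add: algebra_simps)
  also have "\<dots> = (LINT x|lborel. (f k x - F x) * g k x) + (LINT x|lborel. F x * (g k x - G x))"
    by (intro Bochner_Integration.integral_add L2_mult_integrable L2_diff L2)
  also have "cmod \<dots> \<le> l2norm (\<lambda>x. f k x - F x) * l2norm (g k) + l2norm F * l2norm (\<lambda>x. g k x - G x)"
    by (intro order_trans[OF norm_triangle_ineq] add_mono norm_integral_mult_le_l2norm L2_diff L2)
  finally show "norm ((LINT x|lborel. f k x * g k x) - (LINT x|lborel. F x * G x)) \<le>
    l2norm (\<lambda>x. f k x - F x) * l2norm (g k) + l2norm F * l2norm (\<lambda>x. g k x - G x)" .
next
  have "(\<lambda>k. l2norm (\<lambda>x. f k x - F x) * l2norm (g k) + l2norm F * l2norm (\<lambda>x. g k x - G x)) \<longlonglongrightarrow>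
      0 * l2norm G + l2norm F * 0"
    by (intro tendsto_intros f g l2norm_tendsto L2)
  then show "(\<lambda>k. l2norm (\<lambda>x. f k x - F x) * l2norm (g k) + l2norm F * l2norm (\<lambda>x. g k x - G x)) \<longlonglongrightarrow> 0" by simp
qed

lemma l2_fourier_multiplication_formula:
  fixes f g :: "real^'n \<Rightarrow> complex"
  assumes f: "f \<in> L2" and g: "g \<in> L2"
  shows "(LINT x|lborel. f x * l2_fourier g x) = (LINT x|lborel. l2_fourier f x * g x)"
proof (rule LIMSEQ_unique)
  have lim: "(\<lambda>k::nat. l2norm (\<lambda>x. ball_truncation (real k) h x - h x)) \<longlonglongrightarrow> 0" if "h \<in> L2" for h :: "real^'n \<Rightarrow> complex"
    using ball_truncation_tendsto[OF that] filterlim_real_sequentially by (rule filterlim_compose)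
  have limF: "(\<lambda>k::nat. l2norm (\<lambda>x. fourier (ball_truncation (real k) h) x - l2_fourier h x)) \<longlonglongrightarrow> 0"
    if "h \<in> L2" for h :: "real^'n \<Rightarrow> complex"
    using filterlim_compose[OF l2_fourier_tendsto[OF that] filterlim_real_sequentially] by (subst l2norm_minus_commute)
  note L2s = f g ball_truncation_L2 fourier_ball_truncation_L2 l2_fourier_L2 lim limF
  show "(\<lambda>k. LINT x|lborel. ball_truncation (real k) f x * fourier (ball_truncation (real k) g) x) \<longlonglongrightarrow>
      (LINT x|lborel. f x * l2_fourier g x)"
    by (intro L2_integral_mult_tendsto L2s)
  have "(\<lambda>k. LINT x|lborel. fourier (ball_truncation (real k) f) x * ball_truncation (real k) g x) \<longlonglongrightarrow>
      (LINT x|lborel. l2_fourier f x * g x)"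
    by (intro L2_integral_mult_tendsto L2s)
  then show "(\<lambda>k. LINT x|lborel. ball_truncation (real k) f x * fourier (ball_truncation (real k) g) x) \<longlonglongrightarrow>
      (LINT x|lborel. l2_fourier f x * g x)"
    unfolding fourier_multiplication_formula[OF ball_truncation_integrable[OF f] ball_truncation_integrable[OF g]] .
qed

lemma l2norm_add_power2:
  fixes f g :: "real^'n \<Rightarrow> complex"
  assumes "f \<in> L2" "g \<in> L2"
  shows "(l2norm (\<lambda>x. f x + g x))\<^sup>2 = (l2norm f)\<^sup>2 + (l2norm g)\<^sup>2 + 2 * Re (LINT x|lborel. f x * cnj (g x))"
proof -
  have int: "integrable lborel (\<lambda>x. f x * cnj (g x))" by (intro L2_mult_integrable L2_cnj assms)
  have "(cmod (a + b))\<^sup>2 = (cmod a)\<^sup>2 + (cmod b)\<^sup>2 + 2 * Re (a * cnj b)" for a b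
    unfolding cmod_power2 by (simp add: power2_eq_square algebra_simps)
  then have "(l2norm (\<lambda>x. f x + g x))\<^sup>2 = (LINT x|lborel. (cmod (f x))\<^sup>2 + (cmod (g x))\<^sup>2 + 2 * Re (f x * cnj (g x)))"
    unfolding l2norm_power2 by presburger
  also have "\<dots> = (l2norm f)\<^sup>2 + (l2norm g)\<^sup>2 + 2 * (LINT x|lborel. Re (f x * cnj (g x)))"
    unfolding l2norm_power2 using assms[THEN L2_integrable] integrable_Re[OF int]
    by (simp only: Bochner_Integration.integral_add Bochner_Integration.integrable_add integrable_mult_right integral_mult_right_zero)
  also have "(LINT x|lborel. Re (f x * cnj (g x))) = Re (LINT x|lborel. f x * cnj (g x))"
    by (rule integral_Re[OF int])
  finally show ?thesis .
qed

text \<open>Polarisation: expanding the norm of f + h on both sides of the isometry gives equality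
  of the real parts of the inner products.\<close>

lemma l2_fourier_Parseval:
  fixes f g :: "real^'n \<Rightarrow> complex"
  assumes "f \<in> L2" "g \<in> L2"
  shows "(LINT x|lborel. l2_fourier f x * cnj (l2_fourier g x)) = (LINT x|lborel. f x * cnj (g x))"
proof -
  have Re: "Re (LINT x|lborel. l2_fourier f x * cnj (l2_fourier h x)) = Re (LINT x|lborel. f x * cnj (h x))"
    if h: "h \<in> L2" for h
  proof -
    have "l2norm (\<lambda>x. l2_fourier f x + l2_fourier h x) = l2norm (l2_fourier (\<lambda>x. f x + h x))"
      by (intro l2norm_cong_AE L2_measurable L2_add l2_fourier_L2 assms h)
         (use l2_fourier_add[OF assms(1) h] in \<open>eventually_elim, simp\<close>)
    also have "\<dots> = l2norm (\<lambda>x. f x + h x)" by (intro l2norm_l2_fourier L2_add assms h)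
    finally have "(l2norm (\<lambda>x. l2_fourier f x + l2_fourier h x))\<^sup>2 = (l2norm (\<lambda>x. f x + h x))\<^sup>2" by simp
    then show ?thesis
      unfolding l2norm_add_power2[OF assms(1) h] l2norm_add_power2[OF l2_fourier_L2[OF assms(1)] l2_fourier_L2[OF h]]
      by (simp add: l2norm_l2_fourier[OF assms(1)] l2norm_l2_fourier[OF h])
  qed
  \<comment> \<open>The imaginary part is the real part of the pairing with
    \<open>\<i> * g\<close>.\<close>
  have "Re (LINT x|lborel. l2_fourier f x * cnj (l2_fourier (\<lambda>x. \<i> * g x) x)) =
      Re (LINT x|lborel. - \<i> * (l2_fourier f x * cnj (l2_fourier g x)))"
  proof (intro arg_cong[where f=Re] integral_cong_AE)
    note [measurable] = L2_measurable[OF l2_fourier_L2[OF assms(1)]] L2_measurable[OF l2_fourier_L2[OF assms(2)]]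
       L2_measurable[OF l2_fourier_L2[OF L2_mult_const[OF assms(2), of \<i>]]]
    show "(\<lambda>x. l2_fourier f x * cnj (l2_fourier (\<lambda>x. \<i> * g x) x)) \<in> borel_measurable lborel"
      "(\<lambda>x. - \<i> * (l2_fourier f x * cnj (l2_fourier g x))) \<in> borel_measurable lborel" by measurable
    show "AE x in lborel. l2_fourier f x * cnj (l2_fourier (\<lambda>x. \<i> * g x) x) = - \<i> * (l2_fourier f x * cnj (l2_fourier g x))"
      using l2_fourier_mult_const[OF assms(2), of \<i>] by eventually_elim simp
  qed
  also have "\<dots> = Im (LINT x|lborel. l2_fourier f x * cnj (l2_fourier g x))"
    unfolding integral_mult_right_zero by simp
  finally have "Im (LINT x|lborel. l2_fourier f x * cnj (l2_fourier g x)) = Re (LINT x|lborel. f x * cnj (\<i> * g x))"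
    using Re[OF L2_mult_const[OF assms(2), of \<i>]] by simp
  also have "\<dots> = Re (LINT x|lborel. - \<i> * (f x * cnj (g x)))"
    by (simp add: mult_ac)
  also have "\<dots> = Im (LINT x|lborel. f x * cnj (g x))"
    unfolding integral_mult_right_zero by simp
  finally show ?thesis using Re[OF assms(2)] by (simp add: complex_eq_iff)
qed

text \<open>The witness is the inverse transform, written without a reflection. That it is a preimage
  follows from Parseval's identity and the symmetry of the transform under the bilinear pairing.\<close>

lemma l2_fourier_surj:
  fixes k :: "real^'n \<Rightarrow> complex"
  assumes k: "k \<in> L2"
  shows "\<exists>f\<in>L2. AE \<xi> in lborel. l2_fourier f \<xi> = k \<xi>"
proof
  let ?G = "\<lambda>x. cnj (l2_fourier (\<lambda>y. cnj (k y)) x)"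
  show G: "?G \<in> L2" by (intro L2_cnj l2_fourier_L2 k)
  let ?D = "\<lambda>x. l2_fourier ?G x - k x"
  have D: "?D \<in> L2" by (intro L2_diff l2_fourier_L2 G k)
  have int: "integrable lborel (\<lambda>x. cnj (?D x) * l2_fourier ?G x)" "integrable lborel (\<lambda>x. cnj (?D x) * k x)"
    by (intro L2_mult_integrable L2_cnj D l2_fourier_L2[OF G] k)+
  \<comment> \<open>Pairing the conjugate of the defect with the transform and with \<open>k\<close>
    gives the same value; the difference of the two pairings is the squared norm of the
    defect.\<close>
  have "(LINT x|lborel. cnj (?D x) * l2_fourier ?G x) = (LINT x|lborel. l2_fourier (\<lambda>x. cnj (?D x)) x * ?G x)"
    by (rule l2_fourier_multiplication_formula[OF L2_cnj[OF D] G])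
  also have "\<dots> = (LINT x|lborel. cnj (?D x) * k x)"
    by (subst l2_fourier_Parseval[OF L2_cnj[OF D] L2_cnj[OF k]]) simp
  finally have "(LINT x|lborel. cnj (?D x) * l2_fourier ?G x - cnj (?D x) * k x) = 0"
    using int by simp
  then have "(LINT x|lborel. complex_of_real ((cmod (?D x))\<^sup>2)) = 0"
    unfolding complex_norm_square by (simp add: algebra_simps)
  then have "(l2norm ?D)\<^sup>2 = 0" by (simp only: integral_complex_of_real of_real_eq_0_iff l2norm_power2)
  then show "AE \<xi> in lborel. l2_fourier ?G \<xi> = k \<xi>"
    by (intro l2norm_diff_eq_0D l2_fourier_L2 G k) simp
qed

lemma l2_inv_fourier_props:
  fixes F :: "real^'n \<Rightarrow> complex"
  assumes "F \<in> L2"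
  shows l2_inv_fourier_L2: "l2_inv_fourier F \<in> L2"
    and l2_fourier_l2_inv_fourier: "AE \<xi> in lborel. l2_fourier (l2_inv_fourier F) \<xi> = F \<xi>"
proof -
  have "\<exists>f. f \<in> L2 \<and> (AE \<xi> in lborel. l2_fourier f \<xi> = F \<xi>)" using l2_fourier_surj[OF assms] by blast
  from someI_ex[OF this]
  show "l2_inv_fourier F \<in> L2" "AE \<xi> in lborel. l2_fourier (l2_inv_fourier F) \<xi> = F \<xi>"
    unfolding l2_inv_fourier_def by auto
qed

subsection \<open>Convolution\<close>

text \<open>The constant \<^const>\<open>convolution\<close> is the convolution of functions from the definitions; it
  shadows the convolution of measures of the probability library.\<close>

lemma nn_integral_convolution_power2_le:
  fixes k u :: "real^'n \<Rightarrow> complex"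
  assumes k: "integrable lborel k" and u: "u \<in> L2"
  shows "(\<integral>\<^sup>+x. (\<integral>\<^sup>+y. ennreal (cmod (k (x - y) * u y)) \<partial>lborel)\<^sup>2 \<partial>lborel) \<le>
    ennreal (((LINT x|lborel. cmod (k x)) * l2norm u)\<^sup>2)"
proof -
  let ?K = "LINT x|lborel. cmod (k x)"
  have [measurable]: "k \<in> borel_measurable borel" using k by auto
  note [measurable] = L2_measurable[OF u]
  have nk: "integrable lborel (\<lambda>x. cmod (k x))" using k by simp
  have kr: "(\<integral>\<^sup>+y. ennreal (cmod (k (x - y))) \<partial>lborel) = ennreal ?K" for x
    using integrable_reflect[OF nk, of x] integral_reflect[of "\<lambda>y. cmod (k y)" x]
    by (simp add: nn_integral_eq_integral)
  have kt: "(\<integral>\<^sup>+x. ennreal (cmod (k (x - y))) \<partial>lborel) = ennreal ?K" for y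
    using integrable_translate[OF nk, of y] integral_translate[of "\<lambda>y. cmod (k y)" y]
    by (simp add: nn_integral_eq_integral)
  \<comment> \<open>Young's inequality for L1 * L2: |k| is split as sqrt |k| times sqrt |k|, and
    only one of the factors is grouped with |u|.\<close>
  have CS: "(\<integral>\<^sup>+y. ennreal (cmod (k (x - y) * u y)) \<partial>lborel)\<^sup>2 \<le>
      ennreal ?K * (\<integral>\<^sup>+y. ennreal (cmod (k (x - y))) * ennreal ((cmod (u y))\<^sup>2) \<partial>lborel)" for x
  proof -
    let ?f = "\<lambda>y. ennreal (sqrt (cmod (k (x - y))))" and ?g = "\<lambda>y. ennreal (sqrt (cmod (k (x - y))) * cmod (u y))"
    have "(\<integral>\<^sup>+y. ?f y * ?g y \<partial>lborel)\<^sup>2 \<le> (\<integral>\<^sup>+y. (?f y)\<^sup>2 \<partial>lborel) * (\<integral>\<^sup>+y. (?g y)\<^sup>2 \<partial>lborel)"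
      by (rule Cauchy_Schwarz_nn_integral) auto
    moreover have "?f y * ?g y = ennreal (cmod (k (x - y) * u y))" for y
      by (simp add: ennreal_mult[symmetric] norm_mult mult.assoc[symmetric])
    moreover have "(?f y)\<^sup>2 = ennreal (cmod (k (x - y)))" for y
      by (simp add: ennreal_power)
    moreover have "(?g y)\<^sup>2 = ennreal (cmod (k (x - y))) * ennreal ((cmod (u y))\<^sup>2)" for y
      by (simp add: ennreal_power ennreal_mult[symmetric] power_mult_distrib)
    ultimately show ?thesis by (simp add: kr)
  qed
  have "(\<integral>\<^sup>+x. (\<integral>\<^sup>+y. ennreal (cmod (k (x - y) * u y)) \<partial>lborel)\<^sup>2 \<partial>lborel) \<le>
      (\<integral>\<^sup>+x. ennreal ?K * (\<integral>\<^sup>+y. ennreal (cmod (k (x - y))) * ennreal ((cmod (u y))\<^sup>2) \<partial>lborel) \<partial>lborel)"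
    by (intro nn_integral_mono CS)
  also have "\<dots> = ennreal ?K * (\<integral>\<^sup>+x. \<integral>\<^sup>+y. ennreal (cmod (k (x - y))) * ennreal ((cmod (u y))\<^sup>2) \<partial>lborel \<partial>lborel)"
    by (rule nn_integral_cmult) measurable
  also have "(\<integral>\<^sup>+x. \<integral>\<^sup>+y. ennreal (cmod (k (x - y))) * ennreal ((cmod (u y))\<^sup>2) \<partial>lborel \<partial>lborel) =
      (\<integral>\<^sup>+y. \<integral>\<^sup>+x. ennreal (cmod (k (x - y))) * ennreal ((cmod (u y))\<^sup>2) \<partial>lborel \<partial>lborel)"
    by (rule lborel_pair.Fubini'[symmetric]) measurable
  also have "\<dots> = (\<integral>\<^sup>+y. ennreal ?K * ennreal ((cmod (u y))\<^sup>2) \<partial>lborel)"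
    by (simp add: nn_integral_multc kt)
  also have "\<dots> = ennreal ?K * ennreal ((l2norm u)\<^sup>2)"
    using L2_integrable[OF u] by (simp add: nn_integral_cmult nn_integral_eq_integral l2norm_power2)
  also have "ennreal ?K * \<dots> = ennreal ((?K * l2norm u)\<^sup>2)"
    by (simp add: ennreal_mult[symmetric] power2_eq_square mult_ac)
  finally show ?thesis .
qed

lemma convolution_measurable:
  fixes k u :: "real^'n \<Rightarrow> complex"
  assumes [measurable]: "k \<in> borel_measurable borel" "u \<in> borel_measurable borel"
  shows "convolution k u \<in> borel_measurable borel"
  unfolding convolution_def[abs_def] by (rule lborel.borel_measurable_lebesgue_integral) simp

text \<open>All three claims come from one bound on the integral of |k(x - y) u(y)|, taken with
  values in [0, infinity]: its finiteness almost everywhere is absolute convergence of the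
  convolution.\<close>

lemma convolution_L2:
  fixes k u :: "real^'n \<Rightarrow> complex"
  assumes k: "integrable lborel k" and u: "u \<in> L2"
  shows "convolution k u \<in> L2"
    and "l2norm (convolution k u) \<le> (LINT x|lborel. cmod (k x)) * l2norm u"
    and "AE x in lborel. integrable lborel (\<lambda>y. k (x - y) * u y)"
proof -
  let ?K = "LINT x|lborel. cmod (k x)"
  have km[measurable]: "k \<in> borel_measurable borel" using k by auto
  note um[measurable] = L2_measurable[OF u]
  note cm[measurable] = convolution_measurable[OF km um]
  \<comment> \<open>Where the integrand is not integrable the convolution is 0 by default, and the
    estimate is trivial.\<close>
  have le: "ennreal ((cmod (convolution k u x))\<^sup>2) \<le> (\<integral>\<^sup>+y. ennreal (cmod (k (x - y) * u y)) \<partial>lborel)\<^sup>2" for x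
  proof -
    have "ennreal (cmod (convolution k u x)) \<le> (\<integral>\<^sup>+y. ennreal (cmod (k (x - y) * u y)) \<partial>lborel)"
      unfolding convolution_def
      by (cases "integrable lborel (\<lambda>y. k (x - y) * u y)")
         (auto simp: not_integrable_integral_eq intro: integral_norm_bound_ennreal)
    then show ?thesis by (simp add: ennreal_power[symmetric] power_mono)
  qed
  have bd: "(\<integral>\<^sup>+x. ennreal ((cmod (convolution k u x))\<^sup>2) \<partial>lborel) \<le> ennreal ((?K * l2norm u)\<^sup>2)"
    by (rule order_trans[OF nn_integral_mono[OF le] nn_integral_convolution_power2_le[OF k u]])
  then have int: "integrable lborel (\<lambda>x. (cmod (convolution k u x))\<^sup>2)"
    by (intro integrableI_bounded) (auto intro: le_less_trans[OF _ ennreal_less_top])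
  then show "convolution k u \<in> L2" by (intro L2I) auto
  have "(l2norm (convolution k u))\<^sup>2 \<le> (?K * l2norm u)\<^sup>2"
    using bd int by (simp add: nn_integral_eq_integral l2norm_power2)
  then show "l2norm (convolution k u) \<le> ?K * l2norm u" by (rule power2_le_imp_le) simp
  have "(\<integral>\<^sup>+x. (\<integral>\<^sup>+y. ennreal (cmod (k (x - y) * u y)) \<partial>lborel)\<^sup>2 \<partial>lborel) \<noteq> \<infinity>"
    using le_less_trans[OF nn_integral_convolution_power2_le[OF k u] ennreal_less_top] by simp
  then have "AE x in lborel. (\<integral>\<^sup>+y. ennreal (cmod (k (x - y) * u y)) \<partial>lborel)\<^sup>2 \<noteq> \<infinity>"
    by (rule nn_integral_PInf_AE[rotated]) measurable
  then show "AE x in lborel. integrable lborel (\<lambda>y. k (x - y) * u y)"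
  proof eventually_elim
    fix x assume "(\<integral>\<^sup>+y. ennreal (cmod (k (x - y) * u y)) \<partial>lborel)\<^sup>2 \<noteq> \<infinity>"
    then have "(\<integral>\<^sup>+y. ennreal (cmod (k (x - y) * u y)) \<partial>lborel) < \<infinity>"
      by (cases "(\<integral>\<^sup>+y. ennreal (cmod (k (x - y) * u y)) \<partial>lborel)") (auto simp: power2_eq_square)
    then show "integrable lborel (\<lambda>y. k (x - y) * u y)" by (intro integrableI_bounded) auto
  qed
qed

lemma convolution_diff_AE:
  fixes k u v :: "real^'n \<Rightarrow> complex"
  assumes "integrable lborel k" "u \<in> L2" "v \<in> L2"
  shows "AE x in lborel. convolution k (\<lambda>y. u y - v y) x = convolution k u x - convolution k v x"
  using convolution_L2(3)[OF assms(1,2)] convolution_L2(3)[OF assms(1,3)]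
  by eventually_elim (simp add: convolution_def right_diff_distrib)

lemma fourier_convolution:
  fixes k u :: "real^'n \<Rightarrow> complex"
  assumes k: "integrable lborel k" and u: "integrable lborel u"
  shows "integrable lborel (convolution k u)"
    and "fourier (convolution k u) \<xi> = fourier k \<xi> * fourier u \<xi>"
proof -
  have [measurable]: "k \<in> borel_measurable borel" "u \<in> borel_measurable borel" using k u by auto
  let ?P = "\<lambda>y x. u y * k (x - y)"
  have nk: "integrable lborel (\<lambda>x. cmod (k x))" using k by simp
  have P: "integrable (lborel \<Otimes>\<^sub>M lborel) (case_prod ?P)"
  proof (rule lborel_pair.Fubini_integrable)
    show "integrable lborel (\<lambda>y. LINT x|lborel. norm (case (y, x) of (y, x) \<Rightarrow> ?P y x))"
      using u integral_translate[of "\<lambda>y. cmod (k y)"] by (simp add: norm_mult)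
    show "AE y in lborel. integrable lborel (\<lambda>x. case (y, x) of (y, x) \<Rightarrow> ?P y x)"
      using integrable_translate[OF k] by simp
  qed measurable
  have conv: "convolution k u x = (LINT y|lborel. ?P y x)" for x
    by (simp add: convolution_def mult.commute)
  show "integrable lborel (convolution k u)"
    using lborel_pair.integrable_snd[OF P] by (simp add: conv[abs_def])
  let ?Q = "\<lambda>y x. ?P y x * fourier_char x \<xi>"
  have Q: "integrable (lborel \<Otimes>\<^sub>M lborel) (case_prod ?Q)"
  proof (rule integrable_le)
    show "integrable (lborel \<Otimes>\<^sub>M lborel) (\<lambda>z. norm (case_prod ?P z))" using P by simp
    show "norm (case_prod ?Q z) \<le> norm (case_prod ?P z)" for z
      by (simp add: case_prod_beta norm_mult)
  qed measurable
  have "fourier (convolution k u) \<xi> = (LINT x|lborel. LINT y|lborel. ?Q y x)"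
    by (simp add: fourier_eq conv)
  also have "\<dots> = (LINT y|lborel. LINT x|lborel. ?Q y x)"
    by (rule lborel_pair.Fubini_integral[OF Q])
  also have "\<dots> = (LINT y|lborel. (u y * fourier_char y \<xi>) * (LINT x|lborel. k (x - y) * fourier_char (x - y) \<xi>))"
  proof (intro Bochner_Integration.integral_cong refl)
    fix y
    have eq: "?Q y x = (u y * fourier_char y \<xi>) * (k (x - y) * fourier_char (x - y) \<xi>)" for x
      using fourier_char_add[of y "x - y" \<xi>] by simp
    show "(LINT x|lborel. ?Q y x) = (u y * fourier_char y \<xi>) * (LINT x|lborel. k (x - y) * fourier_char (x - y) \<xi>)"
      by (simp only: eq integral_mult_right_zero)
  qed
  also have "\<dots> = (LINT y|lborel. (u y * fourier_char y \<xi>) * fourier k \<xi>)"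
    using integral_translate[of "\<lambda>x. k x * fourier_char x \<xi>"] by (simp add: fourier_eq)
  also have "\<dots> = fourier k \<xi> * fourier u \<xi>" by (simp add: fourier_eq)
  finally show "fourier (convolution k u) \<xi> = fourier k \<xi> * fourier u \<xi>" .
qed

lemma L2_mult_bounded:
  fixes f m :: "real^'n \<Rightarrow> complex"
  assumes f: "f \<in> L2" and [measurable]: "m \<in> borel_measurable borel"
    and bd: "AE x in lborel. cmod (m x) \<le> C"
  shows "(\<lambda>x. m x * f x) \<in> L2" "l2norm (\<lambda>x. m x * f x) \<le> C * l2norm f"
proof -
  note [measurable] = L2_measurable[OF f]
  \<comment> \<open>A statement without the variable that holds a.e. is true, because Lebesgue
    measure is not the null measure.\<close>
  have "C \<ge> 0"
  proof -
    have "AE x in lborel :: (real^'n) measure. 0 \<le> C"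
      using bd by eventually_elim (rule order_trans[OF norm_ge_zero])
    then show ?thesis by (simp add: ae_filter_eq_bot_iff)
  qed
  have le: "AE x in lborel. cmod (m x * f x) \<le> cmod (complex_of_real C * f x)"
    using bd by eventually_elim (use \<open>C \<ge> 0\<close> in \<open>auto simp: norm_mult intro!: mult_right_mono\<close>)
  show "(\<lambda>x. m x * f x) \<in> L2" by (rule L2_mono_AE(1)[OF L2_mult_const[OF f, of C] _ le]) measurable
  have "l2norm (\<lambda>x. m x * f x) \<le> l2norm (\<lambda>x. C * f x)"
    by (rule L2_mono_AE(2)[OF L2_mult_const[OF f, of C] _ le]) measurable
  then show "l2norm (\<lambda>x. m x * f x) \<le> C * l2norm f" using \<open>C \<ge> 0\<close> by (simp add: l2norm_mult_const)
qed

text \<open>Both sides depend continuously on u in L2, with constant the L1 norm of k, and they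
  agree for ball truncations, which are integrable.\<close>

lemma l2_fourier_convolution:
  fixes k u :: "real^'n \<Rightarrow> complex"
  assumes k: "integrable lborel k" and u: "u \<in> L2"
  shows "AE \<xi> in lborel. l2_fourier (convolution k u) \<xi> = fourier k \<xi> * l2_fourier u \<xi>"
proof -
  let ?K = "LINT x|lborel. cmod (k x)"
  let ?u = "\<lambda>n::nat. ball_truncation (real n) u"
  have [measurable]: "k \<in> borel_measurable borel" using k by auto
  have lim: "(\<lambda>n. l2norm (\<lambda>x. ?u n x - u x)) \<longlonglongrightarrow> 0"
    using ball_truncation_tendsto[OF u] filterlim_real_sequentially by (rule filterlim_compose)
  then have Klim: "(\<lambda>n. ?K * l2norm (\<lambda>x. ?u n x - u x)) \<longlonglongrightarrow> 0"
    using tendsto_mult[OF tendsto_const[of ?K] lim] by simp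
  note un = ball_truncation_integrable[OF u] ball_truncation_L2[OF u]
  have kb: "AE \<xi> in lborel. cmod (fourier k \<xi>) \<le> ?K" by (simp add: norm_fourier_le)
  have kmult: "(\<lambda>\<xi>. fourier k \<xi> * g \<xi>) \<in> L2" "l2norm (\<lambda>\<xi>. fourier k \<xi> * g \<xi>) \<le> ?K * l2norm g"
    if "g \<in> L2" for g
    using L2_mult_bounded[OF that _ kb] by simp_all
  have cL2: "convolution k v \<in> L2" if "v \<in> L2" for v by (rule convolution_L2(1)[OF k that])
  show ?thesis
  proof (rule L2_limit_unique[OF trivial_limit_sequentially])
    show "l2_fourier (convolution k (?u n)) \<in> L2" for n by (intro l2_fourier_L2 cL2 un)
    show "l2_fourier (convolution k u) \<in> L2" by (intro l2_fourier_L2 cL2 u)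
    show "(\<lambda>\<xi>. fourier k \<xi> * l2_fourier u \<xi>) \<in> L2" by (intro kmult l2_fourier_L2 u)
    show "(\<lambda>n. l2norm (\<lambda>\<xi>. l2_fourier (convolution k (?u n)) \<xi> - l2_fourier (convolution k u) \<xi>)) \<longlonglongrightarrow> 0"
    proof (rule tendsto_sandwich[OF _ _ tendsto_const Klim]; intro always_eventually allI l2norm_nonneg)
      fix n
      have "l2norm (\<lambda>\<xi>. l2_fourier (convolution k (?u n)) \<xi> - l2_fourier (convolution k u) \<xi>) =
          l2norm (\<lambda>x. convolution k (?u n) x - convolution k u x)"
        by (intro l2norm_l2_fourier_diff cL2 un u)
      also have "\<dots> = l2norm (convolution k (\<lambda>x. ?u n x - u x))"
        by (intro l2norm_cong_AE L2_measurable L2_diff cL2 un u)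
           (use convolution_diff_AE[OF k un(2) u, of "real n"] in \<open>eventually_elim, simp\<close>)
      also have "\<dots> \<le> ?K * l2norm (\<lambda>x. ?u n x - u x)"
        by (intro convolution_L2 k L2_diff un u)
      finally show "l2norm (\<lambda>\<xi>. l2_fourier (convolution k (?u n)) \<xi> - l2_fourier (convolution k u) \<xi>) \<le> ?K * l2norm (\<lambda>x. ?u n x - u x)" .
    qed
    show "(\<lambda>n. l2norm (\<lambda>\<xi>. l2_fourier (convolution k (?u n)) \<xi> - fourier k \<xi> * l2_fourier u \<xi>)) \<longlonglongrightarrow> 0"
    proof (rule tendsto_sandwich[OF _ _ tendsto_const Klim]; intro always_eventually allI l2norm_nonneg)
      fix n
      have "l2norm (\<lambda>\<xi>. l2_fourier (convolution k (?u n)) \<xi> - fourier k \<xi> * l2_fourier u \<xi>) =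
          l2norm (\<lambda>\<xi>. fourier k \<xi> * (l2_fourier (?u n) \<xi> - l2_fourier u \<xi>))"
      proof (intro l2norm_cong_AE L2_measurable L2_diff l2_fourier_L2 kmult cL2 un u)
        show "AE \<xi> in lborel. cmod (l2_fourier (convolution k (?u n)) \<xi> - fourier k \<xi> * l2_fourier u \<xi>) =
            cmod (fourier k \<xi> * (l2_fourier (?u n) \<xi> - l2_fourier u \<xi>))"
          using l2_fourier_eq_fourier[OF fourier_convolution(1)[OF k un(1)] cL2[OF un(2)], of "real n"]
            l2_fourier_eq_fourier[OF un, of "real n"]
          by eventually_elim (simp add: fourier_convolution(2)[OF k un(1)] right_diff_distrib)
      qed
      also have "\<dots> \<le> ?K * l2norm (\<lambda>x. ?u n x - u x)"
        using kmult(2)[OF L2_diff[OF l2_fourier_L2[OF un(2)] l2_fourier_L2[OF u]], of "real n"]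
        by (simp add: l2norm_l2_fourier_diff[OF un(2) u])
      finally show "l2norm (\<lambda>\<xi>. l2_fourier (convolution k (?u n)) \<xi> - fourier k \<xi> * l2_fourier u \<xi>) \<le> ?K * l2norm (\<lambda>x. ?u n x - u x)" .
    qed
  qed
qed

section \<open>The mollifier as a multiplier\<close>

lemma fourier_dilate:
  fixes \<phi> :: "real^'n \<Rightarrow> real"
  assumes "\<beta> > 0"
  shows "fourier (\<lambda>x. complex_of_real (dilate \<beta> \<phi> x)) \<xi> = fourier (\<lambda>x. complex_of_real (\<phi> x)) (\<beta> *\<^sub>R \<xi>)"
proof -
  have scale: "c *\<^sub>R (complex_of_real (r / c) * a) = complex_of_real r * a" if "c \<noteq> 0" for a c r
    using that by (simp add: scaleR_conv_of_real)
  have char: "fourier_char (\<beta> *\<^sub>R x) \<xi> = fourier_char x (\<beta> *\<^sub>R \<xi>)" for x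
    by (simp add: fourier_char_def)
  have "fourier (\<lambda>x. complex_of_real (dilate \<beta> \<phi> x)) \<xi> =
     (\<beta> ^ CARD('n)) *\<^sub>R (LINT x|lborel. complex_of_real (\<phi> x / \<beta> ^ CARD('n)) * fourier_char x (\<beta> *\<^sub>R \<xi>))"
    unfolding fourier_eq using assms
    by (subst integral_affine[of \<beta> _ 0]) (auto simp: dilate_def char)
  also have "\<dots> = fourier (\<lambda>x. complex_of_real (\<phi> x)) (\<beta> *\<^sub>R \<xi>)"
    unfolding integral_scaleR_right[symmetric] fourier_eq using assms by (subst scale) auto
  finally show ?thesis .
qed

lemma integrable_dilate:
  fixes \<phi> :: "real^'n \<Rightarrow> real"
  assumes "\<beta> > 0" "integrable lborel \<phi>"
  shows "integrable lborel (dilate \<beta> \<phi>)"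
  using integrable_affine[OF _ assms(2), of "inverse \<beta>" 0] assms(1) by (simp add: dilate_def[abs_def])

lemma mollify_L2:
  fixes \<phi> :: "real^'n \<Rightarrow> real"
  assumes "\<beta> > 0" "integrable lborel \<phi>" "u \<in> L2"
  shows "mollify \<phi> \<beta> u \<in> L2"
    and "AE \<xi> in lborel. l2_fourier (mollify \<phi> \<beta> u) \<xi> = fourier (\<lambda>x. complex_of_real (\<phi> x)) (\<beta> *\<^sub>R \<xi>) * l2_fourier u \<xi>"
proof -
  have int: "integrable lborel (\<lambda>x. complex_of_real (dilate \<beta> \<phi> x))"
    using integrable_dilate[OF assms(1,2)] by simp
  show "mollify \<phi> \<beta> u \<in> L2" unfolding mollify_def by (rule convolution_L2(1)[OF int assms(3)])
  show "AE \<xi> in lborel. l2_fourier (mollify \<phi> \<beta> u) \<xi> = fourier (\<lambda>x. complex_of_real (\<phi> x)) (\<beta> *\<^sub>R \<xi>) * l2_fourier u \<xi>"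
    using l2_fourier_convolution[OF int assms(3)] by (simp add: mollify_def fourier_dilate[OF assms(1)])
qed

subsection \<open>Fourier multipliers\<close>

lemma fourier_multiplier_props:
  fixes m :: "real^'n \<Rightarrow> complex"
  assumes "l2_symbol m" "f \<in> L2"
  shows fourier_multiplier_L2: "fourier_multiplier m f \<in> L2"
    and l2_fourier_fourier_multiplier: "AE \<xi> in lborel. l2_fourier (fourier_multiplier m f) \<xi> = m \<xi> * l2_fourier f \<xi>"
  using assms l2_inv_fourier_props[of "\<lambda>\<xi>. m \<xi> * l2_fourier f \<xi>"]
  by (auto simp: fourier_multiplier_def l2_symbol_def)

lemma l2_symbol_bounded:
  fixes m :: "real^'n \<Rightarrow> complex"
  assumes "m \<in> borel_measurable borel" "\<And>\<xi>. cmod (m \<xi>) \<le> C"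
  shows "l2_symbol m"
  using assms by (auto simp: l2_symbol_def intro!: L2_mult_bounded(1)[where C=C] l2_fourier_L2)

lemma l2norm_multiplier_diff:
  fixes m\<^sub>1 m\<^sub>2 :: "real^'n \<Rightarrow> complex"
  assumes m: "l2_symbol m\<^sub>1" "l2_symbol m\<^sub>2" and f: "f \<in> L2"
  shows "l2norm (\<lambda>x. fourier_multiplier m\<^sub>1 f x - fourier_multiplier m\<^sub>2 f x) =
    l2norm (\<lambda>\<xi>. (m\<^sub>1 \<xi> - m\<^sub>2 \<xi>) * l2_fourier f \<xi>)"
proof -
  note M = fourier_multiplier_L2[OF m(1) f] fourier_multiplier_L2[OF m(2) f]
  have L2: "(\<lambda>\<xi>. (m\<^sub>1 \<xi> - m\<^sub>2 \<xi>) * l2_fourier f \<xi>) \<in> L2"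
    using m f by (simp add: l2_symbol_def left_diff_distrib L2_diff)
  have "l2norm (\<lambda>x. fourier_multiplier m\<^sub>1 f x - fourier_multiplier m\<^sub>2 f x) =
      l2norm (\<lambda>\<xi>. l2_fourier (fourier_multiplier m\<^sub>1 f) \<xi> - l2_fourier (fourier_multiplier m\<^sub>2 f) \<xi>)"
    by (rule l2norm_l2_fourier_diff[OF M, symmetric])
  also have "\<dots> = l2norm (\<lambda>\<xi>. (m\<^sub>1 \<xi> - m\<^sub>2 \<xi>) * l2_fourier f \<xi>)"
  proof (intro l2norm_cong_AE L2_measurable[OF L2] L2_measurable[OF L2_diff] l2_fourier_L2 M)
    show "AE \<xi> in lborel. cmod (l2_fourier (fourier_multiplier m\<^sub>1 f) \<xi> - l2_fourier (fourier_multiplier m\<^sub>2 f) \<xi>) =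
        cmod ((m\<^sub>1 \<xi> - m\<^sub>2 \<xi>) * l2_fourier f \<xi>)"
      using l2_fourier_fourier_multiplier[OF m(1) f] l2_fourier_fourier_multiplier[OF m(2) f]
      by eventually_elim (simp add: left_diff_distrib)
  qed
  finally show ?thesis .
qed

text \<open>The operator norm controls the essential supremum of the symbol: a set of positive
  measure where the symbol exceeds h would, through the function whose transform is its indicator,
  contradict the norm bound.\<close>

lemma l2_opnorm_multiplier_diff_D:
  fixes m\<^sub>1 m\<^sub>2 :: "real^'n \<Rightarrow> complex"
  assumes m: "l2_symbol m\<^sub>1" "l2_symbol m\<^sub>2"
    and op: "l2_opnorm (\<lambda>f x. fourier_multiplier m\<^sub>1 f x - fourier_multiplier m\<^sub>2 f x) \<le> ereal h"
  shows "0 \<le> h" "AE \<xi> in lborel. cmod (m\<^sub>1 \<xi> - m\<^sub>2 \<xi>) \<le> h"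
proof -
  let ?m = "\<lambda>\<xi>. m\<^sub>1 \<xi> - m\<^sub>2 \<xi>"
  have [measurable]: "m\<^sub>1 \<in> borel_measurable borel" "m\<^sub>2 \<in> borel_measurable borel"
    using m by (auto simp: l2_symbol_def)
  have le: "l2norm (\<lambda>\<xi>. ?m \<xi> * l2_fourier f \<xi>) \<le> h" if "f \<in> L2" "l2norm f \<le> 1" for f
  proof -
    have "ereal (l2norm (\<lambda>x. fourier_multiplier m\<^sub>1 f x - fourier_multiplier m\<^sub>2 f x)) \<le> ereal h"
      using that by (intro order_trans[OF SUP_upper op[unfolded l2_opnorm_def]]) auto
    then show ?thesis by (simp add: l2norm_multiplier_diff[OF m that(1)])
  qed
  have "l2norm (\<lambda>x::real^'n. 0) = 0" by (simp add: l2norm_def)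
  then show h: "0 \<le> h"
    by (intro order_trans[OF l2norm_nonneg le[OF L2_zero]]) simp
  \<comment> \<open>Normalises \<open>F\<close> and realises it as a transform of a unit vector, so
    the bound may be tested with any nonzero function on the frequency side.\<close>
  have scaled: "l2norm (\<lambda>\<xi>. ?m \<xi> * F \<xi>) \<le> h * l2norm F" if F: "F \<in> L2" "l2norm F > 0" for F
  proof -
    let ?c = "complex_of_real (1 / l2norm F)"
    let ?f = "l2_inv_fourier (\<lambda>\<xi>. ?c * F \<xi>)"
    have cF: "(\<lambda>\<xi>. ?c * F \<xi>) \<in> L2" by (rule L2_mult_const[OF F(1)])
    note f = l2_inv_fourier_props[OF cF]
    have "l2norm ?f = l2norm (l2_fourier ?f)" by (rule l2norm_l2_fourier[OF f(1), symmetric])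
    also have "\<dots> = l2norm (\<lambda>\<xi>. ?c * F \<xi>)"
      by (intro l2norm_cong_AE L2_measurable l2_fourier_L2 f(1) cF) (use f(2) in \<open>eventually_elim, simp\<close>)
    also have "\<dots> = 1" using F(2) by (subst l2norm_mult_const) (simp add: norm_divide)
    finally have "l2norm (\<lambda>\<xi>. ?m \<xi> * l2_fourier ?f \<xi>) \<le> h" by (intro le f) simp
    also have "l2norm (\<lambda>\<xi>. ?m \<xi> * l2_fourier ?f \<xi>) = l2norm (\<lambda>\<xi>. ?c * (?m \<xi> * F \<xi>))"
    proof (intro l2norm_cong_AE)
      note [measurable] = L2_measurable[OF l2_fourier_L2[OF f(1)]] L2_measurable[OF F(1)]
      show "(\<lambda>\<xi>. ?m \<xi> * l2_fourier ?f \<xi>) \<in> borel_measurable borel" by measurable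
      show "(\<lambda>\<xi>. ?c * (?m \<xi> * F \<xi>)) \<in> borel_measurable borel" by measurable
      show "AE \<xi> in lborel. cmod (?m \<xi> * l2_fourier ?f \<xi>) = cmod (?c * (?m \<xi> * F \<xi>))"
        using f(2) by eventually_elim (simp only: mult_ac)
    qed
    also have "\<dots> = l2norm (\<lambda>\<xi>. ?m \<xi> * F \<xi>) / l2norm F"
      using F(2) by (subst l2norm_mult_const) (simp add: norm_divide)
    finally show ?thesis using F(2) by (simp add: divide_le_eq)
  qed
  have ball: "AE \<xi> in lborel. \<xi> \<in> cball 0 (real n) \<longrightarrow> cmod (?m \<xi>) \<le> h" for n :: nat
  proof -
    \<comment> \<open>Intersecting with a ball makes the exceptional set of finite measure, so that
      its indicator lies in L2; countably many balls exhaust the space.\<close>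
    define S where "S = {\<xi> \<in> cball 0 (real n). h < cmod (?m \<xi>)}"
    have S[measurable]: "S \<in> sets borel" unfolding S_def by measurable
    have fin: "emeasure lborel S < \<infinity>"
      by (rule le_less_trans[OF emeasure_mono emeasure_lborel_cball_finite[of 0 "real n"]]) (auto simp: S_def)
    let ?F = "\<lambda>\<xi>. indicator S \<xi> *\<^sub>R (1 :: complex)"
    have iS: "integrable lborel (indicator S :: real^'n \<Rightarrow> real)"
      using fin by (intro integrable_real_indicator) auto
    have F: "?F \<in> L2" by (rule L2_bounded[where M=1, OF integrable_scaleR_left[OF iS]]) (auto simp: indicator_def)
    show ?thesis
    proof (cases "l2norm ?F = 0")
      case True
      from l2norm_eq_0D[OF F True] show ?thesis
        by eventually_elim (auto simp: S_def indicator_def split: if_splits)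
    next
      case False
      then have pos: "l2norm ?F > 0" using l2norm_nonneg[of ?F] by linarith
      \<comment> \<open>The individual symbols come without a bound, so integrability is obtained
        from \<open>l2_symbol\<close> applied to the preimage of the indicator.\<close>
      have "(\<lambda>\<xi>. ?m \<xi> * ?F \<xi>) \<in> L2"
      proof -
        have "(\<lambda>\<xi>. m\<^sub>i \<xi> * ?F \<xi>) \<in> L2" if "l2_symbol m\<^sub>i" for m\<^sub>i
        proof -
          have "(\<lambda>\<xi>. m\<^sub>i \<xi> * l2_fourier (l2_inv_fourier ?F) \<xi>) \<in> L2"
            using that l2_inv_fourier_L2[OF F] by (auto simp: l2_symbol_def)
          then show ?thesis
            by (rule L2_cong_AE)
               (use l2_fourier_l2_inv_fourier[OF F] L2_measurable[OF F] that in \<open>auto simp: l2_symbol_def\<close>)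
        qed
        from L2_diff[OF this[OF m(1)] this[OF m(2)]] show ?thesis by (simp add: scaleR_diff_right left_diff_distrib)
      qed
      note i1 = L2_integrable[OF this]
      have i2: "integrable lborel (\<lambda>\<xi>. h\<^sup>2 * (cmod (?F \<xi>))\<^sup>2)" using L2_integrable[OF F] by simp
      have "(l2norm (\<lambda>\<xi>. ?m \<xi> * ?F \<xi>))\<^sup>2 \<le> (h * l2norm ?F)\<^sup>2"
        by (intro power_mono scaled F pos) simp
      then have "(LINT \<xi>|lborel. (cmod (?m \<xi> * ?F \<xi>))\<^sup>2 - h\<^sup>2 * (cmod (?F \<xi>))\<^sup>2) \<le> 0"
        using i1 i2 by (simp only: Bochner_Integration.integral_diff l2norm_power2 power_mult_distrib integral_mult_right_zero diff_le_0_iff_le)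
      \<comment> \<open>On \<open>S\<close> the symbol exceeds \<open>h\<close>, and off
        \<open>S\<close> both terms vanish. With integral at most 0 the difference is 0 a.e., which
        is impossible on \<open>S\<close>, where the inequality is strict.\<close>
      moreover have nn: "0 \<le> (cmod (?m \<xi> * ?F \<xi>))\<^sup>2 - h\<^sup>2 * (cmod (?F \<xi>))\<^sup>2" for \<xi>
        using h by (auto simp: indicator_def S_def intro!: power_mono)
      ultimately have "(LINT \<xi>|lborel. (cmod (?m \<xi> * ?F \<xi>))\<^sup>2 - h\<^sup>2 * (cmod (?F \<xi>))\<^sup>2) = 0"
        by (intro antisym integral_nonneg_AE) auto
      then have "AE \<xi> in lborel. (cmod (?m \<xi> * ?F \<xi>))\<^sup>2 - h\<^sup>2 * (cmod (?F \<xi>))\<^sup>2 = 0"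
        using i1 i2 nn by (subst (asm) integral_nonneg_eq_0_iff_AE) auto
      then show ?thesis
      proof eventually_elim
        fix \<xi> assume 0: "(cmod (?m \<xi> * ?F \<xi>))\<^sup>2 - h\<^sup>2 * (cmod (?F \<xi>))\<^sup>2 = 0"
        have "\<xi> \<notin> S"
        proof
          assume "\<xi> \<in> S"
          with 0 have "(cmod (?m \<xi>))\<^sup>2 = h\<^sup>2" by simp
          then have "cmod (?m \<xi>) = h" using h by (simp add: power2_eq_iff_nonneg)
          with \<open>\<xi> \<in> S\<close> show False by (simp add: S_def)
        qed
        then show "\<xi> \<in> cball 0 (real n) \<longrightarrow> cmod (?m \<xi>) \<le> h" by (auto simp: S_def)
      qed
    qed
  qed
  then have "AE \<xi> in lborel. \<forall>n::nat. \<xi> \<in> cball 0 (real n) \<longrightarrow> cmod (?m \<xi>) \<le> h"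
    unfolding AE_all_countable by (rule allI)
  then show "AE \<xi> in lborel. cmod (?m \<xi>) \<le> h"
    by eventually_elim (metis mem_cball_0 real_arch_simple)
qed

subsection \<open>Minimisers on the Fourier side\<close>

text \<open>\<open>V\<close> is the stationary point: it solves cnj a (a V - G) + m^2 V = 0, and
  this equation is what cancels the cross term in the expansion around \<open>V\<close>.\<close>

lemma quadratic_completion:
  fixes a G U :: complex and m :: real
  assumes D: "(cmod a)\<^sup>2 + m\<^sup>2 > 0"
  defines "D \<equiv> (cmod a)\<^sup>2 + m\<^sup>2"
  defines "V \<equiv> cnj a * G / complex_of_real D"
  shows "(cmod (a * U - G))\<^sup>2 + (m * cmod U)\<^sup>2 = D * (cmod (U - V))\<^sup>2 + ((cmod (a * V - G))\<^sup>2 + (m * cmod V)\<^sup>2)"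
proof -
  define W where "W = U - V"
  have add: "(cmod (x + y))\<^sup>2 = (cmod x)\<^sup>2 + (cmod y)\<^sup>2 + 2 * Re (x * cnj y)" for x y
    unfolding cmod_power2 by (simp add: power2_eq_square algebra_simps)
  have "D \<noteq> 0" using D unfolding D_def by linarith
  moreover have Re_mult: "Re (complex_of_real r * z) = r * Re z" for r z by simp
  ultimately have DV: "complex_of_real D * V = cnj a * G" by (simp add: V_def)
  have "complex_of_real D = a * cnj a + complex_of_real (m\<^sup>2)"
    by (simp add: D_def complex_norm_square flip: of_real_power)
  with DV have z: "cnj a * (a * V - G) + complex_of_real (m\<^sup>2) * V = 0"
    by (simp add: algebra_simps)
  have "a * W * cnj (a * V - G) + complex_of_real (m\<^sup>2) * (W * cnj V) =
      W * cnj (cnj a * (a * V - G) + complex_of_real (m\<^sup>2) * V)"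
    by (simp add: algebra_simps)
  also have "\<dots> = 0" unfolding z by simp
  finally have "Re (a * W * cnj (a * V - G) + complex_of_real (m\<^sup>2) * (W * cnj V)) = 0" by simp
  then have cross: "Re (a * W * cnj (a * V - G)) + m\<^sup>2 * Re (W * cnj V) = 0"
    by (simp only: plus_complex.sel Re_mult)
  have 1: "(cmod (a * U - G))\<^sup>2 = (cmod a)\<^sup>2 * (cmod W)\<^sup>2 + (cmod (a * V - G))\<^sup>2 + 2 * Re (a * W * cnj (a * V - G))"
  proof -
    have "a * U - G = a * W + (a * V - G)" by (simp add: W_def algebra_simps)
    then show ?thesis using add[of "a * W" "a * V - G"] by (simp only: norm_mult power_mult_distrib)
  qed
  have 2: "(m * cmod U)\<^sup>2 = m\<^sup>2 * (cmod W)\<^sup>2 + (m * cmod V)\<^sup>2 + 2 * (m\<^sup>2 * Re (W * cnj V))"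
  proof -
    have "U = W + V" by (simp add: W_def)
    then have "(cmod U)\<^sup>2 = (cmod W)\<^sup>2 + (cmod V)\<^sup>2 + 2 * Re (W * cnj V)" using add[of W V] by (simp only:)
    then show ?thesis by (simp only: power_mult_distrib distrib_left mult_ac)
  qed
  show ?thesis unfolding 1 2 W_def[symmetric] using cross by (simp add: D_def algebra_simps)
qed

lemma objective_fourier:
  fixes \<phi> :: "real^'n \<Rightarrow> real"
  assumes \<phi>: "integrable lborel \<phi>" and \<beta>: "\<beta> > 0" and a: "l2_symbol a"
    and g: "g \<in> L2" and u: "u \<in> L2"
  defines "m \<equiv> \<lambda>\<xi>. cmod (1 - fourier (\<lambda>x. complex_of_real (\<phi> x)) (\<beta> *\<^sub>R \<xi>))"
  shows "integrable lborel (\<lambda>\<xi>. (cmod (a \<xi> * l2_fourier u \<xi> - l2_fourier g \<xi>))\<^sup>2 + (m \<xi> * cmod (l2_fourier u \<xi>))\<^sup>2)"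
    and "objective (fourier_multiplier a) \<phi> \<beta> g u =
      (LINT \<xi>|lborel. (cmod (a \<xi> * l2_fourier u \<xi> - l2_fourier g \<xi>))\<^sup>2 + (m \<xi> * cmod (l2_fourier u \<xi>))\<^sup>2)"
proof -
  let ?M = "\<lambda>\<xi>. 1 - fourier (\<lambda>x. complex_of_real (\<phi> x)) (\<beta> *\<^sub>R \<xi>)"
  have [measurable]: "\<phi> \<in> borel_measurable borel" using \<phi> by auto
  have Mm: "?M \<in> borel_measurable borel" by measurable
  have "cmod (?M \<xi>) \<le> 1 + (LINT x|lborel. cmod (complex_of_real (\<phi> x)))" for \<xi>
    using norm_triangle_ineq4[of 1 "fourier (\<lambda>x. complex_of_real (\<phi> x)) (\<beta> *\<^sub>R \<xi>)"]
      norm_fourier_le[of "\<lambda>x. complex_of_real (\<phi> x)" "\<beta> *\<^sub>R \<xi>"] by simp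
  then have Mu: "(\<lambda>\<xi>. ?M \<xi> * l2_fourier u \<xi>) \<in> L2"
    by (intro L2_mult_bounded(1)[OF l2_fourier_L2[OF u] Mm]) (auto intro: always_eventually)
  have au: "(\<lambda>\<xi>. a \<xi> * l2_fourier u \<xi>) \<in> L2" using a u by (simp add: l2_symbol_def)
  note mol = mollify_L2[OF \<beta> \<phi> u]
  have d1: "(\<lambda>\<xi>. a \<xi> * l2_fourier u \<xi> - l2_fourier g \<xi>) \<in> L2" by (intro L2_diff au l2_fourier_L2 g)
  have n1: "l2norm (\<lambda>x. fourier_multiplier a u x - g x) = l2norm (\<lambda>\<xi>. a \<xi> * l2_fourier u \<xi> - l2_fourier g \<xi>)"
    unfolding l2norm_l2_fourier_diff[OF fourier_multiplier_L2[OF a u] g, symmetric]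
    by (intro l2norm_cong_AE L2_measurable[OF d1] L2_measurable[OF L2_diff] l2_fourier_L2 fourier_multiplier_L2 a u g)
       (use l2_fourier_fourier_multiplier[OF a u] in \<open>eventually_elim, simp\<close>)
  have n2: "l2norm (\<lambda>x. u x - mollify \<phi> \<beta> u x) = l2norm (\<lambda>\<xi>. ?M \<xi> * l2_fourier u \<xi>)"
    unfolding l2norm_l2_fourier_diff[OF u mol(1), symmetric]
    by (intro l2norm_cong_AE L2_measurable[OF Mu] L2_measurable[OF L2_diff] l2_fourier_L2 u mol(1))
       (use mol(2) in \<open>eventually_elim, simp add: left_diff_distrib\<close>)
  have eq: "(cmod (?M \<xi> * l2_fourier u \<xi>))\<^sup>2 = (m \<xi> * cmod (l2_fourier u \<xi>))\<^sup>2" for \<xi>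
    by (simp add: m_def norm_mult)
  note ints = L2_integrable[OF d1] L2_integrable[OF Mu, unfolded eq]
  show "integrable lborel (\<lambda>\<xi>. (cmod (a \<xi> * l2_fourier u \<xi> - l2_fourier g \<xi>))\<^sup>2 + (m \<xi> * cmod (l2_fourier u \<xi>))\<^sup>2)"
    by (intro Bochner_Integration.integrable_add ints)
  show "objective (fourier_multiplier a) \<phi> \<beta> g u =
      (LINT \<xi>|lborel. (cmod (a \<xi> * l2_fourier u \<xi> - l2_fourier g \<xi>))\<^sup>2 + (m \<xi> * cmod (l2_fourier u \<xi>))\<^sup>2)"
    unfolding objective_def n1 n2 l2norm_power2 eq
    by (rule Bochner_Integration.integral_add[OF ints, symmetric])
qed

text \<open>The bound on |a| / D puts the pointwise minimiser into L2, giving existence; positivity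
  of D then makes it the only minimiser up to null sets.\<close>

lemma objective_arg_min:
  fixes \<phi> :: "real^'n \<Rightarrow> real"
  assumes \<phi>: "integrable lborel \<phi>" and \<beta>: "\<beta> > 0" and a: "l2_symbol a" and g: "g \<in> L2"
  defines "m \<equiv> \<lambda>\<xi>. cmod (1 - fourier (\<lambda>x. complex_of_real (\<phi> x)) (\<beta> *\<^sub>R \<xi>))"
  defines "D \<equiv> \<lambda>\<xi>. (cmod (a \<xi>))\<^sup>2 + (m \<xi>)\<^sup>2"
  assumes D: "AE \<xi> in lborel. D \<xi> > 0" and B: "AE \<xi> in lborel. cmod (a \<xi>) / D \<xi> \<le> B"
  shows "\<exists>u. is_arg_min (objective (fourier_multiplier a) \<phi> \<beta> g) (\<lambda>u. u \<in> L2) u"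
    and "\<And>u. is_arg_min (objective (fourier_multiplier a) \<phi> \<beta> g) (\<lambda>u. u \<in> L2) u \<Longrightarrow>
      u \<in> L2 \<and> (AE \<xi> in lborel. l2_fourier u \<xi> = cnj (a \<xi>) * l2_fourier g \<xi> / complex_of_real (D \<xi>))"
proof -
  let ?V = "\<lambda>\<xi>. cnj (a \<xi>) * l2_fourier g \<xi> / complex_of_real (D \<xi>)"
  let ?J = "objective (fourier_multiplier a) \<phi> \<beta> g"
  let ?I = "\<lambda>U \<xi>. (cmod (a \<xi> * U \<xi> - l2_fourier g \<xi>))\<^sup>2 + (m \<xi> * cmod (U \<xi>))\<^sup>2"
  have [measurable]: "\<phi> \<in> borel_measurable borel" using \<phi> by auto
  have [measurable]: "a \<in> borel_measurable borel" using a by (simp add: l2_symbol_def)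
  have [measurable]: "m \<in> borel_measurable borel" unfolding m_def by measurable
  have [measurable]: "D \<in> borel_measurable borel" unfolding D_def by measurable
  have "(\<lambda>\<xi>. cnj (a \<xi>) / complex_of_real (D \<xi>) * l2_fourier g \<xi>) \<in> L2"
  proof (rule L2_mult_bounded(1)[OF l2_fourier_L2[OF g]])
    show "AE \<xi> in lborel. cmod (cnj (a \<xi>) / complex_of_real (D \<xi>)) \<le> B"
      using B D by eventually_elim (simp add: norm_divide)
  qed measurable
  then have V: "?V \<in> L2" by simp
  define v where "v = l2_inv_fourier ?V"
  have v: "v \<in> L2" "AE \<xi> in lborel. l2_fourier v \<xi> = ?V \<xi>"
    unfolding v_def by (rule l2_inv_fourier_props[OF V])+
  have J: "integrable lborel (?I (l2_fourier u))" "?J u = (LINT \<xi>|lborel. ?I (l2_fourier u) \<xi>)" if "u \<in> L2" for u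
    unfolding m_def by (rule objective_fourier[OF \<phi> \<beta> a g that])+
  \<comment> \<open>The excess of the objective is integrated as a difference of two integrable
    functions. It equals a nonnegative square with weight \<open>D\<close> a.e., so zero excess
    forces the two transforms to coincide.\<close>
  have gap: "integrable lborel (\<lambda>\<xi>. ?I (l2_fourier u) \<xi> - ?I (l2_fourier v) \<xi>)"
      "?J u - ?J v = (LINT \<xi>|lborel. ?I (l2_fourier u) \<xi> - ?I (l2_fourier v) \<xi>)"
      "AE \<xi> in lborel. ?I (l2_fourier u) \<xi> - ?I (l2_fourier v) \<xi> = D \<xi> * (cmod (l2_fourier u \<xi> - ?V \<xi>))\<^sup>2"
    if u: "u \<in> L2" for u
  proof -
    show "integrable lborel (\<lambda>\<xi>. ?I (l2_fourier u) \<xi> - ?I (l2_fourier v) \<xi>)"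
      by (intro Bochner_Integration.integrable_diff J(1) u v)
    show "?J u - ?J v = (LINT \<xi>|lborel. ?I (l2_fourier u) \<xi> - ?I (l2_fourier v) \<xi>)"
      unfolding J(2)[OF u] J(2)[OF v(1)] by (intro Bochner_Integration.integral_diff[symmetric] J(1) u v)
    show "AE \<xi> in lborel. ?I (l2_fourier u) \<xi> - ?I (l2_fourier v) \<xi> = D \<xi> * (cmod (l2_fourier u \<xi> - ?V \<xi>))\<^sup>2"
      using D v(2)
    proof eventually_elim
      fix \<xi> assume D0: "0 < D \<xi>" and eq: "l2_fourier v \<xi> = ?V \<xi>"
      show "?I (l2_fourier u) \<xi> - ?I (l2_fourier v) \<xi> = D \<xi> * (cmod (l2_fourier u \<xi> - ?V \<xi>))\<^sup>2"
        unfolding eq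
        using quadratic_completion[of "a \<xi>" "m \<xi>" "l2_fourier u \<xi>" "l2_fourier g \<xi>"] D0 by (simp add: D_def)
    qed
  qed
  have nonneg: "AE \<xi> in lborel. 0 \<le> ?I (l2_fourier u) \<xi> - ?I (l2_fourier v) \<xi>" if u: "u \<in> L2" for u
    using gap(3)[OF u] D by eventually_elim simp
  have "?J v \<le> ?J u" if u: "u \<in> L2" for u
    using integral_nonneg_AE[OF nonneg[OF u]] gap(2)[OF u] by linarith
  then have "is_arg_min ?J (\<lambda>u. u \<in> L2) v" using v(1) by (auto simp: is_arg_min_def not_less)
  then show "\<exists>u. is_arg_min ?J (\<lambda>u. u \<in> L2) u" by blast
  fix u assume min: "is_arg_min ?J (\<lambda>u. u \<in> L2) u"
  then have u: "u \<in> L2" and "?J u \<le> ?J v" using v(1) by (auto simp: is_arg_min_def not_less)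
  then have "(LINT \<xi>|lborel. ?I (l2_fourier u) \<xi> - ?I (l2_fourier v) \<xi>) = 0"
    using integral_nonneg_AE[OF nonneg[OF u]] gap(2)[OF u] by linarith
  then have "AE \<xi> in lborel. ?I (l2_fourier u) \<xi> - ?I (l2_fourier v) \<xi> = 0"
    using integral_nonneg_eq_0_iff_AE[OF gap(1)[OF u] nonneg[OF u]] by simp
  then have "AE \<xi> in lborel. l2_fourier u \<xi> = ?V \<xi>"
    using gap(3)[OF u] D by eventually_elim simp
  with u show "u \<in> L2 \<and> (AE \<xi> in lborel. l2_fourier u \<xi> = ?V \<xi>)" by blast
qed

subsection \<open>Estimates of the symbols\<close>

text \<open>The asymptotic relation covers only a ball of radius d. The minimum with
  \<open>r\<close> records that the lower bound stops growing there, whereas the upper bound extends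
  with a larger constant.\<close>

lemma mollifier_symbol_bounds:
  fixes \<Phi> :: "real^'n \<Rightarrow> complex"
  assumes lt: "\<forall>\<xi>. \<xi> \<noteq> 0 \<longrightarrow> cmod (\<Phi> \<xi>) < 1"
    and real: "\<forall>\<xi>. \<Phi> \<xi> \<in> \<real>"
    and anti: "\<forall>\<xi>. antimono_on {0..} (\<lambda>t. Re (\<Phi> (t *\<^sub>R \<xi>)))"
    and s: "s > 0"
    and theta: "(\<lambda>\<xi>. cmod (1 - \<Phi> \<xi>)) \<in> \<Theta>[at 0](\<lambda>\<xi>. norm \<xi> powr s)"
  obtains c\<^sub>1 c\<^sub>2 r where "c\<^sub>1 > 0" "c\<^sub>2 > 0" "r > 0"
    "\<And>\<xi>. \<xi> \<noteq> 0 \<Longrightarrow> c\<^sub>1 * min (norm \<xi>) r powr s \<le> cmod (1 - \<Phi> \<xi>)"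
    "\<And>\<xi>. \<xi> \<noteq> 0 \<Longrightarrow> cmod (1 - \<Phi> \<xi>) \<le> c\<^sub>2 * norm \<xi> powr s"
proof -
  from theta have "(\<lambda>\<xi>. cmod (1 - \<Phi> \<xi>)) \<in> O[at 0](\<lambda>\<xi>. norm \<xi> powr s)" by (rule bigthetaD1)
  then obtain c2 where c2: "c2 > 0" "\<forall>\<^sub>F \<xi> in at 0. norm (cmod (1 - \<Phi> \<xi>)) \<le> c2 * norm (norm \<xi> powr s)"
    by (elim landau_o.bigE)
  from theta have "(\<lambda>\<xi>. cmod (1 - \<Phi> \<xi>)) \<in> \<Omega>[at 0](\<lambda>\<xi>. norm \<xi> powr s)" by (rule bigthetaD2)
  then obtain c1 where c1: "c1 > 0" "\<forall>\<^sub>F \<xi> in at 0. norm (cmod (1 - \<Phi> \<xi>)) \<ge> c1 * norm (norm \<xi> powr s)"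
    by (elim landau_omega.bigE)
  from eventually_conj[OF c1(2) c2(2)] obtain d where d: "d > 0"
    "\<And>\<xi>. \<xi> \<noteq> 0 \<Longrightarrow> norm \<xi> < d \<Longrightarrow> c1 * norm \<xi> powr s \<le> cmod (1 - \<Phi> \<xi>) \<and> cmod (1 - \<Phi> \<xi>) \<le> c2 * norm \<xi> powr s"
    unfolding eventually_at by auto
  define r where "r = d / 2"
  have r: "r > 0" "r < d" using d(1) by (auto simp: r_def)
  show ?thesis
  proof
    show "c1 > 0" "c2 + 2 / d powr s > 0" "r > 0" using c1(1) c2(1) d(1) r by (auto intro: add_pos_nonneg)
    fix \<xi> :: "real^'n" assume \<xi>: "\<xi> \<noteq> 0"
    show "cmod (1 - \<Phi> \<xi>) \<le> (c2 + 2 / d powr s) * norm \<xi> powr s"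
    proof (cases "norm \<xi> < d")
      case True
      then have "cmod (1 - \<Phi> \<xi>) \<le> c2 * norm \<xi> powr s" using d(2)[OF \<xi>] by blast
      also have "\<dots> \<le> (c2 + 2 / d powr s) * norm \<xi> powr s" by (intro mult_right_mono) auto
      finally show ?thesis .
    next
      case False
      \<comment> \<open>Far from the origin the trivial bound 2 is absorbed by |xi|^s >= d^s; this
        is the summand 2 / d^s of the constant.\<close>
      have "cmod (1 - \<Phi> \<xi>) \<le> 2" using norm_triangle_ineq4[of 1 "\<Phi> \<xi>"] lt \<xi> by fastforce
      also have "\<dots> = 2 / d powr s * d powr s" using d(1) by simp
      also have "\<dots> \<le> 2 / d powr s * norm \<xi> powr s"
        using False d(1) s by (intro mult_left_mono powr_mono2) auto
      also have "\<dots> \<le> (c2 + 2 / d powr s) * norm \<xi> powr s"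
        using c2(1) by (intro mult_right_mono) auto
      finally show ?thesis .
    qed
    show "c1 * min (norm \<xi>) r powr s \<le> cmod (1 - \<Phi> \<xi>)"
    proof (cases "norm \<xi> \<le> r")
      case True
      then show ?thesis using d(2)[OF \<xi>] r by (simp add: min_def)
    next
      case False
      \<comment> \<open>The point of the sphere of radius \<open>r\<close> on the ray through \<xi>.
        The transform is real and decreases along the ray, so 1 - \<Phi> is at least as large at
        \<xi> as at this point.\<close>
      define \<zeta> where "\<zeta> = (r / norm \<xi>) *\<^sub>R \<xi>"
      have n\<zeta>: "norm \<zeta> = r" and \<zeta>: "\<zeta> \<noteq> 0" using \<xi> r(1) by (auto simp: \<zeta>_def)
      have "Re (\<Phi> (1 *\<^sub>R \<xi>)) \<le> Re (\<Phi> ((r / norm \<xi>) *\<^sub>R \<xi>))"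
        by (rule monotone_onD[OF anti[rule_format, of \<xi>]]) (use False r(1) in \<open>auto simp: divide_le_eq_1\<close>)
      then have le: "Re (\<Phi> \<xi>) \<le> Re (\<Phi> \<zeta>)" by (simp add: \<zeta>_def)
      have "c1 * min (norm \<xi>) r powr s = c1 * norm \<zeta> powr s" using False by (simp add: n\<zeta> min_def)
      also have "\<dots> \<le> cmod (1 - \<Phi> \<zeta>)" using d(2)[OF \<zeta>] n\<zeta> r by simp
      also have "\<dots> = \<bar>1 - Re (\<Phi> \<zeta>)\<bar>"
      proof -
        obtain t where t: "\<Phi> \<zeta> = complex_of_real t" using real[rule_format, of \<zeta>] by (rule Reals_cases)
        then have "1 - \<Phi> \<zeta> = complex_of_real (1 - t)" by simp
        then show ?thesis unfolding t by (simp only: norm_of_real Re_complex_of_real)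
      qed
      also have "\<dots> = 1 - Re (\<Phi> \<zeta>)" using lt[rule_format, OF \<zeta>] complex_Re_le_cmod[of "\<Phi> \<zeta>"] by simp
      also have "\<dots> \<le> Re (1 - \<Phi> \<xi>)" using le by simp
      also have "\<dots> \<le> cmod (1 - \<Phi> \<xi>)" by (rule complex_Re_le_cmod)
      finally show ?thesis .
    qed
  qed
qed

text \<open>Collects the smallness conditions. With \<open>p\<^sub>1\<close> = exp(-\<kappa>) the
  second keeps psi_h away from 0 on the unit ball; the third keeps beta within the radius
  \<open>r\<close>; the fourth lets psi_h inherit half of eps^(1/4); the last two say that the
  remaining powers of eps beat powers of the logarithm.\<close>

lemma small_parameter:
  fixes c\<^sub>2 \<kappa> p\<^sub>1 q r s \<tau> :: real
  assumes "\<kappa> > 0" "p\<^sub>1 > 0" "q > 0" "r > 0" "s > 0" "\<tau> > 0"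
  obtains \<eta> :: real where "\<eta> > 0"
    "\<And>\<epsilon>. 0 < \<epsilon> \<Longrightarrow> \<epsilon> < \<eta> \<Longrightarrow> \<epsilon> < 1 \<and> \<epsilon> \<le> p\<^sub>1 / 2 \<and> \<epsilon> powr (1 / (2 * s)) \<le> r \<and> \<epsilon> \<le> \<epsilon> powr (1/4) / 2 \<and>
      4 * c\<^sub>2\<^sup>2 * \<epsilon> powr (1/2) * (- ln \<epsilon> / (4 * \<kappa>)) powr (s / \<tau>) \<le> (- ln \<epsilon>) powr (- q) \<and>
      \<epsilon> powr (1/2) \<le> (- ln \<epsilon>) powr (- q)"
proof -
  define \<sigma> where "\<sigma> = 1 / (2 * s)"
  define \<theta> where "\<theta> = s / \<tau>"
  define c where "c = 4 * c\<^sub>2\<^sup>2 * (1 / (4 * \<kappa>)) powr \<theta>"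
  have pos: "\<sigma> > 0" "\<theta> > 0" using assms by (auto simp: \<sigma>_def \<theta>_def)
  have 1: "\<forall>\<^sub>F \<epsilon>::real in at_right 0. \<epsilon> < 1" by real_asymp
  have "((\<lambda>\<epsilon>::real. \<epsilon>) \<longlongrightarrow> 0) (at_right 0)" by real_asymp
  then have 2: "\<forall>\<^sub>F \<epsilon> in at_right 0. \<epsilon> < p\<^sub>1 / 2" using assms by (intro order_tendstoD) auto
  have "((\<lambda>\<epsilon>. \<epsilon> powr \<sigma>) \<longlongrightarrow> 0) (at_right 0)" using pos by real_asymp
  then have 3: "\<forall>\<^sub>F \<epsilon> in at_right 0. \<epsilon> powr \<sigma> < r" using assms by (intro order_tendstoD) auto
  have 4: "\<forall>\<^sub>F \<epsilon>::real in at_right 0. \<epsilon> \<le> \<epsilon> powr (1/4) / 2" by real_asymp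
  have "((\<lambda>\<epsilon>. \<epsilon> powr (1/2) * (- ln \<epsilon>) powr \<theta> * (- ln \<epsilon>) powr q) \<longlongrightarrow> 0) (at_right 0)"
    using pos assms by real_asymp
  then have "((\<lambda>\<epsilon>. c * (\<epsilon> powr (1/2) * (- ln \<epsilon>) powr \<theta> * (- ln \<epsilon>) powr q)) \<longlongrightarrow> c * 0) (at_right 0)"
    by (intro tendsto_intros)
  then have 5: "\<forall>\<^sub>F \<epsilon> in at_right 0. c * (\<epsilon> powr (1/2) * (- ln \<epsilon>) powr \<theta> * (- ln \<epsilon>) powr q) < 1"
    by (intro order_tendstoD) auto
  have "((\<lambda>\<epsilon>. \<epsilon> powr (1/2) * (- ln \<epsilon>) powr q) \<longlongrightarrow> 0) (at_right 0)"
    using assms by real_asymp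
  then have 6: "\<forall>\<^sub>F \<epsilon> in at_right 0. \<epsilon> powr (1/2) * (- ln \<epsilon>) powr q < 1"
    by (intro order_tendstoD) auto
  have pos0: "\<forall>\<^sub>F \<epsilon>::real in at_right 0. \<epsilon> > 0" by (simp add: eventually_at_right_less)
  have "\<forall>\<^sub>F \<epsilon> in at_right 0. \<epsilon> < 1 \<and> \<epsilon> \<le> p\<^sub>1 / 2 \<and> \<epsilon> powr \<sigma> \<le> r \<and> \<epsilon> \<le> \<epsilon> powr (1/4) / 2 \<and>
      4 * c\<^sub>2\<^sup>2 * \<epsilon> powr (1/2) * (- ln \<epsilon> / (4 * \<kappa>)) powr \<theta> \<le> (- ln \<epsilon>) powr (- q) \<and>
      \<epsilon> powr (1/2) \<le> (- ln \<epsilon>) powr (- q)"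
    using 1 2 3 4 5 6 pos0
  proof eventually_elim
    case (elim \<epsilon>)
    have L: "- ln \<epsilon> > 0" using elim by simp
    have Lq: "(- ln \<epsilon>) powr q > 0" using L by simp
    have "(l / (4 * \<kappa>)) powr \<theta> = l powr \<theta> * (1 / (4 * \<kappa>)) powr \<theta>" if "l > 0" for l
      using that assms(1) by (simp add: powr_divide)
    from this[OF L]
    have "4 * c\<^sub>2\<^sup>2 * \<epsilon> powr (1/2) * (- ln \<epsilon> / (4 * \<kappa>)) powr \<theta> = c * (\<epsilon> powr (1/2) * (- ln \<epsilon>) powr \<theta>)"
      by (simp only: c_def mult_ac)
    moreover have "c * (\<epsilon> powr (1/2) * (- ln \<epsilon>) powr \<theta>) \<le> (- ln \<epsilon>) powr (- q)"
      using elim(5) Lq by (simp add: powr_minus_divide pos_le_divide_eq mult.assoc)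
    moreover have "\<epsilon> powr (1/2) \<le> (- ln \<epsilon>) powr (- q)"
      using elim(6) Lq by (simp add: powr_minus_divide pos_le_divide_eq)
    ultimately show ?case by (intro conjI) (use elim in linarith)+
  qed
  then obtain \<eta> where "\<eta> > 0" "\<And>\<epsilon>. 0 < \<epsilon> \<Longrightarrow> \<epsilon> < \<eta> \<Longrightarrow> \<epsilon> < 1 \<and> \<epsilon> \<le> p\<^sub>1 / 2 \<and> \<epsilon> powr \<sigma> \<le> r \<and> \<epsilon> \<le> \<epsilon> powr (1/4) / 2 \<and>
      4 * c\<^sub>2\<^sup>2 * \<epsilon> powr (1/2) * (- ln \<epsilon> / (4 * \<kappa>)) powr \<theta> \<le> (- ln \<epsilon>) powr (- q) \<and>
      \<epsilon> powr (1/2) \<le> (- ln \<epsilon>) powr (- q)"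
    unfolding eventually_at_right_field by blast
  then show ?thesis using that unfolding \<sigma>_def \<theta>_def by blast
qed

text \<open>The pointwise core, with x = |xi|. The exponent 1/4 of the cut is one choice below 1/2:
  cutting at psi = eps^t leaves eps^(1 - 2t) up to logarithms in the first error factor, so t < 1/2
  gives a positive power.\<close>

lemma regularised_symbol_bounds:
  fixes a :: complex and m :: real
  assumes \<epsilon>: "0 < \<epsilon>" "\<epsilon> < 1" "\<epsilon> \<le> exp (- \<kappa>) / 2" "\<epsilon> powr (1 / (2 * s)) \<le> r" "\<epsilon> \<le> \<epsilon> powr (1/4) / 2"
      "4 * c\<^sub>2\<^sup>2 * \<epsilon> powr (1/2) * (- ln \<epsilon> / (4 * \<kappa>)) powr (s / \<tau>) \<le> (- ln \<epsilon>) powr (- q)"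
    and pos: "\<kappa> > 0" "s > 0" "\<tau> > 0" "q > 0" "c\<^sub>1 > 0" "c\<^sub>2 > 0" "x > 0" "r > 0"
    and a: "cmod (complex_of_real (exp (- (\<kappa> * x powr (2 * \<tau>)))) - a) \<le> \<epsilon>"
    and m: "c\<^sub>1 * min (\<epsilon> powr (1 / (2 * s)) * x) r powr s \<le> m" "m \<le> c\<^sub>2 * (\<epsilon> powr (1 / (2 * s)) * x) powr s"
  shows "(cmod a)\<^sup>2 + m\<^sup>2 > 0"
    and "cmod a / ((cmod a)\<^sup>2 + m\<^sup>2) \<le> (1 / (2 * c\<^sub>1) + 2 * exp \<kappa>) * \<epsilon> powr (- 1/2)"
    and "m\<^sup>2 / ((cmod a)\<^sup>2 + m\<^sup>2) * (1 + 2 * (\<kappa> * x powr (2 * \<tau>))) powr (- q) \<le> (2 powr q + 1) * (- ln \<epsilon>) powr (- q)"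
proof -
  let ?D = "(cmod a)\<^sup>2 + m\<^sup>2" and ?\<beta> = "\<epsilon> powr (1 / (2 * s))" and ?\<sigma> = "\<kappa> * x powr (2 * \<tau>)"
  have \<beta>: "?\<beta> > 0" using \<epsilon> by simp
  have \<beta>s: "?\<beta> powr s = \<epsilon> powr (1/2)" using pos by (simp add: powr_powr)
  have "0 < c\<^sub>1 * min (?\<beta> * x) r powr s" using pos \<beta> by (simp add: min_def)
  with m(1) have mpos: "m > 0" by linarith
  then show D: "?D > 0" by (simp add: add_nonneg_pos)
  have a_ge: "exp (- ?\<sigma>) - \<epsilon> \<le> cmod a"
    using norm_triangle_ineq2[of "complex_of_real (exp (- ?\<sigma>))" a] a by simp
  have \<epsilon>_half: "1 \<le> \<epsilon> powr (- 1/2)"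
  proof -
    have "\<epsilon> powr (1/2) \<le> 1" using \<epsilon> by (simp add: powr_le1)
    then show ?thesis using \<epsilon> by (simp add: powr_minus_divide pos_le_divide_eq)
  qed
  show "cmod a / ?D \<le> (1 / (2 * c\<^sub>1) + 2 * exp \<kappa>) * \<epsilon> powr (- 1/2)"
  proof (cases "x \<ge> 1")
    case True
    have "?\<beta> \<le> min (?\<beta> * x) r" using True \<beta> \<epsilon>(4) by simp
    then have "?\<beta> powr s \<le> min (?\<beta> * x) r powr s" using pos \<beta> by (intro powr_mono2) auto
    then have "c\<^sub>1 * \<epsilon> powr (1/2) \<le> m" using m(1) pos(5) \<beta>s by (metis mult_left_mono order_trans less_imp_le)
    moreover have ce: "c\<^sub>1 * \<epsilon> powr (1/2) > 0" using pos \<epsilon> by simp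
    \<comment> \<open>The arithmetic-geometric inequality 2 m |a| <= |a|^2 + m^2 replaces the
      quotient by 1 / (2 m); this is the origin of the 2 in 1 / (2
      \<open>c\<^sub>1\<close>).\<close>
    ultimately have "2 * (c\<^sub>1 * \<epsilon> powr (1/2)) * cmod a \<le> 2 * m * cmod a" by (intro mult_right_mono) auto
    also have "\<dots> \<le> ?D" using sum_squares_bound[of "cmod a" m] by (simp add: mult_ac)
    finally have "cmod a / ?D \<le> 1 / (2 * (c\<^sub>1 * \<epsilon> powr (1/2)))"
      using D ce by (simp add: divide_le_eq pos_le_divide_eq mult_ac)
    also have "\<dots> = 1 / (2 * c\<^sub>1) * \<epsilon> powr (- 1/2)" using \<epsilon> by (simp add: powr_minus_divide)
    also have "\<dots> \<le> (1 / (2 * c\<^sub>1) + 2 * exp \<kappa>) * \<epsilon> powr (- 1/2)" by (intro mult_right_mono) auto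
    finally show ?thesis .
  next
    case False
    then have "x powr (2 * \<tau>) \<le> 1" using pos by (intro powr_le1) auto
    then have "?\<sigma> \<le> \<kappa>" using pos by simp
    then have "exp (- \<kappa>) \<le> exp (- ?\<sigma>)" by simp
    then have ap: "exp (- \<kappa>) / 2 \<le> cmod a" using a_ge \<epsilon>(3) by linarith
    have apos: "cmod a > 0" using ap exp_gt_zero[of "- \<kappa>"] by linarith
    \<comment> \<open>For low frequencies \<open>m\<close> is simply dropped, since |a| itself is
      bounded below by exp(-\<kappa>) / 2.\<close>
    have "cmod a / ?D \<le> cmod a / (cmod a)\<^sup>2" using apos by (intro divide_left_mono) (auto simp: add_pos_nonneg)
    also have "\<dots> = 1 / cmod a" using apos by (simp add: power2_eq_square)
    also have "\<dots> \<le> 1 / (exp (- \<kappa>) / 2)" using ap apos by (intro divide_left_mono) auto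
    also have "\<dots> = 2 * exp \<kappa> * 1" by (simp add: exp_minus field_simps)
    also have "\<dots> \<le> (1 / (2 * c\<^sub>1) + 2 * exp \<kappa>) * \<epsilon> powr (- 1/2)"
      using pos \<epsilon>_half by (intro mult_mono) auto
    finally show ?thesis .
  qed
  have L: "- ln \<epsilon> > 0" using \<epsilon> by simp
  have \<sigma>: "?\<sigma> > 0" using pos by simp
  have le1: "m\<^sup>2 / ?D \<le> 1" using D by simp
  have q1: "(1 + 2 * ?\<sigma>) powr (- q) \<le> 1"
  proof -
    have "1 powr q \<le> (1 + 2 * ?\<sigma>) powr q" using \<sigma> pos by (intro powr_mono2) auto
    then show ?thesis by (simp add: powr_minus_divide divide_le_eq_1)
  qed
  show "m\<^sup>2 / ?D * (1 + 2 * ?\<sigma>) powr (- q) \<le> (2 powr q + 1) * (- ln \<epsilon>) powr (- q)"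
  proof (cases "?\<sigma> \<ge> - ln \<epsilon> / 4")
    case True
    \<comment> \<open>Above the cut 1 + 2 \<sigma> is at least half of -ln eps, and the quotient is
      at most 1; the source weight alone gives the rate.\<close>
    have "m\<^sup>2 / ?D * (1 + 2 * ?\<sigma>) powr (- q) \<le> 1 * (- ln \<epsilon> / 2) powr (- q)"
      using True L pos by (intro mult_mono le1 powr_mono2') auto
    also have "\<dots> = 2 powr q * (- ln \<epsilon>) powr (- q)"
    proof -
      have "(l / 2) powr (- q) = 2 powr q * l powr (- q)" if "l > 0" for l :: real
        using that by (simp add: powr_divide powr_minus field_simps)
      from this[OF L] show ?thesis by (simp only: mult_1)
    qed
    also have "\<dots> \<le> (2 powr q + 1) * (- ln \<epsilon>) powr (- q)" by (intro mult_right_mono) auto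
    finally show ?thesis .
  next
    case False
    \<comment> \<open>Below the cut exp(-\<sigma>) is at least eps^(1/4), of which the perturbation
      of size eps removes at most half.\<close>
    have "\<epsilon> powr (1/4) = exp (ln \<epsilon> / 4)" using \<epsilon> by (simp add: powr_def)
    also have "\<dots> \<le> exp (- ?\<sigma>)" using False by simp
    finally have ae: "\<epsilon> powr (1/4) / 2 \<le> cmod a" using a_ge \<epsilon>(5) by linarith
    have "(\<epsilon> powr (1/4) / 2)\<^sup>2 \<le> (cmod a)\<^sup>2" using ae by (intro power_mono) auto
    moreover have "(\<epsilon> powr (1/4) / 2)\<^sup>2 = \<epsilon> powr (1/2) / 4"
      using \<epsilon> by (simp add: power_divide power2_eq_square powr_add[symmetric])
    ultimately have Dge: "\<epsilon> powr (1/2) / 4 \<le> ?D" using zero_le_power2[of m] by linarith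
    \<comment> \<open>Raising the bound on x^(2 \<tau>) to the power s / \<tau> turns it into one on
      x^(2 s), the growth of m^2.\<close>
    have "x powr (2 * \<tau>) \<le> - ln \<epsilon> / (4 * \<kappa>)" using False pos by (simp add: field_simps)
    then have "(x powr (2 * \<tau>)) powr (s / \<tau>) \<le> (- ln \<epsilon> / (4 * \<kappa>)) powr (s / \<tau>)"
      using pos by (intro powr_mono2) auto
    then have xs: "(x powr s)\<^sup>2 \<le> (- ln \<epsilon> / (4 * \<kappa>)) powr (s / \<tau>)"
      using pos by (simp add: powr_powr power2_eq_square powr_add[symmetric])
    have "m\<^sup>2 \<le> (c\<^sub>2 * (?\<beta> * x) powr s)\<^sup>2" using m(2) mpos by (intro power_mono) auto
    also have "\<dots> = c\<^sub>2\<^sup>2 * \<epsilon> * (x powr s)\<^sup>2"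
      using \<epsilon> pos \<beta>s by (simp add: powr_mult power_mult_distrib) (simp add: power2_eq_square powr_add[symmetric])
    also have "\<dots> \<le> c\<^sub>2\<^sup>2 * \<epsilon> * (- ln \<epsilon> / (4 * \<kappa>)) powr (s / \<tau>)"
      using \<epsilon> by (intro mult_left_mono xs) auto
    finally have m2: "m\<^sup>2 \<le> c\<^sub>2\<^sup>2 * \<epsilon> * (- ln \<epsilon> / (4 * \<kappa>)) powr (s / \<tau>)" .
    have e2: "\<epsilon> = \<epsilon> powr (1/2) * \<epsilon> powr (1/2)" using \<epsilon> by (simp add: powr_add[symmetric])
    have "m\<^sup>2 / ?D * (1 + 2 * ?\<sigma>) powr (- q) \<le> m\<^sup>2 / ?D * 1"
      using D by (intro mult_left_mono q1) auto
    \<comment> \<open>The numerator carries beta^(2 s) = eps, the denominator only eps^(1/2) / 4.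
      What is left is 4 \<open>c\<^sub>2\<^sup>2\<close> eps^(1/2) times a power of the logarithm,
      the expression in the smallness assumption.\<close>
    also have "\<dots> \<le> c\<^sub>2\<^sup>2 * \<epsilon> * (- ln \<epsilon> / (4 * \<kappa>)) powr (s / \<tau>) / (\<epsilon> powr (1/2) / 4)"
      unfolding mult_1_right using \<epsilon> Dge m2 order_trans[OF zero_le_power2 m2] by (intro frac_le) auto
    also have "\<dots> = 4 * c\<^sub>2\<^sup>2 * \<epsilon> powr (1/2) * (- ln \<epsilon> / (4 * \<kappa>)) powr (s / \<tau>)"
      using \<epsilon>(1) by (subst e2) (simp add: field_simps)
    also have "\<dots> \<le> 1 * (- ln \<epsilon>) powr (- q)" using \<epsilon>(6) by simp
    also have "\<dots> \<le> (2 powr q + 1) * (- ln \<epsilon>) powr (- q)" by (intro mult_right_mono) auto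
    finally show ?thesis .
  qed
qed

text \<open>A nonnegative function with zero integral vanishes a.e., whereas here it is positive on
  an interval of length T. It gives the heat symbol genuine decay.\<close>

lemma set_integral_pos:
  fixes \<gamma> :: "real \<Rightarrow> real"
  assumes T: "T > 0" and \<gamma>: "set_integrable lborel {0<..<T} \<gamma>" "\<forall>l\<in>{0<..<T}. \<gamma> l > 0"
  shows "(LINT l:{0<..<T}|lborel. \<gamma> l) > 0"
proof -
  have int: "integrable lborel (\<lambda>l. indicator {0<..<T} l *\<^sub>R \<gamma> l)"
    using \<gamma>(1) by (simp add: set_integrable_def)
  have nn: "0 \<le> indicator {0<..<T} l *\<^sub>R \<gamma> l" for l using \<gamma>(2) by (auto simp: indicator_def less_imp_le)
  have "(LINT l|lborel. indicator {0<..<T} l *\<^sub>R \<gamma> l) \<noteq> 0"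
  proof
    assume "(LINT l|lborel. indicator {0<..<T} l *\<^sub>R \<gamma> l) = 0"
    then have "AE l in lborel. indicator {0<..<T} l *\<^sub>R \<gamma> l = 0"
      using integral_nonneg_eq_0_iff_AE[OF int] nn by simp
    then have "AE l in lborel. l \<notin> {0<..<T}"
    proof eventually_elim
      fix l assume "indicator {0<..<T} l *\<^sub>R \<gamma> l = 0"
      then show "l \<notin> {0<..<T}" using bspec[OF \<gamma>(2), of l] by (auto simp: indicator_def)
    qed
    then have "emeasure lborel {0<..<T} = 0"
      by (subst (asm) AE_iff_measurable[of "{0<..<T}"]) auto
    with T show False by simp
  qed
  moreover have "0 \<le> (LINT l|lborel. indicator {0<..<T} l *\<^sub>R \<gamma> l)" using nn by (rule Bochner_Integration.integral_nonneg)
  ultimately show ?thesis by (simp add: set_lebesgue_integral_def)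
qed

text \<open>With D = |a|^2 + m^2 one has D U - cnj a G = m^2 U + cnj a ((a - \<psi>) U + (\<psi> U -
  G)). The summands are the regularisation error, the operator error and the data error.\<close>

lemma regularised_inverse_error:
  fixes a U G :: complex and \<psi> m :: real
  assumes D: "(cmod a)\<^sup>2 + m\<^sup>2 > 0" and a: "cmod (complex_of_real \<psi> - a) \<le> h"
  shows "cmod (U - cnj a * G / complex_of_real ((cmod a)\<^sup>2 + m\<^sup>2)) \<le>
    m\<^sup>2 / ((cmod a)\<^sup>2 + m\<^sup>2) * cmod U + cmod a / ((cmod a)\<^sup>2 + m\<^sup>2) * (h * cmod U + cmod (\<psi> * U - G))"
proof -
  define d where "d = (cmod a)\<^sup>2 + m\<^sup>2"
  have d: "d > 0" using D by (simp add: d_def)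
  have "complex_of_real d = a * cnj a + complex_of_real (m\<^sup>2)"
    by (simp add: d_def complex_norm_square flip: of_real_power)
  then have eq: "complex_of_real d * U - cnj a * G =
      complex_of_real (m\<^sup>2) * U + cnj a * ((a - complex_of_real \<psi>) * U + (\<psi> * U - G))"
    by (simp add: algebra_simps)
  have "U - cnj a * G / complex_of_real d = (complex_of_real d * U - cnj a * G) / complex_of_real d"
    using d by (simp add: diff_divide_distrib)
  then have "cmod (U - cnj a * G / complex_of_real d) =
      cmod (complex_of_real (m\<^sup>2) * U + cnj a * ((a - complex_of_real \<psi>) * U + (\<psi> * U - G))) / d"
    unfolding eq using d by (simp add: norm_divide)
  also have "\<dots> \<le> (m\<^sup>2 * cmod U + cmod a * (h * cmod U + cmod (\<psi> * U - G))) / d"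
  proof (intro divide_right_mono)
    have "cmod ((a - complex_of_real \<psi>) * U + (\<psi> * U - G)) \<le> h * cmod U + cmod (\<psi> * U - G)"
      using a by (intro norm_triangle_mono) (auto simp: norm_mult norm_minus_commute intro: mult_right_mono)
    then show "cmod (complex_of_real (m\<^sup>2) * U + cnj a * ((a - complex_of_real \<psi>) * U + (\<psi> * U - G))) \<le>
        m\<^sup>2 * cmod U + cmod a * (h * cmod U + cmod (\<psi> * U - G))"
      by (intro norm_triangle_mono) (auto simp: norm_mult norm_power intro: mult_left_mono)
  qed (use d in simp)
  finally show ?thesis by (simp add: add_divide_distrib d_def)
qed

subsection \<open>The convergence rate\<close>

theorem theorem3:
  fixes T \<tau> s p Cp :: real
    and \<gamma> :: "real \<Rightarrow> real"
    and \<phi> :: "real^'n \<Rightarrow> real"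
  assumes "T > 0" and "0 < \<tau>" and "\<tau> \<le> 1"
    and "set_integrable lborel {0<..<T} \<gamma>" and "\<forall>l\<in>{0<..<T}. \<gamma> l > 0"
    and "integrable lborel \<phi>" and "smooth \<phi>" and "(LINT x|lborel. \<phi> x) = 1"
    and "\<forall>\<xi>. \<xi> \<noteq> 0 \<longrightarrow> cmod (fourier (\<lambda>x. complex_of_real (\<phi> x)) \<xi>) < 1"
    and "\<forall>\<xi>. fourier (\<lambda>x. complex_of_real (\<phi> x)) \<xi> \<in> \<real>"
    and "\<forall>\<xi>. antimono_on {0..} (\<lambda>t. Re (fourier (\<lambda>x. complex_of_real (\<phi> x)) (t *\<^sub>R \<xi>)))"
    and "s > 0"
    and "(\<lambda>\<xi>. cmod (1 - fourier (\<lambda>x. complex_of_real (\<phi> x)) \<xi>)) \<in> \<Theta>[at 0](\<lambda>\<xi>. norm \<xi> powr s)"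
    and "p > 0"
    and "Cp > 0"
    and "\<forall>E>0. \<forall>v \<in> (sobolev p :: (real^'n \<Rightarrow> complex) set). sobolev_norm p v \<le> E \<longrightarrow>
           (\<exists>w\<in>L2. (AE x in lborel. v x = source_op T \<tau> \<gamma> (p / (2 * \<tau>)) w x) \<and> l2norm w \<le> Cp * E)"
  shows "\<exists>K. \<exists>\<eta>\<^sub>0>0. \<forall>E \<rho> \<delta> h \<beta>. \<forall>(u0 :: real^'n \<Rightarrow> complex) g\<^sub>\<delta> \<psi>\<^sub>h.
    E > 0 \<longrightarrow> \<rho> = Cp * E \<longrightarrow>
    u0 \<in> sobolev p \<longrightarrow> sobolev_norm p u0 \<le> E \<longrightarrow>
    g\<^sub>\<delta> \<in> L2 \<longrightarrow> l2norm (\<lambda>x. heat_op T \<tau> \<gamma> u0 x - g\<^sub>\<delta> x) \<le> \<delta> \<longrightarrow>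
    l2_symbol \<psi>\<^sub>h \<longrightarrow>
    l2_opnorm (\<lambda>f x. heat_op T \<tau> \<gamma> f x - fourier_multiplier \<psi>\<^sub>h f x) \<le> ereal h \<longrightarrow>
    l2_opnorm (fourier_multiplier \<psi>\<^sub>h) \<le> 1 \<longrightarrow>
    0 < h + \<delta> / \<rho> \<longrightarrow> h + \<delta> / \<rho> < \<eta>\<^sub>0 \<longrightarrow>
    \<beta> = (h + \<delta> / \<rho>) powr (1 / (2 * s)) \<longrightarrow>
    (\<exists>u. is_arg_min (objective (fourier_multiplier \<psi>\<^sub>h) \<phi> \<beta> g\<^sub>\<delta>) (\<lambda>u. u \<in> L2) u) \<and>
    (\<forall>u. is_arg_min (objective (fourier_multiplier \<psi>\<^sub>h) \<phi> \<beta> g\<^sub>\<delta>) (\<lambda>u. u \<in> L2) u \<longrightarrow>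
       l2norm (\<lambda>x. u0 x - u x) \<le> K * \<rho> * log_index (p / (2 * \<tau>)) ((h + \<delta> / \<rho>)\<^sup>2))"
proof -
  let ?q = "p / (2 * \<tau>)"
  define \<Phi> where "\<Phi> = fourier (\<lambda>x. complex_of_real (\<phi> x))"
  \<comment> \<open>Absorbs the factor 2 pi and the time integral, so that the heat symbol is
    exp(-\<kappa> |xi|^(2 \<tau>)).\<close>
  define \<kappa> where "\<kappa> = (2 * pi) powr (2 * \<tau>) * (LINT l:{0<..<T}|lborel. \<gamma> l)"
  define \<psi> where "\<psi> = (heat_symbol T \<tau> \<gamma> :: real^'n \<Rightarrow> real)"
  have \<kappa>: "\<kappa> > 0" using set_integral_pos[OF assms(1,4,5)] by (simp add: \<kappa>_def)
  have q: "?q > 0" using assms(2,14) by simp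
  obtain c\<^sub>1 c\<^sub>2 r where c: "c\<^sub>1 > 0" "c\<^sub>2 > 0" "r > 0"
    and lower: "\<And>\<xi>. \<xi> \<noteq> 0 \<Longrightarrow> c\<^sub>1 * min (norm \<xi>) r powr s \<le> cmod (1 - \<Phi> \<xi>)"
    and upper: "\<And>\<xi>. \<xi> \<noteq> 0 \<Longrightarrow> cmod (1 - \<Phi> \<xi>) \<le> c\<^sub>2 * norm \<xi> powr s"
    using mollifier_symbol_bounds[OF assms(9-13), folded \<Phi>_def] by blast
  obtain \<eta> where \<eta>: "\<eta> > 0" and small: "\<And>\<epsilon>. 0 < \<epsilon> \<Longrightarrow> \<epsilon> < \<eta> \<Longrightarrow> \<epsilon> < 1 \<and> \<epsilon> \<le> exp (- \<kappa>) / 2 \<and>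
      \<epsilon> powr (1 / (2 * s)) \<le> r \<and> \<epsilon> \<le> \<epsilon> powr (1/4) / 2 \<and>
      4 * c\<^sub>2\<^sup>2 * \<epsilon> powr (1/2) * (- ln \<epsilon> / (4 * \<kappa>)) powr (s / \<tau>) \<le> (- ln \<epsilon>) powr (- ?q) \<and>
      \<epsilon> powr (1/2) \<le> (- ln \<epsilon>) powr (- ?q)"
    using small_parameter[OF \<kappa> exp_gt_zero q c(3) assms(12,2)] by blast
  define A where "A = 2 powr ?q + 1"
  define B where "B = 1 / (2 * c\<^sub>1) + 2 * exp \<kappa>"
  have AB: "A > 0" "B > 0" using c(1) by (auto simp: A_def B_def intro: add_nonneg_pos)
  have \<psi>_eq: "\<psi> \<xi> = exp (- (\<kappa> * norm \<xi> powr (2 * \<tau>)))" for \<xi>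
    by (simp add: \<psi>_def heat_symbol_def \<kappa>_def powr_mult)
  have [measurable]: "\<psi> \<in> borel_measurable borel" unfolding \<psi>_eq[abs_def] by measurable
  have \<psi>_symbol: "l2_symbol (\<lambda>\<xi>. complex_of_real (\<psi> \<xi>))"
    by (rule l2_symbol_bounded[where C=1]) (use \<kappa> in \<open>auto simp: \<psi>_eq\<close>)
  have heat: "heat_op T \<tau> \<gamma> = fourier_multiplier (\<lambda>\<xi>::real^'n. complex_of_real (\<psi> \<xi>))"
    by (simp add: heat_op_def \<psi>_def)
  \<comment> \<open>The factor 1/e under the logarithm contributes the summand 1, which keeps the
    base at least 1 and hence \<open>f\<close> at most 1 even at frequency 0.\<close>
  define f where "f \<xi> = (1 + 2 * (\<kappa> * norm \<xi> powr (2 * \<tau>))) powr (- ?q)" for \<xi> :: "real^'n"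
  have f_eq: "log_index ?q ((\<psi> \<xi>)\<^sup>2 / exp 1) = f \<xi>" for \<xi>
  proof -
    have ln_eq: "ln ((\<psi> \<xi>)\<^sup>2 / exp 1) = - (1 + 2 * (\<kappa> * norm \<xi> powr (2 * \<tau>)))"
      by (simp add: \<psi>_eq ln_div ln_realpow)
    show ?thesis unfolding log_index_def f_def ln_eq by (simp only: minus_minus)
  qed
  have f01: "0 \<le> f \<xi>" "f \<xi> \<le> 1" for \<xi>
  proof -
    show "0 \<le> f \<xi>" by (simp add: f_def)
    have "1 powr ?q \<le> (1 + 2 * (\<kappa> * norm \<xi> powr (2 * \<tau>))) powr ?q"
      using \<kappa> q by (intro powr_mono2) auto
    then show "f \<xi> \<le> 1" by (simp add: f_def powr_minus_divide divide_le_eq_1)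
  qed
  have [measurable]: "f \<in> borel_measurable borel" unfolding f_def by measurable
  have f_symbol: "l2_symbol (\<lambda>\<xi>. complex_of_real (f \<xi>))"
    by (rule l2_symbol_bounded[where C=1]) (use f01 in auto)
  have source: "source_op T \<tau> \<gamma> ?q = fourier_multiplier (\<lambda>\<xi>::real^'n. complex_of_real (f \<xi>))"
    unfolding source_op_def \<psi>_def[symmetric] f_eq ..
  have main: "(\<exists>u. is_arg_min (objective (fourier_multiplier a) \<phi> \<beta> g) (\<lambda>u. u \<in> L2) u) \<and>
    (\<forall>u. is_arg_min (objective (fourier_multiplier a) \<phi> \<beta> g) (\<lambda>u. u \<in> L2) u \<longrightarrow>
       l2norm (\<lambda>x. u0 x - u x) \<le> (A + B) * 2 powr ?q * \<rho> * log_index ?q (\<epsilon>\<^sup>2))"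
    if E: "E > 0" and \<rho>: "\<rho> = Cp * E"
      and u0: "u0 \<in> sobolev p" "sobolev_norm p u0 \<le> E"
      and g: "g \<in> L2" "l2norm (\<lambda>x. heat_op T \<tau> \<gamma> u0 x - g x) \<le> \<delta>"
      and a: "l2_symbol a"
      and op: "l2_opnorm (\<lambda>f x. heat_op T \<tau> \<gamma> f x - fourier_multiplier a f x) \<le> ereal h"
      and \<epsilon>: "\<epsilon> = h + \<delta> / \<rho>" "0 < \<epsilon>" "\<epsilon> < \<eta>" and \<beta>: "\<beta> = \<epsilon> powr (1 / (2 * s))"
    for E \<rho> \<delta> h \<epsilon> \<beta> and u0 g a :: "real^'n \<Rightarrow> complex"
  proof -
    note sm = small[OF \<epsilon>(2,3)]
    have \<rho>0: "\<rho> > 0" using E \<rho> assms(15) by simp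
    have \<beta>0: "\<beta> > 0" using \<epsilon>(2) by (simp add: \<beta>)
    have u0L: "u0 \<in> L2" using u0(1) by (simp add: sobolev_def)
    obtain w where w: "w \<in> L2" "AE x in lborel. u0 x = source_op T \<tau> \<gamma> ?q w x" "l2norm w \<le> \<rho>"
      using assms(16) E u0 \<rho> by blast
    have \<delta>: "0 \<le> \<delta>" by (rule order_trans[OF l2norm_nonneg g(2)])
    note bound = l2_opnorm_multiplier_diff_D[OF \<psi>_symbol a op[unfolded heat]]
    have h\<epsilon>: "h \<le> \<epsilon>" using \<delta> \<rho>0 \<epsilon>(1) by simp
    have u0_hat: "AE \<xi> in lborel. l2_fourier u0 \<xi> = complex_of_real (f \<xi>) * l2_fourier w \<xi>"
      using l2_fourier_cong_AE[OF u0L fourier_multiplier_L2[OF f_symbol w(1)] w(2)[unfolded source]]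
        l2_fourier_fourier_multiplier[OF f_symbol w(1)]
      by eventually_elim simp
    define m where "m \<xi> = cmod (1 - \<Phi> (\<beta> *\<^sub>R \<xi>))" for \<xi>
    define D where "D \<xi> = (cmod (a \<xi>))\<^sup>2 + (m \<xi>)\<^sup>2" for \<xi>
    define B' where "B' = B * \<epsilon> powr (- 1/2)"
    define A' where "A' = A * (- ln \<epsilon>) powr (- ?q)"
    \<comment> \<open>The origin is discarded as a null set, since the two-sided bounds on 1 -
      \<Phi> hold only away from it.\<close>
    have symb: "AE \<xi> in lborel. D \<xi> > 0 \<and> cmod (a \<xi>) / D \<xi> \<le> B' \<and> (m \<xi>)\<^sup>2 / D \<xi> * f \<xi> \<le> A'"
      using bound(2) AE_lborel_singleton[of 0]
    proof eventually_elim
      fix \<xi> :: "real^'n" assume a\<xi>: "cmod (complex_of_real (\<psi> \<xi>) - a \<xi>) \<le> h" and \<xi>: "\<xi> \<noteq> 0"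
      have \<beta>\<xi>: "\<beta> *\<^sub>R \<xi> \<noteq> 0" "norm (\<beta> *\<^sub>R \<xi>) = \<epsilon> powr (1 / (2 * s)) * norm \<xi>" using \<xi> \<beta>0 by (auto simp: \<beta>)
      have b: "c\<^sub>1 * min (\<epsilon> powr (1 / (2 * s)) * norm \<xi>) r powr s \<le> m \<xi>"
        "m \<xi> \<le> c\<^sub>2 * (\<epsilon> powr (1 / (2 * s)) * norm \<xi>) powr s"
        using lower[OF \<beta>\<xi>(1)] upper[OF \<beta>\<xi>(1)] unfolding \<beta>\<xi>(2) m_def by auto
      have n\<xi>: "norm \<xi> > 0" using \<xi> by simp
      have a\<epsilon>: "cmod (complex_of_real (exp (- (\<kappa> * norm \<xi> powr (2 * \<tau>)))) - a \<xi>) \<le> \<epsilon>"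
        using order_trans[OF a\<xi> h\<epsilon>] by (simp only: \<psi>_eq)
      show "D \<xi> > 0 \<and> cmod (a \<xi>) / D \<xi> \<le> B' \<and> (m \<xi>)\<^sup>2 / D \<xi> * f \<xi> \<le> A'"
        unfolding D_def B'_def A'_def f_def A_def B_def
        using regularised_symbol_bounds[OF \<epsilon>(2) _ _ _ _ _ \<kappa> assms(12,2) q c(1,2) n\<xi> c(3) a\<epsilon> b] sm by blast
    qed
    have Dpos: "AE \<xi> in lborel. 0 < D \<xi>" and aD: "AE \<xi> in lborel. cmod (a \<xi>) / D \<xi> \<le> B'"
      using symb by (eventually_elim, simp)+
    note arg_min = objective_arg_min[OF assms(6) \<beta>0 a g(1), folded \<Phi>_def, folded m_def, folded D_def, OF Dpos aD]
    show ?thesis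
    proof (intro conjI allI impI)
      show "\<exists>u. is_arg_min (objective (fourier_multiplier a) \<phi> \<beta> g) (\<lambda>u. u \<in> L2) u" by (rule arg_min(1))
      fix u assume "is_arg_min (objective (fourier_multiplier a) \<phi> \<beta> g) (\<lambda>u. u \<in> L2) u"
      from arg_min(2)[OF this]
      have u: "u \<in> L2" and u_hat: "AE \<xi> in lborel. l2_fourier u \<xi> = cnj (a \<xi>) * l2_fourier g \<xi> / complex_of_real (D \<xi>)"
        by auto
      \<comment> \<open>The pointwise majorants are written as complex functions so that the L2
        comparison and triangle inequality apply to them.\<close>
      let ?W = "\<lambda>\<xi>. complex_of_real ((A' + B' * h) * cmod (l2_fourier w \<xi>))"
      let ?R = "\<lambda>\<xi>. complex_of_real (\<psi> \<xi>) * l2_fourier u0 \<xi> - l2_fourier g \<xi>"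
      let ?S = "\<lambda>\<xi>. complex_of_real (B' * cmod (?R \<xi>))"
      have AB': "0 \<le> A'" "0 \<le> B'" using AB by (auto simp: A'_def B'_def)
      have R: "?R \<in> L2"
        using \<psi>_symbol u0L by (intro L2_diff l2_fourier_L2 g) (simp add: l2_symbol_def)
      have normL2: "(\<lambda>\<xi>. complex_of_real (b * cmod (F \<xi>))) \<in> L2"
        "l2norm (\<lambda>\<xi>. complex_of_real (b * cmod (F \<xi>))) = \<bar>b\<bar> * l2norm F" if "F \<in> L2" for F b
      proof -
        note [measurable] = L2_measurable[OF that]
        have "(\<lambda>\<xi>. complex_of_real (cmod (F \<xi>))) \<in> L2" by (rule L2_mono_AE(1)[OF that]) auto
        from L2_mult_const[OF this, of b] show "(\<lambda>\<xi>. complex_of_real (b * cmod (F \<xi>))) \<in> L2" by simp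
        have "l2norm (\<lambda>\<xi>. complex_of_real (b * cmod (F \<xi>))) = l2norm (\<lambda>\<xi>. complex_of_real b * F \<xi>)"
          by (rule l2norm_cong_AE) (auto simp: norm_mult)
        then show "l2norm (\<lambda>\<xi>. complex_of_real (b * cmod (F \<xi>))) = \<bar>b\<bar> * l2norm F"
          by (simp add: l2norm_mult_const)
      qed
      have wL: "l2_fourier w \<in> L2" by (rule l2_fourier_L2[OF w(1)])
      have WS: "?W \<in> L2" "?S \<in> L2" by (intro normL2 wL R)+
      have dL: "(\<lambda>\<xi>. l2_fourier u0 \<xi> - l2_fourier u \<xi>) \<in> L2" by (intro L2_diff l2_fourier_L2 u0L u)
      have pointwise: "AE \<xi> in lborel. cmod (l2_fourier u0 \<xi> - l2_fourier u \<xi>) \<le> cmod (?W \<xi> + ?S \<xi>)"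
        using symb u0_hat u_hat bound(2)
      proof eventually_elim
        fix \<xi>
        assume s\<xi>: "D \<xi> > 0 \<and> cmod (a \<xi>) / D \<xi> \<le> B' \<and> (m \<xi>)\<^sup>2 / D \<xi> * f \<xi> \<le> A'"
          and u0\<xi>: "l2_fourier u0 \<xi> = complex_of_real (f \<xi>) * l2_fourier w \<xi>"
          and u\<xi>: "l2_fourier u \<xi> = cnj (a \<xi>) * l2_fourier g \<xi> / complex_of_real (D \<xi>)"
          and a\<xi>: "cmod (complex_of_real (\<psi> \<xi>) - a \<xi>) \<le> h"
        have n: "cmod (l2_fourier u0 \<xi>) = f \<xi> * cmod (l2_fourier w \<xi>)"
          using f01[of \<xi>] by (simp add: u0\<xi> norm_mult)
        \<comment> \<open>As \<open>f\<close> is at most 1, the operator error can also be charged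
          to \<open>w\<close>, whose norm is at most \<rho>.\<close>
        have n_le: "cmod (l2_fourier u0 \<xi>) \<le> cmod (l2_fourier w \<xi>)"
          unfolding n using f01[of \<xi>] by (intro mult_left_le_one_le) auto
        have "cmod (l2_fourier u0 \<xi> - l2_fourier u \<xi>) \<le>
            (m \<xi>)\<^sup>2 / D \<xi> * cmod (l2_fourier u0 \<xi>) + cmod (a \<xi>) / D \<xi> * (h * cmod (l2_fourier u0 \<xi>) + cmod (?R \<xi>))"
          unfolding u\<xi> D_def using s\<xi>[unfolded D_def] by (intro regularised_inverse_error a\<xi>) auto
        also have "\<dots> \<le> A' * cmod (l2_fourier w \<xi>) + B' * (h * cmod (l2_fourier w \<xi>) + cmod (?R \<xi>))"
        proof (rule add_mono)
          show "(m \<xi>)\<^sup>2 / D \<xi> * cmod (l2_fourier u0 \<xi>) \<le> A' * cmod (l2_fourier w \<xi>)"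
            using mult_right_mono[of "(m \<xi>)\<^sup>2 / D \<xi> * f \<xi>" A' "cmod (l2_fourier w \<xi>)"] s\<xi> by (simp add: n mult.assoc)
          show "cmod (a \<xi>) / D \<xi> * (h * cmod (l2_fourier u0 \<xi>) + cmod (?R \<xi>)) \<le> B' * (h * cmod (l2_fourier w \<xi>) + cmod (?R \<xi>))"
            using s\<xi> AB' bound(1) n_le by (intro mult_mono add_mono mult_left_mono) auto
        qed
        also have "\<dots> = (A' + B' * h) * cmod (l2_fourier w \<xi>) + B' * cmod (?R \<xi>)" by (simp add: algebra_simps)
        also have "\<dots> \<le> cmod (?W \<xi> + ?S \<xi>)"
          unfolding of_real_add[symmetric] norm_of_real by (rule abs_ge_self)
        finally show "cmod (l2_fourier u0 \<xi> - l2_fourier u \<xi>) \<le> cmod (?W \<xi> + ?S \<xi>)" .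
      qed
      have R\<delta>: "l2norm ?R \<le> \<delta>"
      proof -
        have "l2norm ?R = l2norm (\<lambda>\<xi>. l2_fourier (heat_op T \<tau> \<gamma> u0) \<xi> - l2_fourier g \<xi>)"
          unfolding heat
          by (intro l2norm_cong_AE L2_measurable[OF R] L2_measurable[OF L2_diff] l2_fourier_L2 fourier_multiplier_L2 \<psi>_symbol u0L g(1))
             (use l2_fourier_fourier_multiplier[OF \<psi>_symbol u0L] in \<open>eventually_elim, simp\<close>)
        also have "\<dots> = l2norm (\<lambda>x. heat_op T \<tau> \<gamma> u0 x - g x)"
          unfolding heat by (intro l2norm_l2_fourier_diff fourier_multiplier_L2 \<psi>_symbol u0L g(1))
        finally show ?thesis using g(2) by simp
      qed
      have "l2norm (\<lambda>x. u0 x - u x) = l2norm (\<lambda>\<xi>. l2_fourier u0 \<xi> - l2_fourier u \<xi>)"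
        by (rule l2norm_l2_fourier_diff[OF u0L u, symmetric])
      also have "\<dots> \<le> l2norm (\<lambda>\<xi>. ?W \<xi> + ?S \<xi>)"
        by (rule L2_mono_AE(2)[OF L2_add[OF WS] L2_measurable[OF dL] pointwise])
      also have "\<dots> \<le> l2norm ?W + l2norm ?S" by (rule l2norm_triangle[OF WS])
      also have "\<dots> = (A' + B' * h) * l2norm w + B' * l2norm ?R"
        using AB' bound(1) by (simp only: normL2(2)[OF wL] normL2(2)[OF R] l2norm_l2_fourier[OF w(1)]) simp
      also have "\<dots> \<le> (A' + B' * h) * \<rho> + B' * \<delta>"
        using AB' bound(1) by (intro add_mono mult_left_mono w(3) R\<delta>) auto
      \<comment> \<open>Here h \<rho> + \<delta> = eps \<rho>, the reason for measuring the noise by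
        h + \<delta>/\<rho>.\<close>
      also have "\<dots> = (A' + B' * \<epsilon>) * \<rho>" using \<rho>0 by (simp add: \<epsilon>(1) algebra_simps)
      also have "B' * \<epsilon> = B * \<epsilon> powr (1/2)"
      proof -
        have "\<epsilon> powr (- 1/2) * \<epsilon> powr 1 = \<epsilon> powr (1/2)" unfolding powr_add[symmetric] by simp
        then show ?thesis using \<epsilon>(2) by (simp add: B'_def)
      qed
      also have "(A' + B * \<epsilon> powr (1/2)) * \<rho> \<le> (A' + B * (- ln \<epsilon>) powr (- ?q)) * \<rho>"
        using sm AB \<rho>0 by (intro mult_right_mono add_left_mono mult_left_mono) auto
      \<comment> \<open>Since -ln(eps^2) = 2 (-ln eps), passing to the argument eps^2 produces the
        factor 2^q of the final constant.\<close>
      also have "\<dots> = (A + B) * 2 powr ?q * \<rho> * log_index ?q (\<epsilon>\<^sup>2)"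
      proof -
        have "log_index ?q (\<epsilon>\<^sup>2) = (2 * (- ln \<epsilon>)) powr (- ?q)"
          using \<epsilon>(2) by (simp add: log_index_def ln_realpow)
        also have "\<dots> = 2 powr (- ?q) * (- ln \<epsilon>) powr (- ?q)" by (rule powr_mult)
        finally have "2 powr ?q * log_index ?q (\<epsilon>\<^sup>2) = (- ln \<epsilon>) powr (- ?q)"
          by (simp add: powr_minus)
        then show ?thesis by (simp add: A'_def algebra_simps)
      qed
      finally show "l2norm (\<lambda>x. u0 x - u x) \<le> (A + B) * 2 powr ?q * \<rho> * log_index ?q (\<epsilon>\<^sup>2)" .
    qed
  qed
  \<comment> \<open>\<open>A\<close>, \<open>B\<close> and \<eta> were fixed from the kernel, the
    heat symbol and the exponents before any data were introduced, so they are uniform in E,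
    \<delta> and h.\<close>
  show ?thesis
  proof (rule exI[of _ "(A + B) * 2 powr ?q"], rule exI[of _ \<eta>], rule conjI[OF \<eta>], intro allI impI, goal_cases)
    case (1 E \<rho> \<delta> h \<beta> u0 g a)
    show ?case by (rule main[OF 1(1-8) refl 1(10-12)])
  qed
qed

end
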